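(* (The Coincidence Theorem.) Let $M$ be a microlinear space, $G$ a groupoid over $M$, $L$ a group bundle over $M$, and $\rho$ a representation of the Nishimura algebroid $\mathcal{A}G$ of $G$ in the vector bundle $\mathcal{A}^{1}L$. Then the additive coboundary operator $\mathbf{d}_{+}:\mathbf{C}^{n}(G,\mathcal{A}^{1}L)\to\mathbf{C}^{n+1}(G,\mathcal{A}^{1}L)$ with respect to $\rho$ and the multiplicative coboundary operator $\mathbf{d}_{\times}:\mathbf{C}^{n}(G,\mathcal{A}^{1}L)\to\mathbf{C}^{n+1}(G,\mathcal{A}^{1}L)$ with respect to $\rho$ coincide for any natural number $n$.
   Context: Setting: synthetic differential geometry (internal, intuitionistic reasoning). $\mathbb{R}$ is the line object satisfying the general Kock–Lawvere axiom, $D=\{d\in\mathbb{R}: d^2=0\}$, $D(2)=\{(d_1,d_2)\in D^2: d_1d_2=0\}$; all spaces are assumed microlinear. A vector bundle over $M$ is a map $E\to M$ whose fibers $E_x$ are Euclidean $\mathbb{R}$-modules (for each $F:D\to E_x$ there is a unique $b\in E_x$ with $F(d)=F(0)+db$ for all $d\in D$). A hat denotes omission of a factor. Groupoids: a groupoid $G$ over $M$ has source and target $\alpha,\beta:G\to M$ and identities $\mathrm{id}_x$; $gh$ is defined when $\alpha(g)=\beta(h)$. $\mathcal{A}^n_xG$ is the set of maps $\gamma:D^n\to G$ with $\gamma(0,\dots,0)=\mathrm{id}_x$ and $\alpha\circ\gamma$ constantly $x$; $\mathcal{A}^nG=\bigcup_{x\in M}\mathcal{A}^n_xG$, and $\pi_n:\mathcal{A}^nG\to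 M$ sends $\mathcal{A}^n_xG$ to $x$ (the base point). Write $\gamma_{d_1,\dots,d_n}=\gamma(d_1,\dots,d_n)$. $\mathcal{A}^1G$ is a vector bundle over $M$: $(at)_d=t_{ad}$, and $(t+t')_d=l(d,d)$ where $l:D(2)\to G$ is the unique map into $\alpha^{-1}(x)$ with $l(d,0)=t_d$, $l(0,d)=t'_d$. The anchor $\mathbf{a}_n:\mathcal{A}^nG\to M^{D^n}$ is $\gamma\mapsto\beta\circ\gamma$. For $i=1,2$: $\mathbf{s}_i:\mathcal{A}^1G\to\mathcal{A}^2G$, $\mathbf{s}_1(t)_{d_1,d_2}=t_{d_2}$, $\mathbf{s}_2(t)_{d_1,d_2}=t_{d_1}$; $\mathbf{d}_i:\mathcal{A}^2G\to\mathcal{A}^1G$, $\mathbf{d}_1(\gamma)_d=\gamma_{0,d}$, $\mathbf{d}_2(\gamma)_d=\gamma_{d,0}$. $\mathcal{A}^2G$ is a double vector bundle: its fibers over $\mathcal{A}^1G$ along $\mathbf{d}_1$ (resp. $\mathbf{d}_2$) are $\mathbb{R}$-modules, with addition and scalar multiplication performed as for $\mathcal{A}^1$ in the first (resp. second) variable, the other variable being a parameter. For $\zeta\in(\mathcal{A}^1G)^D$, $t\in\mathcal{A}^1G$ with $\pi_1(\zeta(d))=\beta(t_d)$ for all $d$, $\zeta\ast t\in\mathcal{A}^2G$ is $(\zeta\ast t)_{d_1,d_2}=\zeta(d_1)_{d_2}\,t_{d_1}$. The Nishimura algebroid $\mathcal{A}G$ is $(\mathcal{A}^1G,\mathcal{A}^2G)$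 with these structures. A homomorphism $\mathcal{A}G\to\mathcal{A}G'$ ($G,G'$ over the same $M$) is a pair $(\varphi_1,\varphi_2)$, $\varphi_k:\mathcal{A}^kG\to\mathcal{A}^kG'$, compatible with $\pi_k,\mathbf{a}_k,\mathbf{s}_i,\mathbf{d}_i$, with $\varphi_1$ fiberwise linear, $\varphi_2$ a morphism of double vector bundles, and $\varphi_2(\zeta\ast t)=(\varphi_1\circ\zeta)\ast\varphi_1(t)$. A representation $\rho$ of $\mathcal{A}G$ in a vector bundle $E$ is a homomorphism $\mathcal{A}G\to\mathcal{A}(\Phi_{\mathrm{Lin}}(E))$, where $\Phi_{\mathrm{Lin}}(E)$ is the groupoid over $M$ whose arrows $x\to y$ are the linear isomorphisms $E_x\to E_y$. For $t\in\mathcal{A}^1_xG$ write $\rho(t)=\rho_1(t)$; so $\rho(t)_d:E_x\to E_{\beta(t_d)}$ is a linear isomorphism. Forms: $\mathbf{C}^n(G,E)$ is the set of maps $\omega:\mathcal{A}^nG\to E$ with $\omega(\mathcal{A}^n_xG)\subseteq E_x$ such that (1) $\omega(a\cdot_i\gamma)=a\,\omega(\gamma)$ for $a\in\mathbb{R}$, $1\le i\le n$, where $(a\cdot_i\gamma)_{d_1,\dots,d_n}=\gamma_{d_1,\dots,ad_i,\dots,d_n}$; (2) $\omega(\gamma\circ D^\sigma)=\mathrm{sign}(\sigma)\omega(\gamma)$ for each permutation $\sigma$ of $\{1,\dots,n\}$, where $D^\sigma:D^n\to D^n$ permutes coordinates by $\sigma$. For $\gamma\in\mathcal{A}^{n+1}G$,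 $e\in D$, $1\le i\le n+1$: $\gamma^i_e\in\mathcal{A}^nG$ is $\gamma^i_e(d_1,\dots,d_n)=\gamma(d_1,\dots,d_{i-1},e,d_i,\dots,d_n)\,\gamma(0,\dots,0,e,0,\dots,0)^{-1}$ ($e$ in the $i$-th slot), and $\gamma_i\in\mathcal{A}^1G$ is $\gamma_i(d)=\gamma(0,\dots,0,d,0,\dots,0)$ ($d$ in the $i$-th slot). Group bundle: $L$ is a groupoid over $M$ with $\alpha=\beta$, i.e. a family of groups $L_x$, $x\in M$. $\mathcal{A}^1_xL$ is the set of maps $t:D\to L_x$ with $t_0=\mathrm{id}_x$, and $\mathcal{A}^1L=\bigcup_{x\in M}\mathcal{A}^1_xL$ is a vector bundle over $M$ with fibers $\mathcal{A}^1_xL$, where $(at)_d=t_{ad}$ for $a\in\mathbb{R}$, and $(t+t')_d=l(d,d)$ with $l:D(2)\to L_x$ the unique map such that $l(d,0)=t_d$, $l(0,d)=t'_d$ for all $d\in D$. Additive coboundary operator: for $\omega\in\mathbf{C}^n(G,E)$ and $\rho$ a representation in $E$, $\mathbf{d}_+\omega\in\mathbf{C}^{n+1}(G,E)$ is defined as the unique form with $$d_1\cdots d_{n+1}\,\mathbf{d}_+\omega(\gamma)=\sum_{i=1}^{n+1}(-1)^i d_1\cdots\widehat{d_i}\cdots d_{n+1}\{\omega(\gamma^i_0)-(\rho(\gamma_i)_{d_i})^{-1}(\omega(\gamma^i_{d_i}))\}$$ for all $\gamma\in\mathcal{A}^{n+1}G$, $(d_1,\dots,d_{n+1})\in D^{n+1}$;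 here $E=\mathcal{A}^1L$. Multiplicative coboundary operator: for $\omega\in\mathbf{C}^n(G,\mathcal{A}^1L)$, $\mathbf{d}_\times\omega\in\mathbf{C}^{n+1}(G,\mathcal{A}^1L)$ is defined as the unique form with $$((\mathbf{d}_{\times}\omega)(\gamma))_{d_{1}\cdots d_{n+1}}=\prod_{i=1}^{n+1}\Big\{(\omega(\gamma_{0}^{i}))_{d_{1}\cdots\widehat{d_{i}}\cdots d_{n+1}}\big((\rho(\gamma_{i})_{d_{i}})^{-1}(\omega(\gamma_{d_{i}}^{i}))\big)_{-d_{1}\cdots\widehat{d_{i}}\cdots d_{n+1}}\Big\}^{(-1)^{i}}$$ for all $\gamma\in\mathcal{A}^{n+1}G$, $(d_1,\dots,d_{n+1})\in D^{n+1}$ (product in the group $L_x$, $x=\pi_{n+1}(\gamma)$). The paper asserts existence and uniqueness of both forms.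
   Formalization: The theorem is proved for n ≥ 1 only: for n = 0 the formula defining the multiplicative coboundary evaluates a map on D at the empty product 1, which is not in D, so the multiplicative operator is undefined there. *)

theory Defs
  imports "HOL-Algebra.Ring" "HOL-Combinatorics.Permutations"
begin

text \<open>
  The general Kock--Lawvere axiom is inconsistent with excluded middle if it is read for all
  HOL functions, so the internal (intuitionistic) statements are interpreted by their
  Kripke--Joyal semantics over an arbitrary small category.  A space is a presheaf of sets; an
  element of it is an element at some stage \<open>c\<close>, and \<open>rst X f x\<close> is its restriction along
  \<open>f : c' \<rightarrow> c\<close>.  Universal quantifiers, implications and internal functions range over all later
  stages.  The internal notions below only use \<open>\<forall>\<close>, \<open>\<Rightarrow>\<close>, \<open>\<and>\<close>, \<open>=\<close> and \<open>\<exists>!\<close>, whose Kripke--Joyal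
  clauses involve no covers.  Since the Yoneda embedding of a topos into its presheaves, and the
  inclusion of sheaves into presheaves, preserve finite limits and local exponentials, presheaves
  on an arbitrary category also account for arbitrary toposes.
\<close>

text \<open>All elements of the type \<open>'o\<close> are objects, all elements of the type \<open>'a\<close> are arrows;
  \<open>Cmp f g\<close> is \<open>f\<close> after \<open>g\<close>.\<close>

record ('o, 'a) cat_data =
  Dom :: "'a \<Rightarrow> 'o"
  Cod :: "'a \<Rightarrow> 'o"
  Idn :: "'o \<Rightarrow> 'a"
  Cmp :: "'a \<Rightarrow> 'a \<Rightarrow> 'a"

definition category :: "('o, 'a, 'z) cat_data_scheme \<Rightarrow> bool" where
  "category S \<longleftrightarrow>
    (\<forall>c. Dom S (Idn S c) = c \<and> Cod S (Idn S c) = c) \<and>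
    (\<forall>f g. Cod S g = Dom S f \<longrightarrow>
      Dom S (Cmp S f g) = Dom S g \<and> Cod S (Cmp S f g) = Cod S f) \<and>
    (\<forall>f. Cmp S f (Idn S (Dom S f)) = f \<and> Cmp S (Idn S (Cod S f)) f = f) \<and>
    (\<forall>f g h. Cod S g = Dom S f \<longrightarrow> Cod S h = Dom S g \<longrightarrow>
      Cmp S (Cmp S f g) h = Cmp S f (Cmp S g h))"

record ('o, 'a, 'x) psh_data =
  el :: "'o \<Rightarrow> 'x set"
  rst :: "'a \<Rightarrow> 'x \<Rightarrow> 'x"

definition presheaf ::
  "('o, 'a, 'y) cat_data_scheme \<Rightarrow> ('o, 'a, 'x, 'z) psh_data_scheme \<Rightarrow> bool" where
  "presheaf S X \<longleftrightarrow>
    (\<forall>f. \<forall>x\<in>el X (Cod S f). rst X f x \<in> el X (Dom S f)) \<and>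
    (\<forall>c. \<forall>x\<in>el X c. rst X (Idn S c) x = x) \<and>
    (\<forall>f g. Cod S g = Dom S f \<longrightarrow>
      (\<forall>x\<in>el X (Cod S f). rst X (Cmp S f g) x = rst X g (rst X f x)))"

text \<open>The line is a presheaf of commutative rings, and an algebra over the ground ring \<open>'k\<close>
  (for instance the integers, the rationals or the reals) by means of \<open>scal\<close>.\<close>

record ('o, 'a, 'r, 'k) line_data = "('o, 'a) cat_data" +
  rng :: "'o \<Rightarrow> 'r ring"
  rres :: "'a \<Rightarrow> 'r \<Rightarrow> 'r"
  scal :: "'k \<Rightarrow> 'o \<Rightarrow> 'r"

definition line_psh :: "('o, 'a, 'r, 'k) line_data \<Rightarrow> ('o, 'a, 'r) psh_data" where
  "line_psh S = \<lparr>el = (\<lambda>c. carrier (rng S c)), rst = rres S\<rparr>"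

definition algebra_object :: "('o, 'a, 'r, 'k::comm_ring_1) line_data \<Rightarrow> bool" where
  "algebra_object S \<longleftrightarrow>
    category S \<and> presheaf S (line_psh S) \<and>
    (\<forall>c. cring (rng S c)) \<and>
    (\<forall>f. rres S f \<in> ring_hom (rng S (Cod S f)) (rng S (Dom S f))) \<and>
    (\<forall>c. (\<forall>a. scal S a c \<in> carrier (rng S c)) \<and>
      scal S 1 c = \<one>\<^bsub>rng S c\<^esub> \<and>
      (\<forall>a b. scal S (a + b) c = scal S a c \<oplus>\<^bsub>rng S c\<^esub> scal S b c \<and>
             scal S (a * b) c = scal S a c \<otimes>\<^bsub>rng S c\<^esub> scal S b c)) \<and>
    (\<forall>f a. rres S f (scal S a (Cod S f)) = scal S a (Dom S f))"

text \<open>Infinitesimal spaces are subpresheaves of finite powers of the line, so their elements are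
  lists.  An element at stage \<open>c\<close> of the exponential \<open>X\<^sup>P\<close> is a natural family indexed by
  the arrows into \<open>c\<close>; its value at a point \<open>d\<close> of \<open>P\<close> at the same stage is
  \<open>\<gamma> (Idn S c) d\<close>.  Outside its proper domain a family is \<open>undefined\<close>.\<close>

definition expo ::
  "('o, 'a, 'r, 'k) line_data \<Rightarrow> ('o \<Rightarrow> 'r list set) \<Rightarrow> ('o, 'a, 'x, 'z) psh_data_scheme \<Rightarrow> 'o
    \<Rightarrow> ('a \<Rightarrow> 'r list \<Rightarrow> 'x) set" where
  "expo S P X c = {\<gamma>.
    (\<forall>f d. Cod S f = c \<longrightarrow> d \<in> P (Dom S f) \<longrightarrow> \<gamma> f d \<in> el X (Dom S f)) \<and>
    (\<forall>f d. \<not> (Cod S f = c \<and> d \<in> P (Dom S f)) \<longrightarrow> \<gamma> f d = undefined) \<and>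
    (\<forall>f g d. Cod S f = c \<longrightarrow> Cod S g = Dom S f \<longrightarrow> d \<in> P (Dom S f) \<longrightarrow>
      \<gamma> (Cmp S f g) (map (rres S g) d) = rst X g (\<gamma> f d))}"

definition exp_rst ::
  "('o, 'a, 'z) cat_data_scheme \<Rightarrow> 'a \<Rightarrow> ('a \<Rightarrow> 'b \<Rightarrow> 'x) \<Rightarrow> 'a \<Rightarrow> 'b \<Rightarrow> 'x" where
  "exp_rst S h \<gamma> = (\<lambda>f d. if Cod S f = Dom S h then \<gamma> (Cmp S h f) d else undefined)"

definition lam ::
  "('o, 'a, 'z) cat_data_scheme \<Rightarrow> ('o \<Rightarrow> 'b set) \<Rightarrow> 'o \<Rightarrow> ('a \<Rightarrow> 'b \<Rightarrow> 'x) \<Rightarrow> 'a \<Rightarrow> 'b \<Rightarrow> 'x" where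
  "lam S P c u = (\<lambda>f d. if Cod S f = c \<and> d \<in> P (Dom S f) then u f d else undefined)"

text \<open>A Weil algebra is an algebra structure on \<open>k\<^sup>n\<close> with unit \<open>(1, 0, \<dots>, 0)\<close> for which the
  vectors with first coordinate \<open>0\<close> form a nilpotent ideal.  The bilinear multiplication is given
  by its structure constants: \<open>e\<^sub>i e\<^sub>j = \<Sum>\<^sub>l wtab i j l \<cdot> e\<^sub>l\<close>.\<close>

record 'k weil_data =
  wdim :: nat
  wtab :: "nat \<Rightarrow> nat \<Rightarrow> nat \<Rightarrow> 'k"

definition wvec :: "'k::comm_ring_1 weil_data \<Rightarrow> (nat \<Rightarrow> 'k) set" where
  "wvec W = {x. \<forall>i\<ge>wdim W. x i = 0}"

definition wmul :: "'k::comm_ring_1 weil_data \<Rightarrow> (nat \<Rightarrow> 'k) \<Rightarrow> (nat \<Rightarrow> 'k) \<Rightarrow> nat \<Rightarrow> 'k" where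
  "wmul W x y = (\<lambda>l. if l < wdim W
    then \<Sum>i<wdim W. \<Sum>j<wdim W. x i * y j * wtab W i j l else 0)"

definition wone :: "nat \<Rightarrow> 'k::comm_ring_1" where
  "wone = (\<lambda>i. if i = 0 then 1 else 0)"

definition waug :: "'k::comm_ring_1 weil_data \<Rightarrow> (nat \<Rightarrow> 'k) set" where
  "waug W = {x \<in> wvec W. x 0 = 0}"

definition weil_algebra :: "'k::comm_ring_1 weil_data \<Rightarrow> bool" where
  "weil_algebra W \<longleftrightarrow> 0 < wdim W \<and>
    (\<forall>x\<in>wvec W. wmul W wone x = x) \<and>
    (\<forall>x\<in>wvec W. \<forall>y\<in>wvec W. wmul W x y = wmul W y x) \<and>
    (\<forall>x\<in>wvec W. \<forall>y\<in>wvec W. \<forall>z\<in>wvec W. wmul W (wmul W x y) z = wmul W x (wmul W y z)) \<and>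
    (\<forall>x\<in>wvec W. \<forall>y\<in>waug W. wmul W x y \<in> waug W) \<and>
    (\<exists>N. \<forall>xs. length xs = N \<longrightarrow> set xs \<subseteq> waug W \<longrightarrow> foldr (wmul W) xs wone = (\<lambda>_. 0))"

text \<open>The object of algebra homomorphisms from \<open>W\<close> to the line; a homomorphism is the list of
  its values at the basis vectors.\<close>

definition Spec :: "('o, 'a, 'r, 'k) line_data \<Rightarrow> 'k weil_data \<Rightarrow> 'o \<Rightarrow> 'r list set" where
  "Spec S W c = {p. length p = wdim W \<and> set p \<subseteq> carrier (rng S c) \<and> p ! 0 = \<one>\<^bsub>rng S c\<^esub> \<and>
    (\<forall>i<wdim W. \<forall>j<wdim W. p ! i \<otimes>\<^bsub>rng S c\<^esub> p ! j =
      (\<Oplus>\<^bsub>rng S c\<^esub>l\<in>{..<wdim W}. scal S (wtab W i j l) c \<otimes>\<^bsub>rng S c\<^esub> p ! l))}"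

text \<open>The canonical map from \<open>R \<otimes> W\<close> to \<open>R\<^sup>S\<^sup>p\<^sup>e\<^sup>c\<^sup> \<^sup>W\<close> is invertible.\<close>

definition kock_lawvere :: "('o, 'a, 'r, 'k::comm_ring_1) line_data \<Rightarrow> bool" where
  "kock_lawvere S \<longleftrightarrow> (\<forall>W. weil_algebra W \<longrightarrow>
    (\<forall>c. \<forall>F\<in>expo S (Spec S W) (line_psh S) c.
      \<exists>!w. length w = wdim W \<and> set w \<subseteq> carrier (rng S c) \<and>
        (\<forall>f p. Cod S f = c \<longrightarrow> p \<in> Spec S W (Dom S f) \<longrightarrow>
          F f p = (\<Oplus>\<^bsub>rng S (Dom S f)\<^esub>i\<in>{..<wdim W}.
            rres S f (w ! i) \<otimes>\<^bsub>rng S (Dom S f)\<^esub> p ! i))))"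

definition line_object :: "('o, 'a, 'r, 'k::comm_ring_1) line_data \<Rightarrow> bool" where
  "line_object S \<longleftrightarrow> algebra_object S \<and> kock_lawvere S"

definition inf_map ::
  "('o, 'a, 'r, 'k) line_data \<Rightarrow> ('o \<Rightarrow> 'r list set) \<Rightarrow> ('o \<Rightarrow> 'r list set)
    \<Rightarrow> ('o \<Rightarrow> 'r list \<Rightarrow> 'r list) \<Rightarrow> bool" where
  "inf_map S P Q h \<longleftrightarrow>
    (\<forall>c. \<forall>p\<in>P c. h c p \<in> Q c) \<and>
    (\<forall>f. \<forall>p\<in>P (Cod S f). h (Dom S f) (map (rres S f) p) = map (rres S f) (h (Cod S f) p))"

definition precomp ::
  "('o, 'a, 'r, 'k) line_data \<Rightarrow> ('o \<Rightarrow> 'r list set) \<Rightarrow> ('o \<Rightarrow> 'r list \<Rightarrow> 'r list) \<Rightarrow> 'o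
    \<Rightarrow> ('a \<Rightarrow> 'r list \<Rightarrow> 'x) \<Rightarrow> 'a \<Rightarrow> 'r list \<Rightarrow> 'x" where
  "precomp S P h c \<gamma> = lam S P c (\<lambda>f p. \<gamma> f (h (Dom S f) p))"

text \<open>A finite diagram of infinitesimal spaces has the vertices \<open>Spec W\<close> for \<open>W\<close> in the list
  \<open>Ws\<close>; an edge \<open>(i, j, h)\<close> is a map \<open>h\<close> from the \<open>i\<close>-th to the \<open>j\<close>-th vertex.  A cocone has the
  vertex \<open>Spec V\<close> and the legs \<open>q ! i\<close>.\<close>

definition inf_cocone ::
  "('o, 'a, 'r, 'k::comm_ring_1) line_data \<Rightarrow> 'k weil_data list
    \<Rightarrow> (nat \<times> nat \<times> ('o \<Rightarrow> 'r list \<Rightarrow> 'r list)) list \<Rightarrow> 'k weil_data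
    \<Rightarrow> ('o \<Rightarrow> 'r list \<Rightarrow> 'r list) list \<Rightarrow> bool" where
  "inf_cocone S Ws es V q \<longleftrightarrow>
    (\<forall>W\<in>set Ws. weil_algebra W) \<and> weil_algebra V \<and> length q = length Ws \<and>
    (\<forall>i<length Ws. inf_map S (Spec S (Ws ! i)) (Spec S V) (q ! i)) \<and>
    (\<forall>(i, j, h)\<in>set es. i < length Ws \<and> j < length Ws \<and>
      inf_map S (Spec S (Ws ! i)) (Spec S (Ws ! j)) h \<and>
      (\<forall>c. \<forall>p\<in>Spec S (Ws ! i) c. (q ! j) c (h c p) = (q ! i) c p))"

text \<open>\<open>X\<close> perceives the cocone as a colimit, i.e. \<open>X\<close> to the power of the cocone is a limit.\<close>

definition perceives_colimit ::
  "('o, 'a, 'r, 'k::comm_ring_1) line_data \<Rightarrow> ('o, 'a, 'x, 'z) psh_data_scheme \<Rightarrow> 'k weil_data list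
    \<Rightarrow> (nat \<times> nat \<times> ('o \<Rightarrow> 'r list \<Rightarrow> 'r list)) list \<Rightarrow> 'k weil_data
    \<Rightarrow> ('o \<Rightarrow> 'r list \<Rightarrow> 'r list) list \<Rightarrow> bool" where
  "perceives_colimit S X Ws es V q \<longleftrightarrow>
    (\<forall>c \<gamma>. (\<forall>i<length Ws. \<gamma> i \<in> expo S (Spec S (Ws ! i)) X c) \<longrightarrow>
      (\<forall>(i, j, h)\<in>set es. precomp S (Spec S (Ws ! i)) h c (\<gamma> j) = \<gamma> i) \<longrightarrow>
      (\<exists>!\<delta>. \<delta> \<in> expo S (Spec S V) X c \<and>
        (\<forall>i<length Ws. precomp S (Spec S (Ws ! i)) (q ! i) c \<delta> = \<gamma> i)))"

definition microlinear ::
  "('o, 'a, 'r, 'k::comm_ring_1) line_data \<Rightarrow> ('o, 'a, 'x, 'z) psh_data_scheme \<Rightarrow> bool" where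
  "microlinear S X \<longleftrightarrow> (\<forall>Ws es V q. inf_cocone S Ws es V q \<longrightarrow>
    perceives_colimit S (line_psh S) Ws es V q \<longrightarrow> perceives_colimit S X Ws es V q)"

definition DD :: "('o, 'a, 'r, 'k) line_data \<Rightarrow> 'o \<Rightarrow> 'r set" where
  "DD S c = {d \<in> carrier (rng S c). d \<otimes>\<^bsub>rng S c\<^esub> d = \<zero>\<^bsub>rng S c\<^esub>}"

definition cube :: "('o, 'a, 'r, 'k) line_data \<Rightarrow> nat \<Rightarrow> 'o \<Rightarrow> 'r list set" where
  "cube S n c = {d. length d = n \<and> set d \<subseteq> DD S c}"

text \<open>\<open>D\<^sup>i \<times> D(2) \<times> D\<^sup>n\<^sup>-\<^sup>i\<^sup>-\<^sup>1\<close>, with \<open>i\<close> counted from \<open>0\<close>\<close>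

definition cube_D2 :: "('o, 'a, 'r, 'k) line_data \<Rightarrow> nat \<Rightarrow> nat \<Rightarrow> 'o \<Rightarrow> 'r list set" where
  "cube_D2 S n i c =
    {v \<in> cube S (Suc n) c. v ! i \<otimes>\<^bsub>rng S c\<^esub> v ! Suc i = \<zero>\<^bsub>rng S c\<^esub>}"

definition ins :: "nat \<Rightarrow> 'b \<Rightarrow> 'b list \<Rightarrow> 'b list" where
  "ins i e d = take i d @ e # drop i d"

definition del :: "nat \<Rightarrow> 'b list \<Rightarrow> 'b list" where
  "del i d = take i d @ drop (Suc i) d"

definition zeros :: "('o, 'a, 'r, 'k) line_data \<Rightarrow> 'o \<Rightarrow> nat \<Rightarrow> 'r list" where
  "zeros S c n = replicate n \<zero>\<^bsub>rng S c\<^esub>"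

definition axis :: "('o, 'a, 'r, 'k) line_data \<Rightarrow> 'o \<Rightarrow> nat \<Rightarrow> nat \<Rightarrow> 'r \<Rightarrow> 'r list" where
  "axis S c n i e = (zeros S c n)[i := e]"

definition rprod :: "('o, 'a, 'r, 'k) line_data \<Rightarrow> 'o \<Rightarrow> 'r list \<Rightarrow> 'r" where
  "rprod S c d = foldr (\<otimes>\<^bsub>rng S c\<^esub>) d \<one>\<^bsub>rng S c\<^esub>"

record ('o, 'a, 'm, 'g) groupoid_data = "('o, 'a, 'g) psh_data" +
  src :: "'o \<Rightarrow> 'g \<Rightarrow> 'm"
  tgt :: "'o \<Rightarrow> 'g \<Rightarrow> 'm"
  idt :: "'o \<Rightarrow> 'm \<Rightarrow> 'g"
  gcomp :: "'o \<Rightarrow> 'g \<Rightarrow> 'g \<Rightarrow> 'g"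
  ginv :: "'o \<Rightarrow> 'g \<Rightarrow> 'g"

definition groupoid_at :: "'m set \<Rightarrow> ('o, 'a, 'm, 'g) groupoid_data \<Rightarrow> 'o \<Rightarrow> bool" where
  "groupoid_at B G c \<longleftrightarrow>
    (\<forall>g\<in>el G c. src G c g \<in> B \<and> tgt G c g \<in> B) \<and>
    (\<forall>x\<in>B. idt G c x \<in> el G c \<and> src G c (idt G c x) = x \<and> tgt G c (idt G c x) = x) \<and>
    (\<forall>g\<in>el G c. \<forall>h\<in>el G c. src G c g = tgt G c h \<longrightarrow> gcomp G c g h \<in> el G c \<and>
      src G c (gcomp G c g h) = src G c h \<and> tgt G c (gcomp G c g h) = tgt G c g) \<and>
    (\<forall>g\<in>el G c. \<forall>h\<in>el G c. \<forall>k\<in>el G c. src G c g = tgt G c h \<longrightarrow> src G c h = tgt G c k \<longrightarrow>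
      gcomp G c (gcomp G c g h) k = gcomp G c g (gcomp G c h k)) \<and>
    (\<forall>g\<in>el G c. gcomp G c g (idt G c (src G c g)) = g \<and> gcomp G c (idt G c (tgt G c g)) g = g) \<and>
    (\<forall>g\<in>el G c. ginv G c g \<in> el G c \<and>
      src G c (ginv G c g) = tgt G c g \<and> tgt G c (ginv G c g) = src G c g \<and>
      gcomp G c g (ginv G c g) = idt G c (tgt G c g) \<and>
      gcomp G c (ginv G c g) g = idt G c (src G c g))"

definition groupoid ::
  "('o, 'a, 'y) cat_data_scheme \<Rightarrow> ('o, 'a, 'm) psh_data \<Rightarrow> ('o, 'a, 'm, 'g) groupoid_data \<Rightarrow> bool"
  where
  "groupoid S M G \<longleftrightarrow> presheaf S G \<and> (\<forall>c. groupoid_at (el M c) G c) \<and>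
    (\<forall>f. \<forall>g\<in>el G (Cod S f).
      src G (Dom S f) (rst G f g) = rst M f (src G (Cod S f) g) \<and>
      tgt G (Dom S f) (rst G f g) = rst M f (tgt G (Cod S f) g)) \<and>
    (\<forall>f. \<forall>x\<in>el M (Cod S f). idt G (Dom S f) (rst M f x) = rst G f (idt G (Cod S f) x)) \<and>
    (\<forall>f. \<forall>g\<in>el G (Cod S f). \<forall>h\<in>el G (Cod S f). src G (Cod S f) g = tgt G (Cod S f) h \<longrightarrow>
      rst G f (gcomp G (Cod S f) g h) = gcomp G (Dom S f) (rst G f g) (rst G f h))"

definition group_bundle ::
  "('o, 'a, 'y) cat_data_scheme \<Rightarrow> ('o, 'a, 'm) psh_data \<Rightarrow> ('o, 'a, 'm, 'l) groupoid_data \<Rightarrow> bool"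
  where
  "group_bundle S M L \<longleftrightarrow> groupoid S M L \<and> (\<forall>c. \<forall>l\<in>el L c. src L c l = tgt L c l)"

definition Acube_at ::
  "('o, 'a, 'r, 'k) line_data \<Rightarrow> ('o, 'a, 'm) psh_data \<Rightarrow> ('o, 'a, 'm, 'g) groupoid_data \<Rightarrow> nat
    \<Rightarrow> 'o \<Rightarrow> 'm \<Rightarrow> ('a \<Rightarrow> 'r list \<Rightarrow> 'g) set" where
  "Acube_at S M G n c x = {\<gamma> \<in> expo S (cube S n) G c.
    \<gamma> (Idn S c) (zeros S c n) = idt G c x \<and>
    (\<forall>f d. Cod S f = c \<longrightarrow> d \<in> cube S n (Dom S f) \<longrightarrow> src G (Dom S f) (\<gamma> f d) = rst M f x)}"

definition Acube ::
  "('o, 'a, 'r, 'k) line_data \<Rightarrow> ('o, 'a, 'm) psh_data \<Rightarrow> ('o, 'a, 'm, 'g) groupoid_data \<Rightarrow> nat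
    \<Rightarrow> ('o, 'a, 'a \<Rightarrow> 'r list \<Rightarrow> 'g) psh_data" where
  "Acube S M G n = \<lparr>el = (\<lambda>c. \<Union>x\<in>el M c. Acube_at S M G n c x), rst = exp_rst S\<rparr>"

definition base ::
  "('o, 'a, 'r, 'k) line_data \<Rightarrow> ('o, 'a, 'm, 'g) groupoid_data \<Rightarrow> nat \<Rightarrow> 'o
    \<Rightarrow> ('a \<Rightarrow> 'r list \<Rightarrow> 'g) \<Rightarrow> 'm" where
  "base S G n c \<gamma> = src G c (\<gamma> (Idn S c) (zeros S c n))"

text \<open>Scalar multiplication and addition in the \<open>i\<close>-th variable, \<open>i\<close> counted from \<open>0\<close>, the other
  variables being parameters.  For \<open>n = 1\<close>, \<open>i = 0\<close> this is the vector bundle structure of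
  \<open>\<A>\<^sup>1\<close>, for \<open>n = 2\<close> the double vector bundle structure of \<open>\<A>\<^sup>2\<close>.\<close>

definition slot_smul ::
  "('o, 'a, 'r, 'k) line_data \<Rightarrow> nat \<Rightarrow> nat \<Rightarrow> 'o \<Rightarrow> 'r
    \<Rightarrow> ('a \<Rightarrow> 'r list \<Rightarrow> 'g) \<Rightarrow> 'a \<Rightarrow> 'r list \<Rightarrow> 'g" where
  "slot_smul S n i c a \<gamma> = lam S (cube S n) c
    (\<lambda>f d. \<gamma> f (d[i := rres S f a \<otimes>\<^bsub>rng S (Dom S f)\<^esub> d ! i]))"

definition slot_glue ::
  "('o, 'a, 'r, 'k) line_data \<Rightarrow> ('o, 'a, 'm) psh_data \<Rightarrow> ('o, 'a, 'm, 'g) groupoid_data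
    \<Rightarrow> nat \<Rightarrow> nat \<Rightarrow> 'o \<Rightarrow> ('a \<Rightarrow> 'r list \<Rightarrow> 'g) \<Rightarrow> ('a \<Rightarrow> 'r list \<Rightarrow> 'g) \<Rightarrow> 'a \<Rightarrow> 'r list \<Rightarrow> 'g"
  where
  "slot_glue S M G n i c \<gamma> \<gamma>' = (THE l. l \<in> expo S (cube_D2 S n i) G c \<and>
    (\<forall>f v. Cod S f = c \<longrightarrow> v \<in> cube_D2 S n i (Dom S f) \<longrightarrow>
      src G (Dom S f) (l f v) = rst M f (base S G n c \<gamma>)) \<and>
    (\<forall>f d. Cod S f = c \<longrightarrow> d \<in> cube S n (Dom S f) \<longrightarrow>
      l f (ins (Suc i) \<zero>\<^bsub>rng S (Dom S f)\<^esub> d) = \<gamma> f d \<and>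
      l f (ins i \<zero>\<^bsub>rng S (Dom S f)\<^esub> d) = \<gamma>' f d))"

definition slot_add ::
  "('o, 'a, 'r, 'k) line_data \<Rightarrow> ('o, 'a, 'm) psh_data \<Rightarrow> ('o, 'a, 'm, 'g) groupoid_data
    \<Rightarrow> nat \<Rightarrow> nat \<Rightarrow> 'o \<Rightarrow> ('a \<Rightarrow> 'r list \<Rightarrow> 'g) \<Rightarrow> ('a \<Rightarrow> 'r list \<Rightarrow> 'g) \<Rightarrow> 'a \<Rightarrow> 'r list \<Rightarrow> 'g"
  where
  "slot_add S M G n i c \<gamma> \<gamma>' = lam S (cube S n) c
    (\<lambda>f d. slot_glue S M G n i c \<gamma> \<gamma>' f (ins i (d ! i) d))"

text \<open>With \<open>i\<close> counted from \<open>0\<close>, these are \<open>\<^bold>s\<^sub>i\<^sub>+\<^sub>1\<close> and \<open>\<^bold>d\<^sub>i\<^sub>+\<^sub>1\<close>.\<close>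

definition degen ::
  "('o, 'a, 'r, 'k) line_data \<Rightarrow> nat \<Rightarrow> 'o \<Rightarrow> ('a \<Rightarrow> 'r list \<Rightarrow> 'g) \<Rightarrow> 'a \<Rightarrow> 'r list \<Rightarrow> 'g" where
  "degen S i c t = lam S (cube S 2) c (\<lambda>f d. t f (del i d))"

definition face ::
  "('o, 'a, 'r, 'k) line_data \<Rightarrow> nat \<Rightarrow> 'o \<Rightarrow> ('a \<Rightarrow> 'r list \<Rightarrow> 'g) \<Rightarrow> 'a \<Rightarrow> 'r list \<Rightarrow> 'g" where
  "face S i c \<gamma> = lam S (cube S 1) c (\<lambda>f d. \<gamma> f (ins i \<zero>\<^bsub>rng S (Dom S f)\<^esub> d))"

definition star ::
  "('o, 'a, 'r, 'k) line_data \<Rightarrow> ('o, 'a, 'm, 'g) groupoid_data \<Rightarrow> 'o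
    \<Rightarrow> ('a \<Rightarrow> 'r list \<Rightarrow> 'a \<Rightarrow> 'r list \<Rightarrow> 'g) \<Rightarrow> ('a \<Rightarrow> 'r list \<Rightarrow> 'g) \<Rightarrow> 'a \<Rightarrow> 'r list \<Rightarrow> 'g" where
  "star S G c \<zeta> t = lam S (cube S 2) c
    (\<lambda>f d. gcomp G (Dom S f) (\<zeta> f [d ! 0] (Idn S (Dom S f)) [d ! 1]) (t f [d ! 0]))"

definition star_domain ::
  "('o, 'a, 'r, 'k) line_data \<Rightarrow> ('o, 'a, 'm) psh_data \<Rightarrow> ('o, 'a, 'm, 'g) groupoid_data \<Rightarrow> 'o
    \<Rightarrow> ('a \<Rightarrow> 'r list \<Rightarrow> 'a \<Rightarrow> 'r list \<Rightarrow> 'g) \<Rightarrow> ('a \<Rightarrow> 'r list \<Rightarrow> 'g) \<Rightarrow> bool" where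
  "star_domain S M G c \<zeta> t \<longleftrightarrow>
    \<zeta> \<in> expo S (cube S 1) (Acube S M G 1) c \<and> t \<in> el (Acube S M G 1) c \<and>
    (\<forall>f d. Cod S f = c \<longrightarrow> d \<in> cube S 1 (Dom S f) \<longrightarrow>
      base S G 1 (Dom S f) (\<zeta> f d) = tgt G (Dom S f) (t f d))"

type_synonym ('o, 'a, 'r, 'g, 'h) Acube_map =
  "'o \<Rightarrow> ('a \<Rightarrow> 'r list \<Rightarrow> 'g) \<Rightarrow> 'a \<Rightarrow> 'r list \<Rightarrow> 'h"

definition Acube_hom ::
  "('o, 'a, 'r, 'k) line_data \<Rightarrow> ('o, 'a, 'm) psh_data \<Rightarrow> ('o, 'a, 'm, 'g) groupoid_data
    \<Rightarrow> ('o, 'a, 'm, 'h) groupoid_data \<Rightarrow> nat \<Rightarrow> ('o, 'a, 'r, 'g, 'h) Acube_map \<Rightarrow> bool" where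
  "Acube_hom S M G H n \<phi> \<longleftrightarrow>
    (\<forall>c. \<forall>\<gamma>\<in>el (Acube S M G n) c. \<phi> c \<gamma> \<in> el (Acube S M H n) c \<and>
      base S H n c (\<phi> c \<gamma>) = base S G n c \<gamma> \<and>
      (\<forall>f d. Cod S f = c \<longrightarrow> d \<in> cube S n (Dom S f) \<longrightarrow>
        tgt H (Dom S f) (\<phi> c \<gamma> f d) = tgt G (Dom S f) (\<gamma> f d))) \<and>
    (\<forall>f. \<forall>\<gamma>\<in>el (Acube S M G n) (Cod S f).
      \<phi> (Dom S f) (exp_rst S f \<gamma>) = exp_rst S f (\<phi> (Cod S f) \<gamma>))"

definition algebroid_hom ::
  "('o, 'a, 'r, 'k) line_data \<Rightarrow> ('o, 'a, 'm) psh_data \<Rightarrow> ('o, 'a, 'm, 'g) groupoid_data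
    \<Rightarrow> ('o, 'a, 'm, 'h) groupoid_data
    \<Rightarrow> ('o, 'a, 'r, 'g, 'h) Acube_map \<times> ('o, 'a, 'r, 'g, 'h) Acube_map \<Rightarrow> bool" where
  "algebroid_hom S M G H = (\<lambda>(\<phi>1, \<phi>2).
    Acube_hom S M G H 1 \<phi>1 \<and> Acube_hom S M G H 2 \<phi>2 \<and>
    (\<forall>i<2. \<forall>c. \<forall>t\<in>el (Acube S M G 1) c. \<phi>2 c (degen S i c t) = degen S i c (\<phi>1 c t)) \<and>
    (\<forall>i<2. \<forall>c. \<forall>\<gamma>\<in>el (Acube S M G 2) c. \<phi>1 c (face S i c \<gamma>) = face S i c (\<phi>2 c \<gamma>)) \<and>
    (\<forall>c. \<forall>t\<in>el (Acube S M G 1) c. \<forall>t'\<in>el (Acube S M G 1) c. base S G 1 c t = base S G 1 c t' \<longrightarrow>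
      \<phi>1 c (slot_add S M G 1 0 c t t') = slot_add S M H 1 0 c (\<phi>1 c t) (\<phi>1 c t')) \<and>
    (\<forall>c. \<forall>a\<in>carrier (rng S c). \<forall>t\<in>el (Acube S M G 1) c.
      \<phi>1 c (slot_smul S 1 0 c a t) = slot_smul S 1 0 c a (\<phi>1 c t)) \<and>
    (\<forall>i<2. \<forall>c. \<forall>\<gamma>\<in>el (Acube S M G 2) c. \<forall>\<gamma>'\<in>el (Acube S M G 2) c.
      face S i c \<gamma> = face S i c \<gamma>' \<longrightarrow>
      \<phi>2 c (slot_add S M G 2 i c \<gamma> \<gamma>') = slot_add S M H 2 i c (\<phi>2 c \<gamma>) (\<phi>2 c \<gamma>')) \<and>
    (\<forall>i<2. \<forall>c. \<forall>a\<in>carrier (rng S c). \<forall>\<gamma>\<in>el (Acube S M G 2) c.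
      \<phi>2 c (slot_smul S 2 i c a \<gamma>) = slot_smul S 2 i c a (\<phi>2 c \<gamma>)) \<and>
    (\<forall>c \<zeta> t. star_domain S M G c \<zeta> t \<longrightarrow>
      \<phi>2 c (star S G c \<zeta> t) =
        star S H c (lam S (cube S 1) c (\<lambda>f d. \<phi>1 (Dom S f) (\<zeta> f d))) (\<phi>1 c t)))"

record ('o, 'a, 'r, 'm, 'e) bundle_data = "('o, 'a, 'e) psh_data" +
  bproj :: "'o \<Rightarrow> 'e \<Rightarrow> 'm"
  vadd :: "'o \<Rightarrow> 'e \<Rightarrow> 'e \<Rightarrow> 'e"
  vsmul :: "'o \<Rightarrow> 'r \<Rightarrow> 'e \<Rightarrow> 'e"
  vzero :: "'o \<Rightarrow> 'm \<Rightarrow> 'e"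

definition fib :: "('o, 'a, 'r, 'm, 'e) bundle_data \<Rightarrow> 'o \<Rightarrow> 'm \<Rightarrow> 'e set" where
  "fib E c x = {e \<in> el E c. bproj E c e = x}"

definition A1_bundle ::
  "('o, 'a, 'r, 'k) line_data \<Rightarrow> ('o, 'a, 'm) psh_data \<Rightarrow> ('o, 'a, 'm, 'l) groupoid_data
    \<Rightarrow> ('o, 'a, 'r, 'm, 'a \<Rightarrow> 'r list \<Rightarrow> 'l) bundle_data" where
  "A1_bundle S M L = \<lparr>el = el (Acube S M L 1), rst = rst (Acube S M L 1),
    bproj = base S L 1, vadd = slot_add S M L 1 0, vsmul = slot_smul S 1 0,
    vzero = (\<lambda>c x. lam S (cube S 1) c (\<lambda>f d. idt L (Dom S f) (rst M f x)))\<rparr>"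

text \<open>An arrow \<open>x \<rightarrow> y\<close> at stage \<open>c\<close> is an internal linear isomorphism \<open>E\<^sub>x \<rightarrow> E\<^sub>y\<close>, i.e. a natural
  family of linear isomorphisms of the fibers over the restrictions of \<open>x\<close> and \<open>y\<close>.\<close>

definition lin_iso ::
  "('o, 'a, 'r, 'k) line_data \<Rightarrow> ('o, 'a, 'm) psh_data \<Rightarrow> ('o, 'a, 'r, 'm, 'e) bundle_data \<Rightarrow> 'o
    \<Rightarrow> 'm \<Rightarrow> 'm \<Rightarrow> ('a \<Rightarrow> 'e \<Rightarrow> 'e) \<Rightarrow> bool" where
  "lin_iso S M E c x y \<phi> \<longleftrightarrow>
    (\<forall>f. Cod S f = c \<longrightarrow>
      bij_betw (\<phi> f) (fib E (Dom S f) (rst M f x)) (fib E (Dom S f) (rst M f y)) \<and>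
      (\<forall>e\<in>fib E (Dom S f) (rst M f x). \<forall>e'\<in>fib E (Dom S f) (rst M f x).
        \<phi> f (vadd E (Dom S f) e e') = vadd E (Dom S f) (\<phi> f e) (\<phi> f e')) \<and>
      (\<forall>a\<in>carrier (rng S (Dom S f)). \<forall>e\<in>fib E (Dom S f) (rst M f x).
        \<phi> f (vsmul E (Dom S f) a e) = vsmul E (Dom S f) a (\<phi> f e))) \<and>
    (\<forall>f g. Cod S f = c \<longrightarrow> Cod S g = Dom S f \<longrightarrow> (\<forall>e\<in>fib E (Dom S f) (rst M f x).
      \<phi> (Cmp S f g) (rst E g e) = rst E g (\<phi> f e))) \<and>
    (\<forall>f e. \<not> (Cod S f = c \<and> e \<in> fib E (Dom S f) (rst M f x)) \<longrightarrow> \<phi> f e = undefined)"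

definition fib_lam ::
  "('o, 'a, 'r, 'k) line_data \<Rightarrow> ('o, 'a, 'm) psh_data \<Rightarrow> ('o, 'a, 'r, 'm, 'e) bundle_data \<Rightarrow> 'o
    \<Rightarrow> 'm \<Rightarrow> ('a \<Rightarrow> 'e \<Rightarrow> 'e) \<Rightarrow> 'a \<Rightarrow> 'e \<Rightarrow> 'e" where
  "fib_lam S M E c x u =
    (\<lambda>f e. if Cod S f = c \<and> e \<in> fib E (Dom S f) (rst M f x) then u f e else undefined)"

definition Phi_Lin ::
  "('o, 'a, 'r, 'k) line_data \<Rightarrow> ('o, 'a, 'm) psh_data \<Rightarrow> ('o, 'a, 'r, 'm, 'e) bundle_data
    \<Rightarrow> ('o, 'a, 'm, 'm \<times> 'm \<times> ('a \<Rightarrow> 'e \<Rightarrow> 'e)) groupoid_data" where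
  "Phi_Lin S M E = \<lparr>
    el = (\<lambda>c. {(x, y, \<phi>). x \<in> el M c \<and> y \<in> el M c \<and> lin_iso S M E c x y \<phi>}),
    rst = (\<lambda>h (x, y, \<phi>). (rst M h x, rst M h y, exp_rst S h \<phi>)),
    src = (\<lambda>c (x, y, \<phi>). x),
    tgt = (\<lambda>c (x, y, \<phi>). y),
    idt = (\<lambda>c x. (x, x, fib_lam S M E c x (\<lambda>f e. e))),
    gcomp = (\<lambda>c (y, z, \<psi>) (x, y', \<phi>). (x, z, fib_lam S M E c x (\<lambda>f e. \<psi> f (\<phi> f e)))),
    ginv = (\<lambda>c (x, y, \<phi>). (y, x, fib_lam S M E c y
      (\<lambda>f. inv_into (fib E (Dom S f) (rst M f x)) (\<phi> f))))\<rparr>"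

definition app ::
  "('o, 'a, 'z) cat_data_scheme \<Rightarrow> 'o \<Rightarrow> 'm \<times> 'm \<times> ('a \<Rightarrow> 'e \<Rightarrow> 'e) \<Rightarrow> 'e \<Rightarrow> 'e" where
  "app S c = (\<lambda>(x, y, \<phi>) e. \<phi> (Idn S c) e)"

type_synonym ('o, 'a, 'r, 'm, 'g, 'e) rep_data =
  "('o, 'a, 'r, 'g, 'm \<times> 'm \<times> ('a \<Rightarrow> 'e \<Rightarrow> 'e)) Acube_map \<times>
   ('o, 'a, 'r, 'g, 'm \<times> 'm \<times> ('a \<Rightarrow> 'e \<Rightarrow> 'e)) Acube_map"

definition representation ::
  "('o, 'a, 'r, 'k) line_data \<Rightarrow> ('o, 'a, 'm) psh_data \<Rightarrow> ('o, 'a, 'm, 'g) groupoid_data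
    \<Rightarrow> ('o, 'a, 'r, 'm, 'e) bundle_data \<Rightarrow> ('o, 'a, 'r, 'm, 'g, 'e) rep_data \<Rightarrow> bool" where
  "representation S M G E \<rho> \<longleftrightarrow> algebroid_hom S M G (Phi_Lin S M E) \<rho>"

text \<open>The elements at stage \<open>c\<close> of the space \<open>\<^bold>C\<^sup>n(G, E)\<close>: families indexed by the arrows into \<open>c\<close>.\<close>

definition forms ::
  "('o, 'a, 'r, 'k) line_data \<Rightarrow> ('o, 'a, 'm) psh_data \<Rightarrow> ('o, 'a, 'm, 'g) groupoid_data
    \<Rightarrow> ('o, 'a, 'r, 'm, 'e) bundle_data \<Rightarrow> nat \<Rightarrow> 'o \<Rightarrow> ('a \<Rightarrow> ('a \<Rightarrow> 'r list \<Rightarrow> 'g) \<Rightarrow> 'e) set"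
  where
  "forms S M G E n c = {\<omega>.
    (\<forall>f \<gamma>. \<not> (Cod S f = c \<and> \<gamma> \<in> el (Acube S M G n) (Dom S f)) \<longrightarrow> \<omega> f \<gamma> = undefined) \<and>
    (\<forall>f. Cod S f = c \<longrightarrow> (\<forall>\<gamma>\<in>el (Acube S M G n) (Dom S f).
      \<omega> f \<gamma> \<in> fib E (Dom S f) (base S G n (Dom S f) \<gamma>) \<and>
      (\<forall>g. Cod S g = Dom S f \<longrightarrow> \<omega> (Cmp S f g) (exp_rst S g \<gamma>) = rst E g (\<omega> f \<gamma>)) \<and>
      (\<forall>i<n. \<forall>a\<in>carrier (rng S (Dom S f)).
        \<omega> f (slot_smul S n i (Dom S f) a \<gamma>) = vsmul E (Dom S f) a (\<omega> f \<gamma>)) \<and>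
      (\<forall>\<sigma>. \<sigma> permutes {..<n} \<longrightarrow>
        \<omega> f (lam S (cube S n) (Dom S f) (\<lambda>g d. \<gamma> g (permute_list \<sigma> d))) =
        vsmul E (Dom S f)
          (if sign \<sigma> = 1 then \<one>\<^bsub>rng S (Dom S f)\<^esub>
           else \<ominus>\<^bsub>rng S (Dom S f)\<^esub> \<one>\<^bsub>rng S (Dom S f)\<^esub>) (\<omega> f \<gamma>))))}"

text \<open>With \<open>i\<close> counted from \<open>0\<close>, these are \<open>\<gamma>\<^sup>i\<^sup>+\<^sup>1\<^sub>e\<close> and \<open>\<gamma>\<^sub>i\<^sub>+\<^sub>1\<close> for \<open>\<gamma>\<close> in \<open>\<A>\<^sup>n\<^sup>+\<^sup>1 G\<close>.\<close>

definition cube_shift ::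
  "('o, 'a, 'r, 'k) line_data \<Rightarrow> ('o, 'a, 'm, 'g) groupoid_data \<Rightarrow> nat \<Rightarrow> 'o \<Rightarrow> nat \<Rightarrow> 'r
    \<Rightarrow> ('a \<Rightarrow> 'r list \<Rightarrow> 'g) \<Rightarrow> 'a \<Rightarrow> 'r list \<Rightarrow> 'g" where
  "cube_shift S G n c i e \<gamma> = lam S (cube S n) c
    (\<lambda>f d. gcomp G (Dom S f) (\<gamma> f (ins i (rres S f e) d))
      (ginv G (Dom S f) (\<gamma> f (axis S (Dom S f) (Suc n) i (rres S f e)))))"

definition cube_axis ::
  "('o, 'a, 'r, 'k) line_data \<Rightarrow> nat \<Rightarrow> 'o \<Rightarrow> nat \<Rightarrow> ('a \<Rightarrow> 'r list \<Rightarrow> 'g) \<Rightarrow> 'a \<Rightarrow> 'r list \<Rightarrow> 'g" where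
  "cube_axis S n c i \<gamma> = lam S (cube S 1) c (\<lambda>f d. \<gamma> f (axis S (Dom S f) (Suc n) i (d ! 0)))"

text \<open>\<open>(\<rho>(\<gamma>\<^sub>i)\<^sub>e)\<^sup>-\<^sup>1(\<omega>(\<gamma>\<^sup>i\<^sub>e))\<close>, where \<open>f\<close> is an arrow into the stage of \<open>\<omega>\<close> from the
  stage of \<open>\<gamma>\<close> and \<open>e\<close>\<close>

definition transported ::
  "('o, 'a, 'r, 'k) line_data \<Rightarrow> ('o, 'a, 'm) psh_data \<Rightarrow> ('o, 'a, 'm, 'g) groupoid_data
    \<Rightarrow> ('o, 'a, 'r, 'm, 'e) bundle_data \<Rightarrow> ('o, 'a, 'r, 'm, 'g, 'e) rep_data \<Rightarrow> nat
    \<Rightarrow> ('a \<Rightarrow> ('a \<Rightarrow> 'r list \<Rightarrow> 'g) \<Rightarrow> 'e) \<Rightarrow> 'a \<Rightarrow> ('a \<Rightarrow> 'r list \<Rightarrow> 'g) \<Rightarrow> nat \<Rightarrow> 'r \<Rightarrow> 'e" where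
  "transported S M G E \<rho> n \<omega> f \<gamma> i e = (let c = Dom S f in
    app S c
      (ginv (Phi_Lin S M E) c (fst \<rho> c (cube_axis S n c i \<gamma>) (Idn S c) [e]))
      (\<omega> f (cube_shift S G n c i e \<gamma>)))"

definition is_d_plus ::
  "('o, 'a, 'r, 'k) line_data \<Rightarrow> ('o, 'a, 'm) psh_data \<Rightarrow> ('o, 'a, 'm, 'g) groupoid_data
    \<Rightarrow> ('o, 'a, 'r, 'm, 'e) bundle_data \<Rightarrow> ('o, 'a, 'r, 'm, 'g, 'e) rep_data \<Rightarrow> nat \<Rightarrow> 'o
    \<Rightarrow> ('a \<Rightarrow> ('a \<Rightarrow> 'r list \<Rightarrow> 'g) \<Rightarrow> 'e) \<Rightarrow> ('a \<Rightarrow> ('a \<Rightarrow> 'r list \<Rightarrow> 'g) \<Rightarrow> 'e) \<Rightarrow> bool" where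
  "is_d_plus S M G E \<rho> n c \<omega> \<eta> \<longleftrightarrow> \<eta> \<in> forms S M G E (Suc n) c \<and>
    (\<forall>f. Cod S f = c \<longrightarrow> (let b = Dom S f; R = rng S b in
      \<forall>\<gamma>\<in>el (Acube S M G (Suc n)) b. \<forall>d\<in>cube S (Suc n) b.
        vsmul E b (rprod S b d) (\<eta> f \<gamma>) =
        foldr (vadd E b)
          (map (\<lambda>i. vsmul E b ((\<ominus>\<^bsub>R\<^esub> \<one>\<^bsub>R\<^esub>) [^]\<^bsub>R\<^esub> Suc i)
            (vsmul E b (rprod S b (del i d))
              (vadd E b (\<omega> f (cube_shift S G n b i \<zero>\<^bsub>R\<^esub> \<gamma>))
                (vsmul E b (\<ominus>\<^bsub>R\<^esub> \<one>\<^bsub>R\<^esub>) (transported S M G E \<rho> n \<omega> f \<gamma> i (d ! i))))))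
            [0..<Suc n])
          (vzero E b (base S G (Suc n) b \<gamma>))))"

definition d_plus ::
  "('o, 'a, 'r, 'k) line_data \<Rightarrow> ('o, 'a, 'm) psh_data \<Rightarrow> ('o, 'a, 'm, 'g) groupoid_data
    \<Rightarrow> ('o, 'a, 'r, 'm, 'e) bundle_data \<Rightarrow> ('o, 'a, 'r, 'm, 'g, 'e) rep_data \<Rightarrow> nat \<Rightarrow> 'o
    \<Rightarrow> ('a \<Rightarrow> ('a \<Rightarrow> 'r list \<Rightarrow> 'g) \<Rightarrow> 'e) \<Rightarrow> 'a \<Rightarrow> ('a \<Rightarrow> 'r list \<Rightarrow> 'g) \<Rightarrow> 'e" where
  "d_plus S M G E \<rho> n c \<omega> = (THE \<eta>. is_d_plus S M G E \<rho> n c \<omega> \<eta>)"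

text \<open>The product over \<open>i\<close> is taken in increasing order of \<open>i\<close>.  For \<open>n = 0\<close> the product of the
  \<open>d ! j\<close> with \<open>j \<noteq> i\<close> is empty, i.e. \<open>1\<close>, which is not an element of \<open>D\<close>; hence this operator
  is meaningful for \<open>n \<ge> 1\<close> only.\<close>

definition is_d_times ::
  "('o, 'a, 'r, 'k) line_data \<Rightarrow> ('o, 'a, 'm) psh_data \<Rightarrow> ('o, 'a, 'm, 'g) groupoid_data
    \<Rightarrow> ('o, 'a, 'm, 'l) groupoid_data \<Rightarrow> ('o, 'a, 'r, 'm, 'g, 'a \<Rightarrow> 'r list \<Rightarrow> 'l) rep_data
    \<Rightarrow> nat \<Rightarrow> 'o \<Rightarrow> ('a \<Rightarrow> ('a \<Rightarrow> 'r list \<Rightarrow> 'g) \<Rightarrow> 'a \<Rightarrow> 'r list \<Rightarrow> 'l)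
    \<Rightarrow> ('a \<Rightarrow> ('a \<Rightarrow> 'r list \<Rightarrow> 'g) \<Rightarrow> 'a \<Rightarrow> 'r list \<Rightarrow> 'l) \<Rightarrow> bool" where
  "is_d_times S M G L \<rho> n c \<omega> \<eta> \<longleftrightarrow> \<eta> \<in> forms S M G (A1_bundle S M L) (Suc n) c \<and>
    (\<forall>f. Cod S f = c \<longrightarrow> (let b = Dom S f; R = rng S b in
      \<forall>\<gamma>\<in>el (Acube S M G (Suc n)) b. \<forall>d\<in>cube S (Suc n) b.
        \<eta> f \<gamma> (Idn S b) [rprod S b d] =
        foldr (gcomp L b)
          (map (\<lambda>i. (if odd (Suc i) then ginv L b else id)
            (gcomp L b
              (\<omega> f (cube_shift S G n b i \<zero>\<^bsub>R\<^esub> \<gamma>) (Idn S b) [rprod S b (del i d)])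
              (transported S M G (A1_bundle S M L) \<rho> n \<omega> f \<gamma> i (d ! i)
                (Idn S b) [\<ominus>\<^bsub>R\<^esub> rprod S b (del i d)])))
            [0..<Suc n])
          (idt L b (base S G (Suc n) b \<gamma>))))"

definition d_times ::
  "('o, 'a, 'r, 'k) line_data \<Rightarrow> ('o, 'a, 'm) psh_data \<Rightarrow> ('o, 'a, 'm, 'g) groupoid_data
    \<Rightarrow> ('o, 'a, 'm, 'l) groupoid_data \<Rightarrow> ('o, 'a, 'r, 'm, 'g, 'a \<Rightarrow> 'r list \<Rightarrow> 'l) rep_data
    \<Rightarrow> nat \<Rightarrow> 'o \<Rightarrow> ('a \<Rightarrow> ('a \<Rightarrow> 'r list \<Rightarrow> 'g) \<Rightarrow> 'a \<Rightarrow> 'r list \<Rightarrow> 'l)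
    \<Rightarrow> 'a \<Rightarrow> ('a \<Rightarrow> 'r list \<Rightarrow> 'g) \<Rightarrow> 'a \<Rightarrow> 'r list \<Rightarrow> 'l" where
  "d_times S M G L \<rho> n c \<omega> = (THE \<eta>. is_d_times S M G L \<rho> n c \<omega> \<eta>)"

end

theory Submission
  imports Defs
begin

text \<open>
  Write \<open>t\<^sub>i(d) = \<omega>(\<gamma>\<^sup>i\<^sub>0) - (\<rho>(\<gamma>\<^sub>i)\<^sub>d)\<^sup>-\<^sup>1(\<omega>(\<gamma>\<^sup>i\<^sub>d))\<close>.  Since \<open>t\<^sub>i(0) = 0\<close>, the map
  \<open>(d, e) \<mapsto> t\<^sub>i(d)\<^sub>e\<close> is trivial on both axes of \<open>D \<times> D\<close>, so by microlinearity of \<open>L\<close> it factors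
  through the multiplication \<open>D \<times> D \<rightarrow> D\<close>: there is \<open>b\<^sub>i\<close> in \<open>\<A>\<^sup>1L\<close> with \<open>t\<^sub>i(d)\<^sub>e = (b\<^sub>i)\<^sub>d\<^sub>e\<close>.
  Addition in \<open>\<A>\<^sup>1L\<close> is the pointwise product in \<open>L\<close>, even without commutativity of \<open>L\<close>, because
  \<open>(d, e) \<mapsto> s\<^sub>d s'\<^sub>e\<close> restricts to the glueing of \<open>s\<close> and \<open>s'\<close> on \<open>D(2)\<close>.  With \<open>p\<close> the product of
  all \<open>d\<^sub>j\<close> and \<open>b\<close> the alternating sum of the \<open>b\<^sub>i\<close>, the additive formula therefore reads
  \<open>p \<cdot> \<eta>(\<gamma>) = p \<cdot> b\<close> and the multiplicative one reads \<open>\<eta>(\<gamma>)\<^sub>p = b\<^sub>p\<close>.  As the multiplication of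
  \<open>D\<close> is epic for microlinear spaces, either is equivalent to \<open>\<eta>(\<gamma>) = b\<close>; in particular no existence
  statement is needed to compare the two unique solutions.
\<close>

subsection \<open>The line object\<close>

text \<open>The factorization rests on the Kock-Lawvere axiom: a function on D x D has the form a +
  b d + b' e + g d e, constancy along both axes kills b and b', and a + g x is what remains on D.
  Microlinearity carries this from the line to \<open>L\<close>. Triviality along e = 0 is built
  into tangent vectors; along d = 0 it says that the values of a tangent vector at e and at -e are
  inverse to each other, again a comparison on D(2). In the multiplicative formula e is the product
  of the other coordinates, which lies in D because n \<ge> 1.

  Two obstacles shape the rest. The formulas at a stage involve only points d of that stage, whereas
  equality of tangent vectors is tested at all later stages; so transport, forms and the common
  value must commute with restriction, although inverse isomorphisms and the parts b_i are obtained
  by choice. And microlinearity of \<open>L\<close> yields a factor with values somewhere in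
  \<open>L\<close>: that it stays over a single point x is a separate argument, by epicness of
  multiplication for \<open>M\<close>.\<close>

locale sdg_line =
  fixes S :: "('o, 'a, 'r, 'k::comm_ring_1) line_data"
  assumes line: "line_object S"
begin

lemma algebra: "algebra_object S" and KL: "kock_lawvere S"
  using line by (auto simp: line_object_def)

lemma category: "category S"
  using algebra by (simp add: algebra_object_def)

lemma Dom_Idn [simp]: "Dom S (Idn S c) = c"
  and Cod_Idn [simp]: "Cod S (Idn S c) = c"
  and Cmp_Idn [simp]: "Cmp S f (Idn S (Dom S f)) = f"
  and Idn_Cmp [simp]: "Cmp S (Idn S (Cod S f)) f = f"
  using category by (auto simp: category_def)

lemma Dom_Cmp [simp]: "Cod S g = Dom S f \<Longrightarrow> Dom S (Cmp S f g) = Dom S g"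
  and Cod_Cmp [simp]: "Cod S g = Dom S f \<Longrightarrow> Cod S (Cmp S f g) = Cod S f"
  using category by (auto simp: category_def)

lemma Cmp_assoc:
  "Cod S g = Dom S f \<Longrightarrow> Cod S h = Dom S g \<Longrightarrow> Cmp S (Cmp S f g) h = Cmp S f (Cmp S g h)"
  using category by (auto simp: category_def)

lemma presheaf_line: "presheaf S (line_psh S)"
  using algebra by (simp add: algebra_object_def)

lemma cring_rng: "cring (rng S c)"
  using algebra by (simp add: algebra_object_def)

sublocale R: cring "rng S c" for c
  by (rule cring_rng)

lemma rres_hom: "rres S f \<in> ring_hom (rng S (Cod S f)) (rng S (Dom S f))"
  using algebra by (simp add: algebra_object_def)

lemma rres_closed [simp]:
  "Cod S f = c \<Longrightarrow> x \<in> carrier (rng S c) \<Longrightarrow> rres S f x \<in> carrier (rng S (Dom S f))"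
  using ring_hom_closed[OF rres_hom] by blast

lemma rres_mult [simp]: "Cod S f = c \<Longrightarrow> x \<in> carrier (rng S c) \<Longrightarrow> y \<in> carrier (rng S c) \<Longrightarrow>
    rres S f (x \<otimes>\<^bsub>rng S c\<^esub> y) = rres S f x \<otimes>\<^bsub>rng S (Dom S f)\<^esub> rres S f y"
  using ring_hom_mult[OF rres_hom] by blast

lemma rres_add [simp]: "Cod S f = c \<Longrightarrow> x \<in> carrier (rng S c) \<Longrightarrow> y \<in> carrier (rng S c) \<Longrightarrow>
    rres S f (x \<oplus>\<^bsub>rng S c\<^esub> y) = rres S f x \<oplus>\<^bsub>rng S (Dom S f)\<^esub> rres S f y"
  using ring_hom_add[OF rres_hom] by blast

lemma rres_one [simp]: "Cod S f = c \<Longrightarrow> rres S f \<one>\<^bsub>rng S c\<^esub> = \<one>\<^bsub>rng S (Dom S f)\<^esub>"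
  using ring_hom_one[OF rres_hom] by blast

lemma rres_zero [simp]: "Cod S f = c \<Longrightarrow> rres S f \<zero>\<^bsub>rng S c\<^esub> = \<zero>\<^bsub>rng S (Dom S f)\<^esub>"
  using ring_hom_zero[OF rres_hom R.ring_axioms R.ring_axioms] by blast

lemma rres_minus [simp]: "Cod S f = c \<Longrightarrow> x \<in> carrier (rng S c) \<Longrightarrow>
    rres S f (\<ominus>\<^bsub>rng S c\<^esub> x) = \<ominus>\<^bsub>rng S (Dom S f)\<^esub> rres S f x"
  using R.minus_equality[where x = "rres S f (\<ominus>\<^bsub>rng S c\<^esub> x)" and y = "rres S f x"]
  by (metis R.add.inv_closed R.l_neg R.minus_equality R.r_neg R.add.m_comm rres_add rres_closed rres_zero)

lemma rres_Idn [simp]: "x \<in> carrier (rng S c) \<Longrightarrow> rres S (Idn S c) x = x"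
  using presheaf_line by (auto simp: presheaf_def line_psh_def)

lemma rres_Cmp [simp]: "Cod S g = Dom S f \<Longrightarrow> Cod S f = c \<Longrightarrow> x \<in> carrier (rng S c) \<Longrightarrow>
    rres S (Cmp S f g) x = rres S g (rres S f x)"
  using presheaf_line by (auto simp: presheaf_def line_psh_def)

lemma scal_closed [simp]: "scal S a c \<in> carrier (rng S c)"
  and scal_one [simp]: "scal S 1 c = \<one>\<^bsub>rng S c\<^esub>"
  using algebra by (auto simp: algebra_object_def)

text \<open>Additivity makes the element equal to its own double, and addition cancels. Together
  with \<open>scal_one\<close> this covers every structure constant used below, all of which are 0
  or 1.\<close>

lemma scal_zero [simp]: "scal S 0 c = \<zero>\<^bsub>rng S c\<^esub>"
proof -
  have "scal S (0 + 0) c = scal S 0 c \<oplus>\<^bsub>rng S c\<^esub> scal S 0 c"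
    using algebra unfolding algebra_object_def by blast
  then show ?thesis
    using R.add.r_cancel_one'[of "scal S 0 c" c "scal S 0 c"] by simp
qed

section \<open>Square-zero elements, cubes and products of coordinates\<close>

lemma DD_iff: "d \<in> DD S c \<longleftrightarrow> d \<in> carrier (rng S c) \<and> d \<otimes>\<^bsub>rng S c\<^esub> d = \<zero>\<^bsub>rng S c\<^esub>"
  by (auto simp: DD_def)

lemma DD_closed [simp]: "d \<in> DD S c \<Longrightarrow> d \<in> carrier (rng S c)"
  and DD_square [simp]: "d \<in> DD S c \<Longrightarrow> d \<otimes>\<^bsub>rng S c\<^esub> d = \<zero>\<^bsub>rng S c\<^esub>"
  by (auto simp: DD_iff)

lemma DD_zero [simp]: "\<zero>\<^bsub>rng S c\<^esub> \<in> DD S c"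
  by (subst DD_iff) simp

lemma DD_mult [simp]:
  assumes "a \<in> carrier (rng S c)" "d \<in> DD S c"
  shows "a \<otimes>\<^bsub>rng S c\<^esub> d \<in> DD S c" "d \<otimes>\<^bsub>rng S c\<^esub> a \<in> DD S c"
proof -
  have "(a \<otimes>\<^bsub>rng S c\<^esub> d) \<otimes>\<^bsub>rng S c\<^esub> (a \<otimes>\<^bsub>rng S c\<^esub> d) = \<zero>\<^bsub>rng S c\<^esub>"
    using assms R.m_lcomm[of d c a d] by (simp add: R.m_assoc)
  then show "a \<otimes>\<^bsub>rng S c\<^esub> d \<in> DD S c"
    using assms by (subst DD_iff) simp
  then show "d \<otimes>\<^bsub>rng S c\<^esub> a \<in> DD S c"
    using assms R.m_comm[of a c d] by simp
qed

lemma DD_minus [simp]: "d \<in> DD S c \<Longrightarrow> \<ominus>\<^bsub>rng S c\<^esub> d \<in> DD S c"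
  by (subst DD_iff) (simp add: R.l_minus R.r_minus)

lemma DD_rres [simp]: "Cod S f = c \<Longrightarrow> d \<in> DD S c \<Longrightarrow> rres S f d \<in> DD S (Dom S f)"
  using rres_mult[of f c d d] by (subst DD_iff) simp

lemma cube_rres [simp]: "Cod S f = c \<Longrightarrow> d \<in> cube S n c \<Longrightarrow> map (rres S f) d \<in> cube S n (Dom S f)"
  by (auto simp: cube_def)

lemma cube_0 [simp]: "d \<in> cube S 0 c \<longleftrightarrow> d = []"
  by (auto simp: cube_def)

lemma cube_1E: "d \<in> cube S (Suc 0) c \<Longrightarrow> (\<And>a. a \<in> DD S c \<Longrightarrow> d = [a] \<Longrightarrow> thesis) \<Longrightarrow> thesis"
  by (auto simp: cube_def length_Suc_conv)

lemma cube_nth [simp]: "d \<in> cube S n c \<Longrightarrow> i < n \<Longrightarrow> d ! i \<in> DD S c"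
  by (auto simp: cube_def)

lemma cube_del [simp]: "d \<in> cube S (Suc n) c \<Longrightarrow> i < Suc n \<Longrightarrow> del i d \<in> cube S n c"
  by (auto simp: cube_def del_def dest: in_set_takeD in_set_dropD)

lemma cube_carrier: "d \<in> cube S n c \<Longrightarrow> set d \<subseteq> carrier (rng S c)"
  using DD_closed by (auto simp: cube_def)

lemma cube_Cons [simp]: "a # d \<in> cube S (Suc n) c \<longleftrightarrow> a \<in> DD S c \<and> d \<in> cube S n c"
  by (auto simp: cube_def)

lemma zeros_cube [simp]: "zeros S c n \<in> cube S n c"
  by (auto simp: cube_def zeros_def)

lemma map_rres_zeros [simp]: "Cod S f = c \<Longrightarrow> map (rres S f) (zeros S c n) = zeros S (Dom S f) n"
  by (simp add: zeros_def)

lemma zeros_1 [simp]: "zeros S c (Suc 0) = [\<zero>\<^bsub>rng S c\<^esub>]"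
  by (simp add: zeros_def)

lemma rprod_closed [simp]: "set d \<subseteq> carrier (rng S c) \<Longrightarrow> rprod S c d \<in> carrier (rng S c)"
  by (induction d) (auto simp: rprod_def)

lemma rprod_Cons [simp]: "rprod S c (a # d) = a \<otimes>\<^bsub>rng S c\<^esub> rprod S c d"
  by (simp add: rprod_def)

lemma rprod_Nil [simp]: "rprod S c [] = \<one>\<^bsub>rng S c\<^esub>"
  by (simp add: rprod_def)

text \<open>One factor in D suffices, since D absorbs multiplication by the line. The index
  \<open>Suc n\<close> excludes the empty product, which is 1.\<close>

lemma rprod_DD [simp]:
  assumes "d \<in> cube S (Suc n) c"
  shows "rprod S c d \<in> DD S c"
proof -
  obtain a d' where d: "d = a # d'" "a \<in> DD S c" "d' \<in> cube S n c"
    using assms by (cases d) (auto simp: cube_def)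
  then show ?thesis
    using cube_carrier[of d' n c] by simp
qed

lemma rres_rprod [simp]: "Cod S f = c \<Longrightarrow> set d \<subseteq> carrier (rng S c) \<Longrightarrow>
    rres S f (rprod S c d) = rprod S (Dom S f) (map (rres S f) d)"
  by (induction d) auto

lemma rprod_del:
  "i < length d \<Longrightarrow> set d \<subseteq> carrier (rng S c) \<Longrightarrow>
    d ! i \<otimes>\<^bsub>rng S c\<^esub> rprod S c (del i d) = rprod S c d"
proof (induction d arbitrary: i)
  case (Cons a d)
  show ?case
  proof (cases i)
    case (Suc j)
    have "set (del j d) \<subseteq> carrier (rng S c)" "d ! j \<in> carrier (rng S c)"
      using Cons.prems Suc by (auto simp: del_def dest: in_set_takeD in_set_dropD)
    then show ?thesis
      using Cons.IH[of j] Cons.prems Suc R.m_lcomm[of "d ! j" c a "rprod S c (del j d)"]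
      by (simp add: del_def)
  qed (simp add: del_def)
qed simp

end

section \<open>Natural families as elements of exponentials\<close>

lemma expoI:
  assumes "\<And>f d. Cod S f = c \<Longrightarrow> d \<in> P (Dom S f) \<Longrightarrow> \<gamma> f d \<in> el X (Dom S f)"
    and "\<And>f d. \<not> (Cod S f = c \<and> d \<in> P (Dom S f)) \<Longrightarrow> \<gamma> f d = undefined"
    and "\<And>f g d. Cod S f = c \<Longrightarrow> Cod S g = Dom S f \<Longrightarrow> d \<in> P (Dom S f) \<Longrightarrow>
      \<gamma> (Cmp S f g) (map (rres S g) d) = rst X g (\<gamma> f d)"
  shows "\<gamma> \<in> expo S P X c"
  using assms by (simp add: expo_def)

lemma expo_el: "\<gamma> \<in> expo S P X c \<Longrightarrow> Cod S f = c \<Longrightarrow> d \<in> P (Dom S f) \<Longrightarrow> \<gamma> f d \<in> el X (Dom S f)"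
  by (simp add: expo_def)

lemma expo_undefined:
  "\<gamma> \<in> expo S P X c \<Longrightarrow> \<not> (Cod S f = c \<and> d \<in> P (Dom S f)) \<Longrightarrow> \<gamma> f d = undefined"
  by (auto simp: expo_def)

lemma expo_nat:
  "\<gamma> \<in> expo S P X c \<Longrightarrow> Cod S f = c \<Longrightarrow> Cod S g = Dom S f \<Longrightarrow> d \<in> P (Dom S f) \<Longrightarrow>
    \<gamma> (Cmp S f g) (map (rres S g) d) = rst X g (\<gamma> f d)"
  by (simp add: expo_def)

text \<open>Both families are \<open>undefined\<close> off their common domain, so agreement on
  points is equality of HOL functions.\<close>

lemma expo_eqI:
  assumes "\<gamma> \<in> expo S P X c" "\<delta> \<in> expo S P X c"
    and "\<And>f d. Cod S f = c \<Longrightarrow> d \<in> P (Dom S f) \<Longrightarrow> \<gamma> f d = \<delta> f d"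
  shows "\<gamma> = \<delta>"
proof (intro ext)
  fix f d
  show "\<gamma> f d = \<delta> f d"
    by (cases "Cod S f = c \<and> d \<in> P (Dom S f)")
       (use assms expo_undefined[OF assms(1)] expo_undefined[OF assms(2)] in metis)+
qed

lemma lam_beta [simp]: "Cod S f = c \<Longrightarrow> d \<in> P (Dom S f) \<Longrightarrow> lam S P c u f d = u f d"
  by (simp add: lam_def)

text \<open>The last premise keeps a restricted point inside \<open>P\<close>; without it the guard
  of \<open>lam\<close> could fail at the composite arrow and spoil naturality.\<close>

lemma (in sdg_line) lam_expo:
  assumes "\<And>f d. Cod S f = c \<Longrightarrow> d \<in> P (Dom S f) \<Longrightarrow> u f d \<in> el X (Dom S f)"
    and "\<And>f g d. Cod S f = c \<Longrightarrow> Cod S g = Dom S f \<Longrightarrow> d \<in> P (Dom S f) \<Longrightarrow>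
      u (Cmp S f g) (map (rres S g) d) = rst X g (u f d)"
    and "\<And>f d. d \<in> P (Cod S f) \<Longrightarrow> map (rres S f) d \<in> P (Dom S f)"
  shows "lam S P c u \<in> expo S P X c"
proof (rule expoI)
  fix f g d
  assume *: "Cod S f = c" "Cod S g = Dom S f" "d \<in> P (Dom S f)"
  then have "map (rres S g) d \<in> P (Dom S g)"
    using assms(3)[of d g] by simp
  then show "lam S P c u (Cmp S f g) (map (rres S g) d) = rst X g (lam S P c u f d)"
    using * assms(2) by simp
qed (auto simp: lam_def assms(1))

subsection \<open>The Weil algebras of \<open>D\<close>, \<open>D(2)\<close> and \<open>D \<times> D\<close>\<close>

text \<open>Basis \<open>1, x\<^sub>1, \<dots>, x\<^sub>n\<close> with all products \<open>x\<^sub>i x\<^sub>j\<close> zero.\<close>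

definition weil_square_zero :: "nat \<Rightarrow> 'k::comm_ring_1 weil_data" where
  "weil_square_zero n = \<lparr>wdim = Suc n,
    wtab = (\<lambda>i j l. if i = 0 \<and> l = j \<or> j = 0 \<and> l = i then 1 else 0)\<rparr>"

text \<open>Basis \<open>1, x, y, xy\<close>, where \<open>x\<^sup>2 = y\<^sup>2 = 0\<close>.\<close>

definition weil_DD :: "'k::comm_ring_1 weil_data" where
  "weil_DD = \<lparr>wdim = 4,
    wtab = (\<lambda>i j l. if i = 0 \<and> l = j \<or> j = 0 \<and> l = i \<or> l = 3 \<and> {i, j} = {1, 2} then 1 else 0)\<rparr>"

lemma wvec_eqI:
  "x \<in> wvec W \<Longrightarrow> y \<in> wvec W \<Longrightarrow> (\<And>i. i < wdim W \<Longrightarrow> x i = y i) \<Longrightarrow> x = y"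
  by (rule ext) (metis (mono_tags, lifting) mem_Collect_eq not_less wvec_def)

lemma wmul_wvec: "wmul W x y \<in> wvec W"
  by (simp add: wmul_def wvec_def)

lemma wmul_square_zero:
  assumes "l < Suc n"
  shows "wmul (weil_square_zero n) x y l = (if l = 0 then x 0 * y 0 else x 0 * y l + x l * y 0)"
proof -
  \<comment> \<open>The row of the unit gives the first sum; a row \<open>Suc i\<close> meets a
    nonzero entry only in column 0, giving the second. The product of unit with unit is thus counted
    once.\<close>
  have "wmul (weil_square_zero n) x y l =
      (\<Sum>j<Suc n. if j = l then x 0 * y j else 0) + (\<Sum>i<n. if l = Suc i then x l * y 0 else 0)"
    using assms by (auto simp: wmul_def weil_square_zero_def sum.lessThan_Suc_shift
        simp del: sum.lessThan_Suc intro!: sum.cong arg_cong2[where f = plus])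
  then show ?thesis
    using assms by (cases l) (auto simp del: sum.lessThan_Suc)
qed

lemma wmul_DD:
  "wmul weil_DD x y l = (if l = 0 then x 0 * y 0 else if l = 1 then x 0 * y 1 + x 1 * y 0
    else if l = 2 then x 0 * y 2 + x 2 * y 0
    else if l = 3 then x 0 * y 3 + x 1 * y 2 + x 2 * y 1 + x 3 * y 0 else 0)"
  by (auto simp: wmul_def weil_DD_def eval_nat_numeral lessThan_Suc doubleton_eq_iff algebra_simps)

lemma weil_square_zero: "weil_algebra (weil_square_zero n)"
proof -
  let ?W = "weil_square_zero n :: 'a weil_data"
  have dim: "wdim ?W = Suc n"
    by (simp add: weil_square_zero_def)
  note eq = wvec_eqI[where W = ?W] and mul = wmul_square_zero
  \<comment> \<open>Any two elements of the augmentation ideal multiply to zero, so 2 is a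
    nilpotency bound.\<close>
  have aug: "foldr (wmul ?W) xs wone = (\<lambda>_. 0)"
    if xs: "length xs = 2" "set xs \<subseteq> waug ?W" for xs
  proof -
    obtain x y where xy: "xs = [x, y]" "x \<in> waug ?W" "y \<in> waug ?W"
      using xs by (auto simp: length_Suc_conv eval_nat_numeral)
    show ?thesis
    proof (rule eq)
      show "foldr (wmul ?W) xs wone \<in> wvec ?W"
        using xy by (simp add: wmul_wvec)
      show "(\<lambda>_. 0) \<in> wvec ?W"
        by (simp add: wvec_def)
    qed (use xy in \<open>auto simp: dim mul waug_def wone_def\<close>)
  qed
  show ?thesis
    unfolding weil_algebra_def
  proof (intro conjI ballI)
    fix x y z assume x: "x \<in> wvec ?W"
    show "wmul ?W wone x = x"
      by (rule eq[OF wmul_wvec x]) (auto simp: dim mul wone_def)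
    show "wmul ?W x y = wmul ?W y x"
      by (rule eq[OF wmul_wvec wmul_wvec]) (auto simp: dim mul)
    show "wmul ?W (wmul ?W x y) z = wmul ?W x (wmul ?W y z)"
      by (rule eq[OF wmul_wvec wmul_wvec]) (auto simp: dim mul algebra_simps)
  qed (use aug in \<open>auto simp: dim waug_def wmul_wvec mul\<close>)
qed

lemma weil_DD: "weil_algebra weil_DD"
proof -
  let ?W = "weil_DD :: 'a weil_data"
  have dim: "wdim ?W = 4"
    by (simp add: weil_DD_def)
  note eq = wvec_eqI[where W = ?W]
  \<comment> \<open>Here x y survives as a basis vector, so the bound is 3 rather than 2.\<close>
  have aug: "foldr (wmul ?W) xs wone = (\<lambda>_. 0)"
    if xs: "length xs = 3" "set xs \<subseteq> waug ?W" for xs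
  proof -
    obtain x y z where "xs = [x, y, z]" "x \<in> waug ?W" "y \<in> waug ?W" "z \<in> waug ?W"
      using xs by (auto simp: length_Suc_conv eval_nat_numeral)
    then show ?thesis
      by (auto simp: fun_eq_iff wmul_DD waug_def wone_def)
  qed
  show ?thesis
    unfolding weil_algebra_def
  proof (intro conjI ballI)
    fix x y z assume x: "x \<in> wvec ?W"
    show "wmul ?W wone x = x"
      by (rule eq[OF wmul_wvec x]) (auto simp: dim wmul_DD wone_def eval_nat_numeral less_Suc_eq)
    show "wmul ?W x y = wmul ?W y x"
      by (auto simp: wmul_DD fun_eq_iff)
    show "wmul ?W (wmul ?W x y) z = wmul ?W x (wmul ?W y z)"
      by (auto simp: wmul_DD fun_eq_iff algebra_simps)
  qed (use aug in \<open>auto simp: dim waug_def wmul_wvec wmul_DD\<close>)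
qed

subsection \<open>Points of the Weil algebras and the Kock--Lawvere axiom\<close>

context sdg_line
begin

lemma finsum_delta:
  assumes "i \<in> {..<n::nat}" "p i \<in> carrier (rng S c)"
    and "\<And>l. l < n \<Longrightarrow> f l = (if l = i then p l else \<zero>\<^bsub>rng S c\<^esub>)"
  shows "finsum (rng S c) f {..<n} = p i"
proof -
  have "finsum (rng S c) f {..<n} =
      finsum (rng S c) (\<lambda>l. if i = l then p i else \<zero>\<^bsub>rng S c\<^esub>) {..<n}"
    using assms by (intro R.finsum_cong') auto
  then show ?thesis
    using assms R.finsum_singleton[of i "{..<n}" "\<lambda>_. p i" c] by simp
qed

lemma finsum_0:
  assumes "\<And>l. l < n \<Longrightarrow> f l = \<zero>\<^bsub>rng S c\<^esub>"
  shows "finsum (rng S c) f {..<n::nat} = \<zero>\<^bsub>rng S c\<^esub>"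
proof -
  have "finsum (rng S c) f {..<n} = finsum (rng S c) (\<lambda>l. \<zero>\<^bsub>rng S c\<^esub>) {..<n}"
    using assms by (intro R.finsum_cong') auto
  then show ?thesis
    by simp
qed

text \<open>The relations involving the basis vector 1 hold automatically once it is sent to the
  unit; what is left is the vanishing of all products of the other coordinates, squares
  included.\<close>

lemma Spec_square_zero:
  "Spec S (weil_square_zero n) c = {\<one>\<^bsub>rng S c\<^esub> # v |v. length v = n \<and> set v \<subseteq> carrier (rng S c) \<and>
    (\<forall>i<n. \<forall>j<n. v ! i \<otimes>\<^bsub>rng S c\<^esub> v ! j = \<zero>\<^bsub>rng S c\<^esub>)}"
proof -
  let ?W = "weil_square_zero n :: 'k weil_data"
  have sum: "(\<Oplus>\<^bsub>rng S c\<^esub>l\<in>{..<wdim ?W}. scal S (wtab ?W i j l) c \<otimes>\<^bsub>rng S c\<^esub> p ! l) =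
      (if i = 0 then p ! j else if j = 0 then p ! i else \<zero>\<^bsub>rng S c\<^esub>)"
    if "i < Suc n" "j < Suc n" "length p = Suc n" "set p \<subseteq> carrier (rng S c)" for i j p
  proof -
    have p: "p ! l \<in> carrier (rng S c)" if "l < Suc n" for l
      using that \<open>length p = Suc n\<close> \<open>set p \<subseteq> _\<close> by auto
    show ?thesis
      using that p
      by (auto simp: weil_square_zero_def intro!: finsum_delta[where p = "\<lambda>l. p ! l"] finsum_0)
  qed
  have "(\<forall>i<Suc n. \<forall>j<Suc n. p ! i \<otimes>\<^bsub>rng S c\<^esub> p ! j =
      (if i = 0 then p ! j else if j = 0 then p ! i else \<zero>\<^bsub>rng S c\<^esub>)) \<longleftrightarrow>
      (\<forall>i<n. \<forall>j<n. v ! i \<otimes>\<^bsub>rng S c\<^esub> v ! j = \<zero>\<^bsub>rng S c\<^esub>)"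
    if p: "p = \<one>\<^bsub>rng S c\<^esub> # v" "length v = n" "set v \<subseteq> carrier (rng S c)" for p v
  proof -
    have v: "v ! i \<in> carrier (rng S c)" if "i < n" for i
      using that p by auto
    show ?thesis
      using v by (simp add: All_less_Suc2 p(1))
  qed
  note mult = this
  show ?thesis
  proof (intro equalityI subsetI)
    fix p assume "p \<in> Spec S ?W c"
    then have p: "length p = Suc n" "set p \<subseteq> carrier (rng S c)" "p ! 0 = \<one>\<^bsub>rng S c\<^esub>"
      and m: "\<And>i j. i < Suc n \<Longrightarrow> j < Suc n \<Longrightarrow> p ! i \<otimes>\<^bsub>rng S c\<^esub> p ! j =
        (\<Oplus>\<^bsub>rng S c\<^esub>l\<in>{..<wdim ?W}. scal S (wtab ?W i j l) c \<otimes>\<^bsub>rng S c\<^esub> p ! l)"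
      by (auto simp: Spec_def weil_square_zero_def)
    obtain v where v: "p = \<one>\<^bsub>rng S c\<^esub> # v" "length v = n" "set v \<subseteq> carrier (rng S c)"
      using p by (cases p) auto
    have "\<forall>i<n. \<forall>j<n. v ! i \<otimes>\<^bsub>rng S c\<^esub> v ! j = \<zero>\<^bsub>rng S c\<^esub>"
      unfolding mult[OF v, symmetric] using m sum[OF _ _ p(1,2)] by simp
    then show "p \<in> {\<one>\<^bsub>rng S c\<^esub> # v |v. length v = n \<and> set v \<subseteq> carrier (rng S c) \<and>
        (\<forall>i<n. \<forall>j<n. v ! i \<otimes>\<^bsub>rng S c\<^esub> v ! j = \<zero>\<^bsub>rng S c\<^esub>)}"
      using v by blast
  next
    fix p assume "p \<in> {\<one>\<^bsub>rng S c\<^esub> # v |v. length v = n \<and> set v \<subseteq> carrier (rng S c) \<and>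
        (\<forall>i<n. \<forall>j<n. v ! i \<otimes>\<^bsub>rng S c\<^esub> v ! j = \<zero>\<^bsub>rng S c\<^esub>)}"
    then obtain v where v: "p = \<one>\<^bsub>rng S c\<^esub> # v" "length v = n" "set v \<subseteq> carrier (rng S c)"
      and z: "\<forall>i<n. \<forall>j<n. v ! i \<otimes>\<^bsub>rng S c\<^esub> v ! j = \<zero>\<^bsub>rng S c\<^esub>"
      by blast
    have p: "length p = Suc n" "set p \<subseteq> carrier (rng S c)"
      using v by auto
    have dim: "wdim ?W = Suc n"
      by (simp add: weil_square_zero_def)
    have "p ! i \<otimes>\<^bsub>rng S c\<^esub> p ! j =
        (\<Oplus>\<^bsub>rng S c\<^esub>l\<in>{..<wdim ?W}. scal S (wtab ?W i j l) c \<otimes>\<^bsub>rng S c\<^esub> p ! l)"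
      if "i < Suc n" "j < Suc n" for i j
      using sum[OF that p] iffD2[OF mult[OF v] z] that by simp
    then show "p \<in> Spec S ?W c"
      using p v(1) unfolding Spec_def dim by auto
  qed
qed

lemma finsum_lessThan_Suc:
  fixes n :: nat
  assumes "\<forall>i<Suc n. f i \<in> carrier (rng S c)"
  shows "finsum (rng S c) f {..<Suc n} = finsum (rng S c) f {..<n} \<oplus>\<^bsub>rng S c\<^esub> f n"
proof -
  have "finsum (rng S c) f {..<Suc n} = f n \<oplus>\<^bsub>rng S c\<^esub> finsum (rng S c) f {..<n}"
    using assms unfolding lessThan_Suc by (intro R.finsum_insert) auto
  also have "\<dots> = finsum (rng S c) f {..<n} \<oplus>\<^bsub>rng S c\<^esub> f n"
    using assms by (intro R.a_comm R.finsum_closed) auto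
  finally show ?thesis .
qed

lemma Spec_D: "Spec S (weil_square_zero (Suc 0)) c = {[\<one>\<^bsub>rng S c\<^esub>, d] |d. d \<in> DD S c}"
  by (auto simp: Spec_square_zero length_Suc_conv DD_iff simp del: DD_closed DD_square)

lemma Spec_D2: "Spec S (weil_square_zero 2) c =
    {[\<one>\<^bsub>rng S c\<^esub>, d, e] |d e. d \<in> DD S c \<and> e \<in> DD S c \<and> d \<otimes>\<^bsub>rng S c\<^esub> e = \<zero>\<^bsub>rng S c\<^esub>}"
  by (auto simp: Spec_square_zero length_Suc_conv eval_nat_numeral DD_iff less_Suc_eq R.m_comm
      simp del: DD_closed DD_square)

text \<open>The image of x y is forced to be d e, so these points are those of D x D with the
  product stored as a redundant last coordinate. Multiplication D x D \<rightarrow> D is therefore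
  just reading off \<open>p ! 3\<close>.\<close>

lemma Spec_DD: "Spec S weil_DD c =
    {[\<one>\<^bsub>rng S c\<^esub>, d, e, d \<otimes>\<^bsub>rng S c\<^esub> e] |d e. d \<in> DD S c \<and> e \<in> DD S c}"
proof -
  let ?W = "weil_DD :: 'k weil_data"
  have dim: "wdim ?W = 4"
    by (simp add: weil_DD_def)
  have sum: "(\<Oplus>\<^bsub>rng S c\<^esub>l\<in>{..<4}. scal S (wtab ?W i j l) c \<otimes>\<^bsub>rng S c\<^esub> p ! l) =
      (if i = 0 then p ! j else if j = 0 then p ! i
        else if {i, j} = {1, 2} then p ! 3 else \<zero>\<^bsub>rng S c\<^esub>)"
    if "i < 4" "j < 4" "length p = 4" "set p \<subseteq> carrier (rng S c)" for i j p
  proof -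
    have p: "p ! l \<in> carrier (rng S c)" if "l < 4" for l
      using that \<open>length p = 4\<close> \<open>set p \<subseteq> _\<close> by auto
    show ?thesis
      using that p
      by (auto simp: weil_DD_def doubleton_eq_iff
          intro!: finsum_delta[where p = "\<lambda>l. p ! l"] finsum_0)
  qed
  have "p \<in> Spec S ?W c \<longleftrightarrow> length p = 4 \<and> set p \<subseteq> carrier (rng S c) \<and> p ! 0 = \<one>\<^bsub>rng S c\<^esub> \<and>
      (\<forall>i<4. \<forall>j<4. p ! i \<otimes>\<^bsub>rng S c\<^esub> p ! j = (if i = 0 then p ! j else if j = 0 then p ! i
        else if {i, j} = {1, 2} then p ! 3 else \<zero>\<^bsub>rng S c\<^esub>))" for p
    by (simp add: Spec_def dim sum cong: conj_cong)
  note Spec = this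
  show ?thesis
  proof (intro equalityI subsetI)
    fix p assume p: "p \<in> Spec S ?W c"
    then obtain u d e m where eq: "p = [u, d, e, m]"
      by (auto simp: Spec length_Suc_conv eval_nat_numeral)
    have "p ! 0 = \<one>\<^bsub>rng S c\<^esub>" "p ! 1 \<otimes>\<^bsub>rng S c\<^esub> p ! 1 = \<zero>\<^bsub>rng S c\<^esub>"
      "p ! 2 \<otimes>\<^bsub>rng S c\<^esub> p ! 2 = \<zero>\<^bsub>rng S c\<^esub>" "p ! 1 \<otimes>\<^bsub>rng S c\<^esub> p ! 2 = p ! 3"
      using p unfolding Spec by (auto simp: doubleton_eq_iff)
    moreover have "set p \<subseteq> carrier (rng S c)"
      using p unfolding Spec by blast
    ultimately show "p \<in> {[\<one>\<^bsub>rng S c\<^esub>, d, e, d \<otimes>\<^bsub>rng S c\<^esub> e] |d e. d \<in> DD S c \<and> e \<in> DD S c}"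
      by (auto simp: eq DD_iff simp del: DD_closed DD_square)
  next
    fix p assume "p \<in> {[\<one>\<^bsub>rng S c\<^esub>, d, e, d \<otimes>\<^bsub>rng S c\<^esub> e] |d e. d \<in> DD S c \<and> e \<in> DD S c}"
    then obtain d e where p: "p = [\<one>\<^bsub>rng S c\<^esub>, d, e, d \<otimes>\<^bsub>rng S c\<^esub> e]"
      and d: "d \<in> DD S c" "e \<in> DD S c"
      by blast
    have c: "e \<otimes>\<^bsub>rng S c\<^esub> d = d \<otimes>\<^bsub>rng S c\<^esub> e"
      using d by (simp add: R.m_comm)
    have z1: "d \<otimes>\<^bsub>rng S c\<^esub> (d \<otimes>\<^bsub>rng S c\<^esub> e) = \<zero>\<^bsub>rng S c\<^esub>"
      using d R.m_assoc[of d c d e] by simp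
    have z2: "d \<otimes>\<^bsub>rng S c\<^esub> e \<otimes>\<^bsub>rng S c\<^esub> e = \<zero>\<^bsub>rng S c\<^esub>"
      using d R.m_assoc[of d c e e] by simp
    have z3: "d \<otimes>\<^bsub>rng S c\<^esub> e \<otimes>\<^bsub>rng S c\<^esub> d = \<zero>\<^bsub>rng S c\<^esub>"
      using d z1 R.m_comm[of "d \<otimes>\<^bsub>rng S c\<^esub> e" c d] by simp
    have z4: "e \<otimes>\<^bsub>rng S c\<^esub> (d \<otimes>\<^bsub>rng S c\<^esub> e) = \<zero>\<^bsub>rng S c\<^esub>"
      using d z2 R.m_comm[of "d \<otimes>\<^bsub>rng S c\<^esub> e" c e] by simp
    have z5: "d \<otimes>\<^bsub>rng S c\<^esub> e \<otimes>\<^bsub>rng S c\<^esub> (d \<otimes>\<^bsub>rng S c\<^esub> e) = \<zero>\<^bsub>rng S c\<^esub>"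
      using d DD_square[OF DD_mult(1)[of d c e]] by simp
    note z = c z1 z2 z3 z4 z5
    show "p \<in> Spec S ?W c"
      unfolding Spec using d z
      by (auto simp: p doubleton_eq_iff less_Suc_eq eval_nat_numeral)
  qed
qed

text \<open>The canonical map from R \<otimes> W to the functions on \<open>Spec S W\<close>,
  applied to a coefficient vector \<open>w\<close>: affine functions on D and D(2), bilinear
  polynomials on D x D.\<close>

definition lin where
  "lin W c w = lam S (Spec S W) c
    (\<lambda>f p. \<Oplus>\<^bsub>rng S (Dom S f)\<^esub>i\<in>{..<wdim W}. rres S f (w ! i) \<otimes>\<^bsub>rng S (Dom S f)\<^esub> p ! i)"

lemma lin_D:
  assumes "a \<in> carrier (rng S c)" "b \<in> carrier (rng S c)" "Cod S f = c" "d \<in> DD S (Dom S f)"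
  shows "lin (weil_square_zero (Suc 0)) c [a, b] f [\<one>\<^bsub>rng S (Dom S f)\<^esub>, d] =
    rres S f a \<oplus>\<^bsub>rng S (Dom S f)\<^esub> rres S f b \<otimes>\<^bsub>rng S (Dom S f)\<^esub> d"
proof -
  have "[\<one>\<^bsub>rng S (Dom S f)\<^esub>, d] \<in> Spec S (weil_square_zero (Suc 0)) (Dom S f)"
    using assms by (simp add: Spec_D)
  then show ?thesis
    using assms
    by (simp add: lin_def weil_square_zero_def finsum_lessThan_Suc All_less_Suc)
qed

lemma lin_D2:
  assumes "a \<in> carrier (rng S c)" "b \<in> carrier (rng S c)" "b' \<in> carrier (rng S c)"
    "Cod S f = c" "d \<in> DD S (Dom S f)" "e \<in> DD S (Dom S f)"
    "d \<otimes>\<^bsub>rng S (Dom S f)\<^esub> e = \<zero>\<^bsub>rng S (Dom S f)\<^esub>"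
  shows "lin (weil_square_zero 2) c [a, b, b'] f [\<one>\<^bsub>rng S (Dom S f)\<^esub>, d, e] =
    rres S f a \<oplus>\<^bsub>rng S (Dom S f)\<^esub> rres S f b \<otimes>\<^bsub>rng S (Dom S f)\<^esub> d
      \<oplus>\<^bsub>rng S (Dom S f)\<^esub> rres S f b' \<otimes>\<^bsub>rng S (Dom S f)\<^esub> e"
proof -
  have "[\<one>\<^bsub>rng S (Dom S f)\<^esub>, d, e] \<in> Spec S (weil_square_zero 2) (Dom S f)"
    using assms by (auto simp add: Spec_D2)
  then show ?thesis
    using assms
    by (simp add: lin_def weil_square_zero_def finsum_lessThan_Suc All_less_Suc eval_nat_numeral)
qed

lemma lin_DD:
  assumes "a \<in> carrier (rng S c)" "b \<in> carrier (rng S c)" "b' \<in> carrier (rng S c)"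
    "g \<in> carrier (rng S c)" "Cod S f = c" "d \<in> DD S (Dom S f)" "e \<in> DD S (Dom S f)"
    "m = d \<otimes>\<^bsub>rng S (Dom S f)\<^esub> e"
  shows "lin weil_DD c [a, b, b', g] f [\<one>\<^bsub>rng S (Dom S f)\<^esub>, d, e, m] =
    rres S f a \<oplus>\<^bsub>rng S (Dom S f)\<^esub> rres S f b \<otimes>\<^bsub>rng S (Dom S f)\<^esub> d
      \<oplus>\<^bsub>rng S (Dom S f)\<^esub> rres S f b' \<otimes>\<^bsub>rng S (Dom S f)\<^esub> e
      \<oplus>\<^bsub>rng S (Dom S f)\<^esub> rres S f g \<otimes>\<^bsub>rng S (Dom S f)\<^esub> m"
proof -
  have "[\<one>\<^bsub>rng S (Dom S f)\<^esub>, d, e, m] \<in> Spec S weil_DD (Dom S f)"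
    using assms by (auto simp add: Spec_DD)
  then show ?thesis
    using assms
    by (simp add: lin_def weil_DD_def finsum_lessThan_Suc All_less_Suc eval_nat_numeral)
qed

text \<open>The existence half of the Kock-Lawvere axiom, strengthened from equality on points to
  equality of families.\<close>

lemma KL_lin:
  assumes "weil_algebra W" "F \<in> expo S (Spec S W) (line_psh S) c"
  obtains w where "length w = wdim W" "set w \<subseteq> carrier (rng S c)" "F = lin W c w"
proof -
  have "\<exists>!w. length w = wdim W \<and> set w \<subseteq> carrier (rng S c) \<and>
        (\<forall>f p. Cod S f = c \<longrightarrow> p \<in> Spec S W (Dom S f) \<longrightarrow>
          F f p = (\<Oplus>\<^bsub>rng S (Dom S f)\<^esub>i\<in>{..<wdim W}.
            rres S f (w ! i) \<otimes>\<^bsub>rng S (Dom S f)\<^esub> p ! i))"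
    using KL assms unfolding kock_lawvere_def by blast
  then obtain w where w: "length w = wdim W" "set w \<subseteq> carrier (rng S c)"
    and eq: "\<And>f p. Cod S f = c \<Longrightarrow> p \<in> Spec S W (Dom S f) \<Longrightarrow> F f p =
      (\<Oplus>\<^bsub>rng S (Dom S f)\<^esub>i\<in>{..<wdim W}. rres S f (w ! i) \<otimes>\<^bsub>rng S (Dom S f)\<^esub> p ! i)"
    by blast
  have "F = lin W c w"
  proof (intro ext)
    fix f p
    show "F f p = lin W c w f p"
      using eq[of f p] expo_undefined[OF assms(2), of f p] by (auto simp: lin_def lam_def)
  qed
  with w that show thesis
    by blast
qed

text \<open>The uniqueness half. The axiom speaks of natural families only, hence the premise that
  \<open>lin W c w\<close> lies in the exponential.\<close>

lemma lin_inject: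
  assumes "weil_algebra W" "lin W c w \<in> expo S (Spec S W) (line_psh S) c"
    and "length w = wdim W" "set w \<subseteq> carrier (rng S c)"
    and "length w' = wdim W" "set w' \<subseteq> carrier (rng S c)"
    and eq: "\<And>f p. Cod S f = c \<Longrightarrow> p \<in> Spec S W (Dom S f) \<Longrightarrow> lin W c w f p = lin W c w' f p"
  shows "w = w'"
proof -
  have "\<exists>!w'. length w' = wdim W \<and> set w' \<subseteq> carrier (rng S c) \<and>
        (\<forall>f p. Cod S f = c \<longrightarrow> p \<in> Spec S W (Dom S f) \<longrightarrow>
          lin W c w f p = (\<Oplus>\<^bsub>rng S (Dom S f)\<^esub>i\<in>{..<wdim W}.
            rres S f (w' ! i) \<otimes>\<^bsub>rng S (Dom S f)\<^esub> p ! i))"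
    using KL assms(1,2) unfolding kock_lawvere_def by blast
  moreover have "lin W c w f p = (\<Oplus>\<^bsub>rng S (Dom S f)\<^esub>i\<in>{..<wdim W}.
      rres S f (w ! i) \<otimes>\<^bsub>rng S (Dom S f)\<^esub> p ! i)"
    "lin W c w f p = (\<Oplus>\<^bsub>rng S (Dom S f)\<^esub>i\<in>{..<wdim W}.
      rres S f (w' ! i) \<otimes>\<^bsub>rng S (Dom S f)\<^esub> p ! i)"
    if "Cod S f = c" "p \<in> Spec S W (Dom S f)" for f p
    using that eq[OF that] by (simp_all add: lin_def)
  ultimately show ?thesis
    using assms(3-6) by blast
qed

lemma lin_D_expo:
  assumes "a \<in> carrier (rng S c)" "b \<in> carrier (rng S c)"
  shows "lin (weil_square_zero (Suc 0)) c [a, b] \<in>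
    expo S (Spec S (weil_square_zero (Suc 0))) (line_psh S) c"
proof (rule expoI)
  fix f g p
  assume *: "Cod S f = c" "Cod S g = Dom S f" "p \<in> Spec S (weil_square_zero (Suc 0)) (Dom S f)"
  then obtain d where d: "p = [\<one>\<^bsub>rng S (Dom S f)\<^esub>, d]" "d \<in> DD S (Dom S f)"
    by (auto simp: Spec_D)
  show "lin (weil_square_zero (Suc 0)) c [a, b] (Cmp S f g) (map (rres S g) p) =
      rst (line_psh S) g (lin (weil_square_zero (Suc 0)) c [a, b] f p)"
    using lin_D[of a c b "Cmp S f g" "rres S g d"] lin_D[of a c b f d] * assms d
    by (simp add: line_psh_def)
next
  fix f p assume *: "Cod S f = c" "p \<in> Spec S (weil_square_zero (Suc 0)) (Dom S f)"
  then obtain d where d: "p = [\<one>\<^bsub>rng S (Dom S f)\<^esub>, d]" "d \<in> DD S (Dom S f)"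
    by (auto simp: Spec_D)
  show "lin (weil_square_zero (Suc 0)) c [a, b] f p \<in> el (line_psh S) (Dom S f)"
    using lin_D[of a c b f d] * assms d by (simp add: line_psh_def)
qed (auto simp: lin_def lam_def)

lemma lin_D2_expo:
  assumes "a \<in> carrier (rng S c)" "b \<in> carrier (rng S c)" "b' \<in> carrier (rng S c)"
  shows "lin (weil_square_zero 2) c [a, b, b'] \<in>
    expo S (Spec S (weil_square_zero 2)) (line_psh S) c"
proof (rule expoI)
  fix f g p
  assume *: "Cod S f = c" "Cod S g = Dom S f" "p \<in> Spec S (weil_square_zero 2) (Dom S f)"
  then obtain d e where d: "p = [\<one>\<^bsub>rng S (Dom S f)\<^esub>, d, e]" "d \<in> DD S (Dom S f)" "e \<in> DD S (Dom S f)"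
    "d \<otimes>\<^bsub>rng S (Dom S f)\<^esub> e = \<zero>\<^bsub>rng S (Dom S f)\<^esub>"
    by (auto simp: Spec_D2)
  have "rres S g d \<otimes>\<^bsub>rng S (Dom S g)\<^esub> rres S g e = \<zero>\<^bsub>rng S (Dom S g)\<^esub>"
    using d * rres_mult[of g "Dom S f" d e] by simp
  then show "lin (weil_square_zero 2) c [a, b, b'] (Cmp S f g) (map (rres S g) p) =
      rst (line_psh S) g (lin (weil_square_zero 2) c [a, b, b'] f p)"
    using lin_D2[of a c b b' "Cmp S f g" "rres S g d" "rres S g e"] lin_D2[of a c b b' f d e] * assms d
    by (simp add: line_psh_def)
next
  fix f p assume *: "Cod S f = c" "p \<in> Spec S (weil_square_zero 2) (Dom S f)"
  then obtain d e where d: "p = [\<one>\<^bsub>rng S (Dom S f)\<^esub>, d, e]" "d \<in> DD S (Dom S f)" "e \<in> DD S (Dom S f)"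
    "d \<otimes>\<^bsub>rng S (Dom S f)\<^esub> e = \<zero>\<^bsub>rng S (Dom S f)\<^esub>"
    by (auto simp: Spec_D2)
  show "lin (weil_square_zero 2) c [a, b, b'] f p \<in> el (line_psh S) (Dom S f)"
    using lin_D2[of a c b b' f d e] * assms d by (simp add: line_psh_def)
qed (auto simp: lin_def lam_def)

end

subsection \<open>Two colimits perceived by the line\<close>

context sdg_line
begin

abbreviation "WD \<equiv> weil_square_zero (Suc 0) :: 'k weil_data"
abbreviation "WD2 \<equiv> weil_square_zero 2 :: 'k weil_data"
abbreviation "WDD \<equiv> weil_DD :: 'k weil_data"

lemma wdim_simps [simp]: "wdim WD = 2" "wdim WD2 = 3" "wdim WDD = 4"
  by (simp_all add: weil_square_zero_def weil_DD_def)

text \<open>Because of the leading unit coordinate, \<open>p ! 1\<close> is the parameter in D. The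
  maps named \<open>fst\<close> and \<open>snd\<close> are the inclusions of the two axes, those
  named \<open>pt\<close> are constant at the origin; a constant map still takes a point, since an
  edge must be a map out of its source vertex.\<close>

definition pt_D where "pt_D c p = [\<one>\<^bsub>rng S c\<^esub>, \<zero>\<^bsub>rng S c\<^esub>]"
definition fst_D2 where "fst_D2 c p = [\<one>\<^bsub>rng S c\<^esub>, p ! 1, \<zero>\<^bsub>rng S c\<^esub>]"
definition snd_D2 where "snd_D2 c p = [\<one>\<^bsub>rng S c\<^esub>, \<zero>\<^bsub>rng S c\<^esub>, p ! 1]"
definition pt_D2 where "pt_D2 c p = [\<one>\<^bsub>rng S c\<^esub>, \<zero>\<^bsub>rng S c\<^esub>, \<zero>\<^bsub>rng S c\<^esub>]"
definition fst_DD where "fst_DD c p = [\<one>\<^bsub>rng S c\<^esub>, p ! 1, \<zero>\<^bsub>rng S c\<^esub>, \<zero>\<^bsub>rng S c\<^esub>]"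
definition snd_DD where "snd_DD c p = [\<one>\<^bsub>rng S c\<^esub>, \<zero>\<^bsub>rng S c\<^esub>, p ! 1, \<zero>\<^bsub>rng S c\<^esub>]"
definition pt_DD where
  "pt_DD c p = [\<one>\<^bsub>rng S c\<^esub>, \<zero>\<^bsub>rng S c\<^esub>, \<zero>\<^bsub>rng S c\<^esub>, \<zero>\<^bsub>rng S c\<^esub>]"
definition mult_DD where "mult_DD c p = [\<one>\<^bsub>rng S c\<^esub>, p ! 3]"

lemmas leg_defs = pt_D_def fst_D2_def snd_D2_def pt_D2_def fst_DD_def snd_DD_def pt_DD_def
  mult_DD_def

lemma lam_eq_lin:
  assumes "\<And>f p. Cod S f = c \<Longrightarrow> p \<in> Spec S W (Dom S f) \<Longrightarrow> u f p = lin W c w f p"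
  shows "lam S (Spec S W) c u = lin W c w"
  using assms by (auto simp: lin_def lam_def fun_eq_iff)

text \<open>On Kock-Lawvere coefficients, evaluation at the origin deletes the slope, and
  multiplication moves the slope to the coefficient of d e. Such bookkeeping reduces the two colimit
  properties to linear algebra.\<close>

lemma precomp_lin:
  assumes "a \<in> carrier (rng S c)" "b \<in> carrier (rng S c)"
  shows "precomp S (Spec S WD) pt_D c (lin WD c [a, b]) = lin WD c [a, \<zero>\<^bsub>rng S c\<^esub>]"
    and "precomp S (Spec S WDD) mult_DD c (lin WD c [a, b]) =
      lin WDD c [a, \<zero>\<^bsub>rng S c\<^esub>, \<zero>\<^bsub>rng S c\<^esub>, b]"
  unfolding precomp_def using assms
  by (auto intro!: lam_eq_lin simp: Spec_D Spec_DD lin_D lin_DD leg_defs)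

lemma precomp_lin_D2:
  assumes "a \<in> carrier (rng S c)" "b \<in> carrier (rng S c)" "b' \<in> carrier (rng S c)"
  shows "precomp S (Spec S WD) fst_D2 c (lin WD2 c [a, b, b']) = lin WD c [a, b]"
    and "precomp S (Spec S WD) snd_D2 c (lin WD2 c [a, b, b']) = lin WD c [a, b']"
    and "precomp S (Spec S WD) pt_D2 c (lin WD2 c [a, b, b']) = lin WD c [a, \<zero>\<^bsub>rng S c\<^esub>]"
  unfolding precomp_def using assms
  by (auto intro!: lam_eq_lin simp: Spec_D lin_D lin_D2 leg_defs)

lemma precomp_lin_DD:
  assumes "a \<in> carrier (rng S c)" "b \<in> carrier (rng S c)" "b' \<in> carrier (rng S c)"
    "g \<in> carrier (rng S c)"
  shows "precomp S (Spec S WD) fst_DD c (lin WDD c [a, b, b', g]) = lin WD c [a, b]"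
    and "precomp S (Spec S WD) snd_DD c (lin WDD c [a, b, b', g]) = lin WD c [a, b']"
    and "precomp S (Spec S WD) pt_DD c (lin WDD c [a, b, b', g]) = lin WD c [a, \<zero>\<^bsub>rng S c\<^esub>]"
  unfolding precomp_def using assms
  by (auto intro!: lam_eq_lin simp: Spec_D lin_D lin_DD leg_defs)

lemma KL_D:
  assumes "F \<in> expo S (Spec S WD) (line_psh S) c"
  obtains a b where "a \<in> carrier (rng S c)" "b \<in> carrier (rng S c)" "F = lin WD c [a, b]"
proof -
  obtain w where w: "length w = wdim WD" "set w \<subseteq> carrier (rng S c)" "F = lin WD c w"
    using KL_lin[OF weil_square_zero assms] .
  then obtain a b where "w = [a, b]"
    by (auto simp: length_Suc_conv eval_nat_numeral)
  with w show thesis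
    by (intro that) auto
qed

lemma KL_D2:
  assumes "F \<in> expo S (Spec S WD2) (line_psh S) c"
  obtains a b b' where "a \<in> carrier (rng S c)" "b \<in> carrier (rng S c)" "b' \<in> carrier (rng S c)"
    "F = lin WD2 c [a, b, b']"
proof -
  obtain w where w: "length w = wdim WD2" "set w \<subseteq> carrier (rng S c)" "F = lin WD2 c w"
    using KL_lin[OF weil_square_zero assms] .
  then obtain a b b' where "w = [a, b, b']"
    by (auto simp: length_Suc_conv eval_nat_numeral simp del: wdim_simps)
       (auto simp: weil_square_zero_def length_Suc_conv)
  with w show thesis
    by (intro that) auto
qed

lemma KL_DD:
  assumes "F \<in> expo S (Spec S WDD) (line_psh S) c"
  obtains a b b' g where "a \<in> carrier (rng S c)" "b \<in> carrier (rng S c)" "b' \<in> carrier (rng S c)"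
    "g \<in> carrier (rng S c)" "F = lin WDD c [a, b, b', g]"
proof -
  obtain w where w: "length w = wdim WDD" "set w \<subseteq> carrier (rng S c)" "F = lin WDD c w"
    using KL_lin[OF weil_DD assms] .
  then obtain a b b' g where "w = [a, b, b', g]"
    by (auto simp: length_Suc_conv eval_nat_numeral)
  with w show thesis
    by (intro that) auto
qed

lemma lin_D_inject:
  assumes "lin WD c [a, b] = lin WD c [a', b']" "a \<in> carrier (rng S c)" "b \<in> carrier (rng S c)"
    "a' \<in> carrier (rng S c)" "b' \<in> carrier (rng S c)"
  shows "a = a' \<and> b = b'"
  using lin_inject[OF weil_square_zero lin_D_expo, of a c b "[a', b']"] assms by simp

lemma lin_DD_expo:
  assumes "a \<in> carrier (rng S c)" "b \<in> carrier (rng S c)"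
  shows "lin WDD c [a, \<zero>\<^bsub>rng S c\<^esub>, \<zero>\<^bsub>rng S c\<^esub>, b] \<in> expo S (Spec S WDD) (line_psh S) c"
proof (rule expoI)
  fix f g p
  assume *: "Cod S f = c" "Cod S g = Dom S f" "p \<in> Spec S WDD (Dom S f)"
  then obtain d e where d: "p = [\<one>\<^bsub>rng S (Dom S f)\<^esub>, d, e, d \<otimes>\<^bsub>rng S (Dom S f)\<^esub> e]"
    "d \<in> DD S (Dom S f)" "e \<in> DD S (Dom S f)"
    by (auto simp: Spec_DD)
  let ?w = "lin WDD c [a, \<zero>\<^bsub>rng S c\<^esub>, \<zero>\<^bsub>rng S c\<^esub>, b]"
  show "?w (Cmp S f g) (map (rres S g) p) = rst (line_psh S) g (?w f p)"
    using lin_DD[of a c "\<zero>\<^bsub>rng S c\<^esub>" "\<zero>\<^bsub>rng S c\<^esub>" b "Cmp S f g" "rres S g d" "rres S g e"]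
      lin_DD[of a c "\<zero>\<^bsub>rng S c\<^esub>" "\<zero>\<^bsub>rng S c\<^esub>" b f d e] * assms d
    by (simp add: line_psh_def)
next
  fix f p assume *: "Cod S f = c" "p \<in> Spec S WDD (Dom S f)"
  then obtain d e where d: "p = [\<one>\<^bsub>rng S (Dom S f)\<^esub>, d, e, d \<otimes>\<^bsub>rng S (Dom S f)\<^esub> e]"
    "d \<in> DD S (Dom S f)" "e \<in> DD S (Dom S f)"
    by (auto simp: Spec_DD)
  show "lin WDD c [a, \<zero>\<^bsub>rng S c\<^esub>, \<zero>\<^bsub>rng S c\<^esub>, b] f p \<in> el (line_psh S) (Dom S f)"
    using lin_DD[of a c "\<zero>\<^bsub>rng S c\<^esub>" "\<zero>\<^bsub>rng S c\<^esub>" b f d e] * assms d by (simp add: line_psh_def)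
qed (auto simp: lin_def lam_def)

text \<open>D(2) as two copies of D joined at the origin. The third vertex, a copy of D that both
  edges collapse to 0, stands in for the one-point space.\<close>

lemma cocone_D2:
  "inf_cocone S [WD, WD, WD] [(2, 0, pt_D), (2, 1, pt_D)] WD2 [fst_D2, snd_D2, pt_D2]"
  by (auto simp: inf_cocone_def weil_square_zero inf_map_def Spec_D Spec_D2 leg_defs
      less_Suc_eq)

text \<open>The quotient of D x D by its two axes, with multiplication as quotient map: the three
  parallel edges make a family on D x D agree along each axis with its value at the origin.\<close>

lemma cocone_DD:
  "inf_cocone S [WD, WDD] [(0, 1, fst_DD), (0, 1, snd_DD), (0, 1, pt_DD)] WD [pt_D, mult_DD]"
  by (auto simp: inf_cocone_def weil_square_zero weil_DD inf_map_def Spec_D Spec_DD leg_defs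
      less_Suc_eq)

text \<open>Affine functions a + b d and a + b' e with the same constant term glue to a + b d + b'
  e, and restriction to the axes recovers all three coefficients.\<close>

lemma line_perceives_D2:
  "perceives_colimit S (line_psh S) [WD, WD, WD] [(2, 0, pt_D), (2, 1, pt_D)] WD2
    [fst_D2, snd_D2, pt_D2]"
  unfolding perceives_colimit_def
proof (intro allI impI)
  fix c and \<gamma> :: "nat \<Rightarrow> 'a \<Rightarrow> 'r list \<Rightarrow> 'r"
  assume "\<forall>i<length [WD, WD, WD]. \<gamma> i \<in> expo S (Spec S ([WD, WD, WD] ! i)) (line_psh S) c"
  then have \<gamma>: "\<gamma> 0 \<in> expo S (Spec S WD) (line_psh S) c" "\<gamma> 1 \<in> expo S (Spec S WD) (line_psh S) c"
    by (auto simp: eval_nat_numeral All_less_Suc)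
  assume "\<forall>(i, j, h)\<in>set [(2, 0, pt_D), (2, 1, pt_D)].
    precomp S (Spec S ([WD, WD, WD] ! i)) h c (\<gamma> j) = \<gamma> i"
  then have edge: "precomp S (Spec S WD) pt_D c (\<gamma> 0) = \<gamma> 2"
    "precomp S (Spec S WD) pt_D c (\<gamma> 1) = \<gamma> 2"
    by (auto simp: eval_nat_numeral)
  obtain a b where ab: "a \<in> carrier (rng S c)" "b \<in> carrier (rng S c)" "\<gamma> 0 = lin WD c [a, b]"
    using KL_D[OF \<gamma>(1)] .
  obtain a' b' where ab': "a' \<in> carrier (rng S c)" "b' \<in> carrier (rng S c)" "\<gamma> 1 = lin WD c [a', b']"
    using KL_D[OF \<gamma>(2)] .
  have \<gamma>2: "\<gamma> 2 = lin WD c [a, \<zero>\<^bsub>rng S c\<^esub>]" "\<gamma> 2 = lin WD c [a', \<zero>\<^bsub>rng S c\<^esub>]"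
    using edge precomp_lin(1) ab ab' by simp_all
  \<comment> \<open>Both edges produce the same constant family, so the constant terms
    agree.\<close>
  then have a': "a' = a"
    using lin_D_inject[of c a "\<zero>\<^bsub>rng S c\<^esub>" a' "\<zero>\<^bsub>rng S c\<^esub>"] ab ab' by simp
  have legs: "(\<forall>i<length [WD, WD, WD].
      precomp S (Spec S ([WD, WD, WD] ! i)) ([fst_D2, snd_D2, pt_D2] ! i) c \<delta> = \<gamma> i) \<longleftrightarrow>
    precomp S (Spec S WD) fst_D2 c \<delta> = lin WD c [a, b] \<and>
    precomp S (Spec S WD) snd_D2 c \<delta> = lin WD c [a, b'] \<and>
    precomp S (Spec S WD) pt_D2 c \<delta> = lin WD c [a, \<zero>\<^bsub>rng S c\<^esub>]" for \<delta> :: "'a \<Rightarrow> 'r list \<Rightarrow> 'r"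
    using ab ab' a' \<gamma>2 by (simp add: eval_nat_numeral All_less_Suc) blast
  show "\<exists>!\<delta>. \<delta> \<in> expo S (Spec S WD2) (line_psh S) c \<and> (\<forall>i<length [WD, WD, WD].
      precomp S (Spec S ([WD, WD, WD] ! i)) ([fst_D2, snd_D2, pt_D2] ! i) c \<delta> = \<gamma> i)"
    unfolding legs
  proof (rule ex1I)
    show "lin WD2 c [a, b, b'] \<in> expo S (Spec S WD2) (line_psh S) c \<and>
      precomp S (Spec S WD) fst_D2 c (lin WD2 c [a, b, b']) = lin WD c [a, b] \<and>
      precomp S (Spec S WD) snd_D2 c (lin WD2 c [a, b, b']) = lin WD c [a, b'] \<and>
      precomp S (Spec S WD) pt_D2 c (lin WD2 c [a, b, b']) = lin WD c [a, \<zero>\<^bsub>rng S c\<^esub>]"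
      using ab ab' lin_D2_expo precomp_lin_D2 by simp
  next
    fix \<delta> :: "'a \<Rightarrow> 'r list \<Rightarrow> 'r"
    assume \<delta>: "\<delta> \<in> expo S (Spec S WD2) (line_psh S) c \<and>
      precomp S (Spec S WD) fst_D2 c \<delta> = lin WD c [a, b] \<and>
      precomp S (Spec S WD) snd_D2 c \<delta> = lin WD c [a, b'] \<and>
      precomp S (Spec S WD) pt_D2 c \<delta> = lin WD c [a, \<zero>\<^bsub>rng S c\<^esub>]"
    obtain u v w where uvw: "u \<in> carrier (rng S c)" "v \<in> carrier (rng S c)" "w \<in> carrier (rng S c)"
      "\<delta> = lin WD2 c [u, v, w]"
      using KL_D2 \<delta> by blast
    then show "\<delta> = lin WD2 c [a, b, b']"
      using \<delta> precomp_lin_D2[of u c v w] lin_D_inject[of c u v a b] lin_D_inject[of c u w a b'] ab ab'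
      by simp
  qed
qed

text \<open>A function a + b d + b' e + g d e that is constant along the axes has b = b' = 0, and a
  + g d e is the pullback of a + g x along multiplication, with both coefficients
  determined.\<close>

lemma line_perceives_DD:
  "perceives_colimit S (line_psh S) [WD, WDD] [(0, 1, fst_DD), (0, 1, snd_DD), (0, 1, pt_DD)] WD
    [pt_D, mult_DD]"
  unfolding perceives_colimit_def
proof (intro allI impI)
  fix c and \<gamma> :: "nat \<Rightarrow> 'a \<Rightarrow> 'r list \<Rightarrow> 'r"
  assume "\<forall>i<length [WD, WDD]. \<gamma> i \<in> expo S (Spec S ([WD, WDD] ! i)) (line_psh S) c"
  then have \<gamma>: "\<gamma> 1 \<in> expo S (Spec S WDD) (line_psh S) c"
    by (auto simp: eval_nat_numeral All_less_Suc)
  assume "\<forall>(i, j, h)\<in>set [(0, 1, fst_DD), (0, 1, snd_DD), (0, 1, pt_DD)].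
    precomp S (Spec S ([WD, WDD] ! i)) h c (\<gamma> j) = \<gamma> i"
  then have edge: "precomp S (Spec S WD) fst_DD c (\<gamma> 1) = \<gamma> 0"
    "precomp S (Spec S WD) snd_DD c (\<gamma> 1) = \<gamma> 0" "precomp S (Spec S WD) pt_DD c (\<gamma> 1) = \<gamma> 0"
    by (auto simp: eval_nat_numeral)
  obtain a b b' g where ab: "a \<in> carrier (rng S c)" "b \<in> carrier (rng S c)" "b' \<in> carrier (rng S c)"
    "g \<in> carrier (rng S c)" "\<gamma> 1 = lin WDD c [a, b, b', g]"
    using KL_DD[OF \<gamma>] .
  have \<gamma>0: "\<gamma> 0 = lin WD c [a, b]" "\<gamma> 0 = lin WD c [a, b']" "\<gamma> 0 = lin WD c [a, \<zero>\<^bsub>rng S c\<^esub>]"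
    using edge precomp_lin_DD ab by simp_all
  \<comment> \<open>The restrictions to the two axes have slopes b and b', and both equal a constant
    family.\<close>
  have b: "b = \<zero>\<^bsub>rng S c\<^esub>" "b' = \<zero>\<^bsub>rng S c\<^esub>"
    using lin_D_inject[OF \<gamma>0(1)[symmetric, unfolded \<gamma>0(3)]]
      lin_D_inject[OF \<gamma>0(2)[symmetric, unfolded \<gamma>0(3)]] ab(1-3)
    by auto
  have \<gamma>1: "\<gamma> (Suc 0) = lin WDD c [a, \<zero>\<^bsub>rng S c\<^esub>, \<zero>\<^bsub>rng S c\<^esub>, g]"
    using ab(5) b by simp
  have legs: "(\<forall>i<length [WD, WDD].
      precomp S (Spec S ([WD, WDD] ! i)) ([pt_D, mult_DD] ! i) c \<delta> = \<gamma> i) \<longleftrightarrow>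
    precomp S (Spec S WD) pt_D c \<delta> = lin WD c [a, \<zero>\<^bsub>rng S c\<^esub>] \<and>
    precomp S (Spec S WDD) mult_DD c \<delta> = lin WDD c [a, \<zero>\<^bsub>rng S c\<^esub>, \<zero>\<^bsub>rng S c\<^esub>, g]"
    for \<delta> :: "'a \<Rightarrow> 'r list \<Rightarrow> 'r"
    using \<gamma>1 \<gamma>0(3) by (auto simp: All_less_Suc)
  show "\<exists>!\<delta>. \<delta> \<in> expo S (Spec S WD) (line_psh S) c \<and> (\<forall>i<length [WD, WDD].
      precomp S (Spec S ([WD, WDD] ! i)) ([pt_D, mult_DD] ! i) c \<delta> = \<gamma> i)"
    unfolding legs
  proof (rule ex1I)
    show "lin WD c [a, g] \<in> expo S (Spec S WD) (line_psh S) c \<and>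
      precomp S (Spec S WD) pt_D c (lin WD c [a, g]) = lin WD c [a, \<zero>\<^bsub>rng S c\<^esub>] \<and>
      precomp S (Spec S WDD) mult_DD c (lin WD c [a, g]) = lin WDD c [a, \<zero>\<^bsub>rng S c\<^esub>, \<zero>\<^bsub>rng S c\<^esub>, g]"
      using ab lin_D_expo precomp_lin by simp
  next
    fix \<delta> :: "'a \<Rightarrow> 'r list \<Rightarrow> 'r"
    assume \<delta>: "\<delta> \<in> expo S (Spec S WD) (line_psh S) c \<and>
      precomp S (Spec S WD) pt_D c \<delta> = lin WD c [a, \<zero>\<^bsub>rng S c\<^esub>] \<and>
      precomp S (Spec S WDD) mult_DD c \<delta> = lin WDD c [a, \<zero>\<^bsub>rng S c\<^esub>, \<zero>\<^bsub>rng S c\<^esub>, g]"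
    obtain u v where uv: "u \<in> carrier (rng S c)" "v \<in> carrier (rng S c)" "\<delta> = lin WD c [u, v]"
      using KL_D \<delta> by blast
    then show "\<delta> = lin WD c [a, g]"
      using \<delta> precomp_lin[of u c v] ab
        lin_inject[OF weil_DD lin_DD_expo[of u c v], of "[a, \<zero>\<^bsub>rng S c\<^esub>, \<zero>\<^bsub>rng S c\<^esub>, g]"]
      by simp
  qed
qed

end

subsection \<open>Microlinear spaces\<close>

context sdg_line
begin

lemma precomp_expo:
  assumes "inf_map S P Q h" "\<delta> \<in> expo S Q X c"
    and "\<And>f p. p \<in> P (Cod S f) \<Longrightarrow> map (rres S f) p \<in> P (Dom S f)"
  shows "precomp S P h c \<delta> \<in> expo S P X c"
  unfolding precomp_def
proof (rule lam_expo)
  fix f g p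
  assume *: "Cod S f = c" "Cod S g = Dom S f" "p \<in> P (Dom S f)"
  then have "h (Dom S g) (map (rres S g) p) = map (rres S g) (h (Dom S f) p)"
    "h (Dom S f) p \<in> Q (Dom S f)"
    using assms(1) by (auto simp: inf_map_def)
  then show "\<delta> (Cmp S f g) (h (Dom S (Cmp S f g)) (map (rres S g) p)) =
      rst X g (\<delta> f (h (Dom S f) p))"
    using * expo_nat[OF assms(2)] by simp
qed (use assms in \<open>auto simp: inf_map_def intro: expo_el\<close>)

lemma precomp_cong:
  assumes "\<And>f p. Cod S f = c \<Longrightarrow> p \<in> P (Dom S f) \<Longrightarrow> \<delta> f (h (Dom S f) p) = \<delta>' f (h' (Dom S f) p)"
  shows "precomp S P h c \<delta> = precomp S P h' c \<delta>'"
  using assms by (auto simp: precomp_def lam_def fun_eq_iff)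

lemma precomp_beta [simp]:
  "Cod S f = c \<Longrightarrow> p \<in> P (Dom S f) \<Longrightarrow> precomp S P h c \<delta> f p = \<delta> f (h (Dom S f) p)"
  by (simp add: precomp_def)

lemma cube_D2_iff: "v \<in> cube_D2 S (Suc 0) 0 c \<longleftrightarrow>
    (\<exists>d e. v = [d, e] \<and> d \<in> DD S c \<and> e \<in> DD S c \<and> d \<otimes>\<^bsub>rng S c\<^esub> e = \<zero>\<^bsub>rng S c\<^esub>)"
  by (auto simp: cube_D2_def cube_def length_Suc_conv)

lemma Spec_D_rres: "p \<in> Spec S WD (Cod S f) \<Longrightarrow> map (rres S f) p \<in> Spec S WD (Dom S f)"
  by (auto simp: Spec_D)

lemma Spec_D2_rres:
  assumes "p \<in> Spec S WD2 (Cod S f)" shows "map (rres S f) p \<in> Spec S WD2 (Dom S f)"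
proof -
  obtain d e where "p = [\<one>\<^bsub>rng S (Cod S f)\<^esub>, d, e]" "d \<in> DD S (Cod S f)" "e \<in> DD S (Cod S f)"
    "d \<otimes>\<^bsub>rng S (Cod S f)\<^esub> e = \<zero>\<^bsub>rng S (Cod S f)\<^esub>"
    using assms by (auto simp: Spec_D2)
  then show ?thesis
    using rres_mult[of f "Cod S f" d e] by (simp add: Spec_D2)
qed

lemma Spec_DD_nth: "p \<in> Spec S WDD c \<Longrightarrow> p ! 1 \<in> DD S c" "p \<in> Spec S WDD c \<Longrightarrow> p ! 2 \<in> DD S c"
  and length_Spec_DD: "p \<in> Spec S WDD c \<Longrightarrow> length p = 4"
  by (auto simp: Spec_DD)

lemma Spec_DD_rres: "p \<in> Spec S WDD (Cod S f) \<Longrightarrow> map (rres S f) p \<in> Spec S WDD (Dom S f)"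
  by (auto simp: Spec_DD)

context
  fixes X :: "('o, 'a, 'x, 'z) psh_data_scheme"
  assumes ml: "microlinear S X"
begin

text \<open>Uniqueness in the colimit property of D(2). Points of \<open>cube_D2\<close> lack the
  leading unit, so both families are pulled back along \<open>tl\<close> to the spectrum, compared
  there, and read back.\<close>

lemma D2_unique:
  assumes l: "l \<in> expo S (cube_D2 S (Suc 0) 0) X c" and l': "l' \<in> expo S (cube_D2 S (Suc 0) 0) X c"
    and fst: "\<And>f d. Cod S f = c \<Longrightarrow> d \<in> DD S (Dom S f) \<Longrightarrow>
      l f [d, \<zero>\<^bsub>rng S (Dom S f)\<^esub>] = l' f [d, \<zero>\<^bsub>rng S (Dom S f)\<^esub>]"
    and snd: "\<And>f d. Cod S f = c \<Longrightarrow> d \<in> DD S (Dom S f) \<Longrightarrow>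
      l f [\<zero>\<^bsub>rng S (Dom S f)\<^esub>, d] = l' f [\<zero>\<^bsub>rng S (Dom S f)\<^esub>, d]"
  shows "l = l'"
proof -
  let ?\<delta> = "precomp S (Spec S WD2) (\<lambda>_. tl) c"
  have map: "inf_map S (Spec S WD2) (cube_D2 S (Suc 0) 0) (\<lambda>_. tl)"
    by (auto simp: inf_map_def Spec_D2 cube_D2_iff)
  have legs: "inf_map S (Spec S WD) (Spec S WD2) fst_D2" "inf_map S (Spec S WD) (Spec S WD2) snd_D2"
    "inf_map S (Spec S WD) (Spec S WD2) pt_D2"
    by (auto simp: inf_map_def Spec_D Spec_D2 leg_defs)
  have \<delta>: "?\<delta> l \<in> expo S (Spec S WD2) X c" "?\<delta> l' \<in> expo S (Spec S WD2) X c"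
    by (intro precomp_expo[OF map] l l' Spec_D2_rres; assumption)+
  \<comment> \<open>The cocone data are the restrictions of \<open>l\<close> itself, so
    \<open>l\<close> is one solution by construction and \<open>l'\<close> is another by
    hypothesis.\<close>
  define \<gamma> where "\<gamma> i = precomp S (Spec S WD) ([fst_D2, snd_D2, pt_D2] ! i) c (?\<delta> l)" for i
  have in_Spec: "[\<one>\<^bsub>rng S b\<^esub>, d, \<zero>\<^bsub>rng S b\<^esub>] \<in> Spec S WD2 b"
    "[\<one>\<^bsub>rng S b\<^esub>, \<zero>\<^bsub>rng S b\<^esub>, d] \<in> Spec S WD2 b" if "d \<in> DD S b" for b d
    using that by (auto simp: Spec_D2)
  have "perceives_colimit S X [WD, WD, WD] [(2, 0, pt_D), (2, 1, pt_D)] WD2 [fst_D2, snd_D2, pt_D2]"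
    using ml cocone_D2 line_perceives_D2 unfolding microlinear_def by blast
  moreover have "\<gamma> i \<in> expo S (Spec S ([WD, WD, WD] ! i)) X c" if "i < length [WD, WD, WD]" for i
    using that unfolding \<gamma>_def
    by (auto simp: less_Suc_eq intro!: precomp_expo legs \<delta> Spec_D_rres)
  moreover have "\<forall>(i, j, h)\<in>set [(2, 0, pt_D), (2, 1, pt_D)].
      precomp S (Spec S ([WD, WD, WD] ! i)) h c (\<gamma> j) = \<gamma> i"
    by (auto simp: \<gamma>_def Spec_D in_Spec leg_defs intro!: precomp_cong)
  ultimately have ex1: "\<exists>!\<delta>. \<delta> \<in> expo S (Spec S WD2) X c \<and> (\<forall>i<length [WD, WD, WD].
      precomp S (Spec S ([WD, WD, WD] ! i)) ([fst_D2, snd_D2, pt_D2] ! i) c \<delta> = \<gamma> i)"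
    unfolding perceives_colimit_def by blast
  have "\<forall>i<length [WD, WD, WD].
      precomp S (Spec S ([WD, WD, WD] ! i)) ([fst_D2, snd_D2, pt_D2] ! i) c (?\<delta> l) = \<gamma> i"
    by (simp add: \<gamma>_def less_Suc_eq All_less_Suc)
  moreover have "\<forall>i<length [WD, WD, WD].
      precomp S (Spec S ([WD, WD, WD] ! i)) ([fst_D2, snd_D2, pt_D2] ! i) c (?\<delta> l') = \<gamma> i"
    using fst snd
    by (auto simp: \<gamma>_def less_Suc_eq All_less_Suc Spec_D in_Spec leg_defs intro!: precomp_cong)
  ultimately have eq: "?\<delta> l = ?\<delta> l'"
    using ex1 \<delta> by blast
  show ?thesis
  proof (rule expo_eqI[OF l l'])
    fix f v assume f: "Cod S f = c" and v: "v \<in> cube_D2 S (Suc 0) 0 (Dom S f)"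
    then have "\<one>\<^bsub>rng S (Dom S f)\<^esub> # v \<in> Spec S WD2 (Dom S f)"
      by (auto simp: cube_D2_iff Spec_D2)
    then show "l f v = l' f v"
      using fun_cong[OF fun_cong[OF eq], of f "\<one>\<^bsub>rng S (Dom S f)\<^esub> # v"] f by simp
  qed
qed

text \<open>The colimit property of the multiplication cocone, with the edge conditions reduced to
  equations between values at points of D.\<close>

lemma DD_ex1:
  assumes \<gamma>0: "\<gamma>0 \<in> expo S (Spec S WD) X c" and \<gamma>1: "\<gamma>1 \<in> expo S (Spec S WDD) X c"
    and eq: "\<And>f d. Cod S f = c \<Longrightarrow> d \<in> DD S (Dom S f) \<Longrightarrow>
      \<gamma>1 f (fst_DD (Dom S f) [\<one>\<^bsub>rng S (Dom S f)\<^esub>, d]) = \<gamma>0 f [\<one>\<^bsub>rng S (Dom S f)\<^esub>, d] \<and>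
      \<gamma>1 f (snd_DD (Dom S f) [\<one>\<^bsub>rng S (Dom S f)\<^esub>, d]) = \<gamma>0 f [\<one>\<^bsub>rng S (Dom S f)\<^esub>, d] \<and>
      \<gamma>1 f (pt_DD (Dom S f) [\<one>\<^bsub>rng S (Dom S f)\<^esub>, d]) = \<gamma>0 f [\<one>\<^bsub>rng S (Dom S f)\<^esub>, d]"
  shows "\<exists>!\<delta>. \<delta> \<in> expo S (Spec S WD) X c \<and> precomp S (Spec S WD) pt_D c \<delta> = \<gamma>0 \<and>
    precomp S (Spec S WDD) mult_DD c \<delta> = \<gamma>1"
proof -
  have pc: "perceives_colimit S X [WD, WDD] [(0, 1, fst_DD), (0, 1, snd_DD), (0, 1, pt_DD)] WD
    [pt_D, mult_DD]"
    using ml cocone_DD line_perceives_DD unfolding microlinear_def by blast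
  define \<gamma> where "\<gamma> i = [\<gamma>0, \<gamma>1] ! i" for i
  have "\<forall>i<length [WD, WDD]. \<gamma> i \<in> expo S (Spec S ([WD, WDD] ! i)) X c"
    using \<gamma>0 \<gamma>1 by (simp add: \<gamma>_def All_less_Suc)
  moreover have "precomp S (Spec S WD) h c \<gamma>1 = \<gamma>0"
    if "h \<in> {fst_DD, snd_DD, pt_DD}" for h
  proof -
    have "precomp S (Spec S WD) h c \<gamma>1 f p = \<gamma>0 f p" for f p
      using that eq[of f] expo_undefined[OF \<gamma>0, of f p]
      by (auto simp: precomp_def lam_def Spec_D)
    then show ?thesis
      by (simp add: fun_eq_iff)
  qed
  then have "\<forall>(i, j, h)\<in>set [(0, 1, fst_DD), (0, 1, snd_DD), (0, 1, pt_DD)].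
      precomp S (Spec S ([WD, WDD] ! i)) h c (\<gamma> j) = \<gamma> i"
    by (simp add: \<gamma>_def)
  ultimately have "\<exists>!\<delta>. \<delta> \<in> expo S (Spec S WD) X c \<and> (\<forall>i<length [WD, WDD].
      precomp S (Spec S ([WD, WDD] ! i)) ([pt_D, mult_DD] ! i) c \<delta> = \<gamma> i)"
    using pc unfolding perceives_colimit_def by blast
  moreover have "(\<forall>i<length [WD, WDD].
      precomp S (Spec S ([WD, WDD] ! i)) ([pt_D, mult_DD] ! i) c \<delta> = \<gamma> i) \<longleftrightarrow>
      precomp S (Spec S WD) pt_D c \<delta> = \<gamma>0 \<and> precomp S (Spec S WDD) mult_DD c \<delta> = \<gamma>1" for \<delta>
    by (auto simp: \<gamma>_def All_less_Suc)
  ultimately show ?thesis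
    by simp
qed

text \<open>Both families factor the pullback of \<open>w\<close> along multiplication, and such a
  factorization is unique. That this pullback is constant along the axes needs no hypothesis, as a
  product with 0 is 0.\<close>

lemma mult_unique:
  assumes w: "w \<in> expo S (cube S (Suc 0)) X c" and w': "w' \<in> expo S (cube S (Suc 0)) X c"
    and eq: "\<And>f d e. Cod S f = c \<Longrightarrow> d \<in> DD S (Dom S f) \<Longrightarrow> e \<in> DD S (Dom S f) \<Longrightarrow>
      w f [d \<otimes>\<^bsub>rng S (Dom S f)\<^esub> e] = w' f [d \<otimes>\<^bsub>rng S (Dom S f)\<^esub> e]"
  shows "w = w'"
proof -
  let ?\<delta> = "precomp S (Spec S WD) (\<lambda>_. tl) c"
  have map: "inf_map S (Spec S WD) (cube S (Suc 0)) (\<lambda>_. tl)"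
    "inf_map S (Spec S WD) (Spec S WD) pt_D" "inf_map S (Spec S WDD) (Spec S WD) mult_DD"
    by (auto simp: inf_map_def Spec_D Spec_DD leg_defs)
  have \<delta>: "?\<delta> w \<in> expo S (Spec S WD) X c" "?\<delta> w' \<in> expo S (Spec S WD) X c"
    by (intro precomp_expo[OF map(1)] w w' Spec_D_rres; assumption)+
  have in_Spec: "[\<one>\<^bsub>rng S b\<^esub>, d] \<in> Spec S WD b" if "d \<in> DD S b" for b d
    using that by (auto simp: Spec_D)
  have in_Spec': "[\<one>\<^bsub>rng S b\<^esub>, d, \<zero>\<^bsub>rng S b\<^esub>, \<zero>\<^bsub>rng S b\<^esub>] \<in> Spec S WDD b"
    "[\<one>\<^bsub>rng S b\<^esub>, \<zero>\<^bsub>rng S b\<^esub>, d, \<zero>\<^bsub>rng S b\<^esub>] \<in> Spec S WDD b" if "d \<in> DD S b" for b d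
    using that by (force simp: Spec_DD)+
  let ?\<gamma>0 = "precomp S (Spec S WD) pt_D c (?\<delta> w)" and ?\<gamma>1 = "precomp S (Spec S WDD) mult_DD c (?\<delta> w)"
  have "\<exists>!\<delta>. \<delta> \<in> expo S (Spec S WD) X c \<and> precomp S (Spec S WD) pt_D c \<delta> = ?\<gamma>0 \<and>
    precomp S (Spec S WDD) mult_DD c \<delta> = ?\<gamma>1"
  proof (rule DD_ex1)
    show "?\<gamma>0 \<in> expo S (Spec S WD) X c" "?\<gamma>1 \<in> expo S (Spec S WDD) X c"
      by (intro precomp_expo[OF map(2)] precomp_expo[OF map(3)] \<delta> Spec_D_rres Spec_DD_rres; assumption)+
  qed (auto simp: leg_defs in_Spec in_Spec')
  \<comment> \<open>The value at the origin is the case where both factors are 0.\<close>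
  moreover have "precomp S (Spec S WD) pt_D c (?\<delta> w') = ?\<gamma>0"
    using eq[of f "\<zero>\<^bsub>rng S (Dom S f)\<^esub>" "\<zero>\<^bsub>rng S (Dom S f)\<^esub>" for f]
    by (intro precomp_cong) (auto simp: Spec_D leg_defs)
  moreover have "precomp S (Spec S WDD) mult_DD c (?\<delta> w') = ?\<gamma>1"
    using eq by (intro precomp_cong) (auto simp: Spec_D Spec_DD leg_defs)
  ultimately have eq: "?\<delta> w = ?\<delta> w'"
    using \<delta> by blast
  show ?thesis
  proof (rule expo_eqI[OF w w'])
    fix f v assume f: "Cod S f = c" and v: "v \<in> cube S (Suc 0) (Dom S f)"
    then have "\<one>\<^bsub>rng S (Dom S f)\<^esub> # v \<in> Spec S WD (Dom S f)"
      by (auto simp: Spec_D elim: cube_1E)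
    then show "w f v = w' f v"
      using fun_cong[OF fun_cong[OF eq], of f "\<one>\<^bsub>rng S (Dom S f)\<^esub> # v"] f by simp
  qed
qed

text \<open>The existence half: \<open>u\<close> is a natural family on D x D whose values on both
  axes equal the value at the origin, so it descends along multiplication.\<close>

lemma mult_factor:
  assumes el: "\<And>f d e. Cod S f = c \<Longrightarrow> d \<in> DD S (Dom S f) \<Longrightarrow> e \<in> DD S (Dom S f) \<Longrightarrow>
      u f d e \<in> el X (Dom S f)"
    and nat: "\<And>f g d e. Cod S f = c \<Longrightarrow> Cod S g = Dom S f \<Longrightarrow> d \<in> DD S (Dom S f) \<Longrightarrow>
      e \<in> DD S (Dom S f) \<Longrightarrow> u (Cmp S f g) (rres S g d) (rres S g e) = rst X g (u f d e)"
    and zero: "\<And>f d. Cod S f = c \<Longrightarrow> d \<in> DD S (Dom S f) \<Longrightarrow>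
      u f d \<zero>\<^bsub>rng S (Dom S f)\<^esub> = u f \<zero>\<^bsub>rng S (Dom S f)\<^esub> \<zero>\<^bsub>rng S (Dom S f)\<^esub> \<and>
      u f \<zero>\<^bsub>rng S (Dom S f)\<^esub> d = u f \<zero>\<^bsub>rng S (Dom S f)\<^esub> \<zero>\<^bsub>rng S (Dom S f)\<^esub>"
  obtains w where "w \<in> expo S (cube S (Suc 0)) X c"
    "\<And>f d e. Cod S f = c \<Longrightarrow> d \<in> DD S (Dom S f) \<Longrightarrow> e \<in> DD S (Dom S f) \<Longrightarrow>
      u f d e = w f [d \<otimes>\<^bsub>rng S (Dom S f)\<^esub> e]"
proof -
  \<comment> \<open>At the vertex D the cocone datum is the constant family at the value of
    \<open>u\<close> at the origin; at the vertex D x D it is \<open>u\<close>.\<close>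
  define \<gamma>0 where "\<gamma>0 = lam S (Spec S WD) c (\<lambda>f p. u f \<zero>\<^bsub>rng S (Dom S f)\<^esub> \<zero>\<^bsub>rng S (Dom S f)\<^esub>)"
  define \<gamma>1 where "\<gamma>1 = lam S (Spec S WDD) c (\<lambda>f p. u f (p ! 1) (p ! 2))"
  have in_Spec': "[\<one>\<^bsub>rng S b\<^esub>, d, \<zero>\<^bsub>rng S b\<^esub>, \<zero>\<^bsub>rng S b\<^esub>] \<in> Spec S WDD b"
    "[\<one>\<^bsub>rng S b\<^esub>, \<zero>\<^bsub>rng S b\<^esub>, d, \<zero>\<^bsub>rng S b\<^esub>] \<in> Spec S WDD b" if "d \<in> DD S b" for b d
    using that by (force simp: Spec_DD)+
  have \<gamma>0: "\<gamma>0 \<in> expo S (Spec S WD) X c"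
    unfolding \<gamma>0_def
  proof (rule lam_expo)
    fix f g p assume "Cod S f = c" "Cod S g = Dom S f"
    then show "u (Cmp S f g) \<zero>\<^bsub>rng S (Dom S (Cmp S f g))\<^esub> \<zero>\<^bsub>rng S (Dom S (Cmp S f g))\<^esub> =
        rst X g (u f \<zero>\<^bsub>rng S (Dom S f)\<^esub> \<zero>\<^bsub>rng S (Dom S f)\<^esub>)"
      using nat[of f g "\<zero>\<^bsub>rng S (Dom S f)\<^esub>" "\<zero>\<^bsub>rng S (Dom S f)\<^esub>"] by simp
  qed (auto simp: el Spec_D_rres)
  have \<gamma>1: "\<gamma>1 \<in> expo S (Spec S WDD) X c"
    unfolding \<gamma>1_def
  proof (rule lam_expo)
    fix f g p assume *: "Cod S f = c" "Cod S g = Dom S f" "p \<in> Spec S WDD (Dom S f)"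
    then show "u (Cmp S f g) (map (rres S g) p ! 1) (map (rres S g) p ! 2) =
        rst X g (u f (p ! 1) (p ! 2))"
      using nat[OF *(1,2) Spec_DD_nth[OF *(3)]] length_Spec_DD[OF *(3)] by simp
  next
    fix f p assume *: "Cod S f = c" "p \<in> Spec S WDD (Dom S f)"
    show "u f (p ! 1) (p ! 2) \<in> el X (Dom S f)"
      by (rule el[OF *(1) Spec_DD_nth[OF *(2)]])
  qed (rule Spec_DD_rres)
  have "\<exists>!\<delta>. \<delta> \<in> expo S (Spec S WD) X c \<and> precomp S (Spec S WD) pt_D c \<delta> = \<gamma>0 \<and>
    precomp S (Spec S WDD) mult_DD c \<delta> = \<gamma>1"
  proof (rule DD_ex1[OF \<gamma>0 \<gamma>1], goal_cases)
    case (1 f d)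
    from zero[OF this] show ?case
      using 1 by (simp add: \<gamma>0_def \<gamma>1_def in_Spec' Spec_D leg_defs)
  qed
  then obtain \<delta> where \<delta>: "\<delta> \<in> expo S (Spec S WD) X c" "precomp S (Spec S WDD) mult_DD c \<delta> = \<gamma>1"
    by blast
  define w where "w = precomp S (cube S (Suc 0)) (\<lambda>c v. \<one>\<^bsub>rng S c\<^esub> # v) c \<delta>"
  have "inf_map S (cube S (Suc 0)) (Spec S WD) (\<lambda>c v. \<one>\<^bsub>rng S c\<^esub> # v)"
    by (auto simp: inf_map_def Spec_D elim!: cube_1E)
  then have "w \<in> expo S (cube S (Suc 0)) X c"
    unfolding w_def by (rule precomp_expo[OF _ \<delta>(1)]) simp
  moreover have "u f d e = w f [d \<otimes>\<^bsub>rng S (Dom S f)\<^esub> e]"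
    if *: "Cod S f = c" "d \<in> DD S (Dom S f)" "e \<in> DD S (Dom S f)" for f d e
  proof -
    let ?p = "[\<one>\<^bsub>rng S (Dom S f)\<^esub>, d, e, d \<otimes>\<^bsub>rng S (Dom S f)\<^esub> e]"
    have "?p \<in> Spec S WDD (Dom S f)"
      using * by (auto simp: Spec_DD)
    then show ?thesis
      using fun_cong[OF fun_cong[OF \<delta>(2)], of f ?p] * by (simp add: \<gamma>1_def w_def leg_defs)
  qed
  ultimately show thesis
    by (rule that)
qed

end

end

subsection \<open>Groupoids and group bundles\<close>

lemma exp_rst_beta [simp]: "Cod S f = Dom S h \<Longrightarrow> exp_rst S h \<gamma> f d = \<gamma> (Cmp S h f) d"
  by (simp add: exp_rst_def)

lemma ins_zeros: "ins i e (zeros S c n) = axis S c (Suc n) i e" if "i \<le> n"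
proof -
  have "replicate (Suc n) \<zero>\<^bsub>rng S c\<^esub> =
      replicate i \<zero>\<^bsub>rng S c\<^esub> @ \<zero>\<^bsub>rng S c\<^esub> # replicate (n - i) \<zero>\<^bsub>rng S c\<^esub>"
    using that by (metis replicate_Suc replicate_add le_add_diff_inverse add_Suc_right)
  then show ?thesis
    using that by (simp add: ins_def axis_def zeros_def list_update_append del: replicate_Suc)
qed

locale sdg_groupoid = sdg_line S
  for S :: "('o, 'a, 'r, 'k::comm_ring_1) line_data" +
  fixes M :: "('o, 'a, 'm) psh_data" and G :: "('o, 'a, 'm, 'g) groupoid_data"
  assumes presheaf_M: "presheaf S M" and groupoid: "groupoid S M G"
begin

lemma rst_M [simp]: "Cod S f = c \<Longrightarrow> x \<in> el M c \<Longrightarrow> rst M f x \<in> el M (Dom S f)"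
  and rst_M_Idn [simp]: "x \<in> el M c \<Longrightarrow> rst M (Idn S c) x = x"
  and rst_M_Cmp [simp]: "Cod S g = Dom S f \<Longrightarrow> Cod S f = c \<Longrightarrow> x \<in> el M c \<Longrightarrow>
    rst M (Cmp S f g) x = rst M g (rst M f x)"
  using presheaf_M by (auto simp: presheaf_def)

lemma presheaf_G: "presheaf S G"
  using groupoid by (simp add: groupoid_def)

lemma rst_el [simp]: "Cod S f = c \<Longrightarrow> g \<in> el G c \<Longrightarrow> rst G f g \<in> el G (Dom S f)"
  and rst_Idn [simp]: "g \<in> el G c \<Longrightarrow> rst G (Idn S c) g = g"
  and rst_Cmp [simp]: "Cod S h = Dom S f \<Longrightarrow> Cod S f = c \<Longrightarrow> g \<in> el G c \<Longrightarrow>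
    rst G (Cmp S f h) g = rst G h (rst G f g)"
  using presheaf_G by (auto simp: presheaf_def)

lemma groupoid_at: "groupoid_at (el M c) G c"
  using groupoid by (simp add: groupoid_def)

lemma src_el [simp]: "g \<in> el G c \<Longrightarrow> src G c g \<in> el M c"
  and tgt_el [simp]: "g \<in> el G c \<Longrightarrow> tgt G c g \<in> el M c"
  and idt_el [simp]: "x \<in> el M c \<Longrightarrow> idt G c x \<in> el G c"
  and src_idt [simp]: "x \<in> el M c \<Longrightarrow> src G c (idt G c x) = x"
  and tgt_idt [simp]: "x \<in> el M c \<Longrightarrow> tgt G c (idt G c x) = x"
  using groupoid_at[of c] unfolding groupoid_at_def by blast+

lemma comp_el [simp]: "g \<in> el G c \<Longrightarrow> h \<in> el G c \<Longrightarrow> src G c g = tgt G c h \<Longrightarrow> gcomp G c g h \<in> el G c"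
  and src_comp [simp]: "g \<in> el G c \<Longrightarrow> h \<in> el G c \<Longrightarrow> src G c g = tgt G c h \<Longrightarrow>
    src G c (gcomp G c g h) = src G c h"
  and tgt_comp [simp]: "g \<in> el G c \<Longrightarrow> h \<in> el G c \<Longrightarrow> src G c g = tgt G c h \<Longrightarrow>
    tgt G c (gcomp G c g h) = tgt G c g"
  and comp_assoc: "g \<in> el G c \<Longrightarrow> h \<in> el G c \<Longrightarrow> k \<in> el G c \<Longrightarrow> src G c g = tgt G c h \<Longrightarrow>
    src G c h = tgt G c k \<Longrightarrow> gcomp G c (gcomp G c g h) k = gcomp G c g (gcomp G c h k)"
  and comp_idt [simp]: "g \<in> el G c \<Longrightarrow> src G c g = x \<Longrightarrow> gcomp G c g (idt G c x) = g"
  and idt_comp [simp]: "g \<in> el G c \<Longrightarrow> tgt G c g = x \<Longrightarrow> gcomp G c (idt G c x) g = g"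
  using groupoid_at[of c] unfolding groupoid_at_def by blast+

lemma inv_el [simp]: "g \<in> el G c \<Longrightarrow> ginv G c g \<in> el G c"
  and src_inv [simp]: "g \<in> el G c \<Longrightarrow> src G c (ginv G c g) = tgt G c g"
  and tgt_inv [simp]: "g \<in> el G c \<Longrightarrow> tgt G c (ginv G c g) = src G c g"
  and comp_inv [simp]: "g \<in> el G c \<Longrightarrow> gcomp G c g (ginv G c g) = idt G c (tgt G c g)"
  and inv_comp [simp]: "g \<in> el G c \<Longrightarrow> gcomp G c (ginv G c g) g = idt G c (src G c g)"
  using groupoid_at[of c] unfolding groupoid_at_def by blast+

lemma src_rst [simp]: "Cod S f = c \<Longrightarrow> g \<in> el G c \<Longrightarrow> src G (Dom S f) (rst G f g) = rst M f (src G c g)"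
  and tgt_rst [simp]: "Cod S f = c \<Longrightarrow> g \<in> el G c \<Longrightarrow> tgt G (Dom S f) (rst G f g) = rst M f (tgt G c g)"
  and idt_rst: "Cod S f = c \<Longrightarrow> x \<in> el M c \<Longrightarrow> idt G (Dom S f) (rst M f x) = rst G f (idt G c x)"
  and rst_comp: "Cod S f = c \<Longrightarrow> g \<in> el G c \<Longrightarrow> h \<in> el G c \<Longrightarrow> src G c g = tgt G c h \<Longrightarrow>
    rst G f (gcomp G c g h) = gcomp G (Dom S f) (rst G f g) (rst G f h)"
  using groupoid unfolding groupoid_def by blast+

lemma inv_unique:
  assumes "g \<in> el G c" "h \<in> el G c" "src G c g = tgt G c h"
    and eq: "gcomp G c g h = idt G c (tgt G c g)"
  shows "h = ginv G c g"
proof -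
  have "h = gcomp G c (gcomp G c (ginv G c g) g) h"
    using assms by simp
  also have "\<dots> = gcomp G c (ginv G c g) (gcomp G c g h)"
    using assms by (intro comp_assoc) auto
  also have "\<dots> = ginv G c g"
    using assms by simp
  finally show ?thesis .
qed

text \<open>Naturality of inversion is derived: restriction preserves composition and identities,
  and inverses are unique.\<close>

lemma rst_inv:
  assumes "Cod S f = c" "g \<in> el G c"
  shows "rst G f (ginv G c g) = ginv G (Dom S f) (rst G f g)"
proof (rule inv_unique)
  show "gcomp G (Dom S f) (rst G f g) (rst G f (ginv G c g)) = idt G (Dom S f) (tgt G (Dom S f) (rst G f g))"
    using assms rst_comp[of f c g "ginv G c g"] idt_rst[of f c "tgt G c g"] by simp
qed (use assms in auto)

lemma Acube_expo: "\<gamma> \<in> Acube_at S M G n c x \<Longrightarrow> \<gamma> \<in> expo S (cube S n) G c"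
  by (simp add: Acube_at_def)

lemma Acube_val [simp]:
  assumes "\<gamma> \<in> Acube_at S M G n c x" "Cod S f = c" "d \<in> cube S n (Dom S f)"
  shows "\<gamma> f d \<in> el G (Dom S f)" "src G (Dom S f) (\<gamma> f d) = rst M f x"
  using assms expo_el[OF Acube_expo[OF assms(1)]] unfolding Acube_at_def by blast+

lemma Acube_val_Cmp [simp]:
  assumes "\<gamma> \<in> Acube_at S M G n c x" "Cod S f = c" "Cod S g = Dom S f" "d \<in> cube S n (Dom S g)"
  shows "\<gamma> (Cmp S f g) d \<in> el G (Dom S g)"
    "src G (Dom S g) (\<gamma> (Cmp S f g) d) = rst M (Cmp S f g) x"
  using Acube_val[OF assms(1), of "Cmp S f g" d] assms(2-4) by auto

lemma Acube_Idn: "\<gamma> \<in> Acube_at S M G n c x \<Longrightarrow> \<gamma> (Idn S c) (zeros S c n) = idt G c x"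
  unfolding Acube_at_def by blast

lemma Acube_val_Idn [simp]:
  assumes "\<gamma> \<in> Acube_at S M G n c x" "d \<in> cube S n c"
  shows "\<gamma> (Idn S c) d \<in> el G c" "x \<in> el M c \<Longrightarrow> src G c (\<gamma> (Idn S c) d) = x"
  using Acube_val[OF assms(1), of "Idn S c" d] assms(2) by auto

lemma Acube_nat:
  assumes "\<gamma> \<in> Acube_at S M G n c x" "Cod S f = c" "Cod S g = Dom S f" "d \<in> cube S n (Dom S f)"
  shows "\<gamma> (Cmp S f g) (map (rres S g) d) = rst G g (\<gamma> f d)"
  by (rule expo_nat[OF Acube_expo[OF assms(1)] assms(2-4)])

text \<open>\<open>Acube_at\<close> prescribes the value at the origin at the identity arrow only;
  naturality along \<open>f\<close> carries it to every later stage.\<close>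

lemma Acube_zeros:
  assumes "\<gamma> \<in> Acube_at S M G n c x" "x \<in> el M c" "Cod S f = c"
  shows "\<gamma> f (zeros S (Dom S f) n) = idt G (Dom S f) (rst M f x)"
proof -
  have "\<gamma> (Cmp S (Idn S c) f) (map (rres S f) (zeros S c n)) = rst G f (\<gamma> (Idn S c) (zeros S c n))"
    using assms by (intro Acube_nat) auto
  moreover have "Cmp S (Idn S c) f = f"
    using assms by auto
  ultimately show ?thesis
    using assms by (simp add: Acube_Idn idt_rst)
qed

lemma base_Acube:
  assumes "\<gamma> \<in> Acube_at S M G n c x" "x \<in> el M c"
  shows "base S G n c \<gamma> = x"
  using assms by (simp add: base_def Acube_Idn)

text \<open>The union over base points in \<open>Acube\<close> is disjoint, since
  \<open>base\<close> recovers the point from the value at the origin.\<close>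

lemma Acube_iff:
  "\<gamma> \<in> el (Acube S M G n) c \<longleftrightarrow> base S G n c \<gamma> \<in> el M c \<and> \<gamma> \<in> Acube_at S M G n c (base S G n c \<gamma>)"
  using base_Acube by (auto simp: Acube_def)

lemma Acube_exp_rst:
  assumes "\<gamma> \<in> Acube_at S M G n c x" "x \<in> el M c" "Cod S g = c"
  shows "exp_rst S g \<gamma> \<in> Acube_at S M G n (Dom S g) (rst M g x)"
  unfolding Acube_at_def
proof (intro CollectI conjI allI impI)
  show "exp_rst S g \<gamma> \<in> expo S (cube S n) G (Dom S g)"
  proof (rule expoI)
    fix f d assume "\<not> (Cod S f = Dom S g \<and> d \<in> cube S n (Dom S f))"
    then show "exp_rst S g \<gamma> f d = undefined"
      using expo_undefined[OF Acube_expo[OF assms(1)], of "Cmp S g f" d]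
      by (auto simp: exp_rst_def)
  next
    fix f h d assume *: "Cod S f = Dom S g" "Cod S h = Dom S f" "d \<in> cube S n (Dom S f)"
    then show "exp_rst S g \<gamma> (Cmp S f h) (map (rres S h) d) = rst G h (exp_rst S g \<gamma> f d)"
      using Acube_nat[OF assms(1), of "Cmp S g f" h d] assms by (simp flip: Cmp_assoc)
  qed (use assms in auto)
qed (use assms Acube_zeros[OF assms(1,2), of g] in auto)

lemma Acube_atI:
  assumes "\<And>f d. Cod S f = c \<Longrightarrow> d \<in> cube S n (Dom S f) \<Longrightarrow>
      u f d \<in> el G (Dom S f) \<and> src G (Dom S f) (u f d) = rst M f x"
    and "\<And>f g d. Cod S f = c \<Longrightarrow> Cod S g = Dom S f \<Longrightarrow> d \<in> cube S n (Dom S f) \<Longrightarrow>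
      u (Cmp S f g) (map (rres S g) d) = rst G g (u f d)"
    and "u (Idn S c) (zeros S c n) = idt G c x"
  shows "lam S (cube S n) c u \<in> Acube_at S M G n c x"
  unfolding Acube_at_def using assms by (auto intro!: lam_expo)

lemma Acube_eqI:
  assumes "\<gamma> \<in> Acube_at S M G n c x" "\<delta> \<in> Acube_at S M G n c y"
    and "\<And>f d. Cod S f = c \<Longrightarrow> d \<in> cube S n (Dom S f) \<Longrightarrow> \<gamma> f d = \<delta> f d"
  shows "\<gamma> = \<delta>"
  using assms by (auto intro: expo_eqI dest!: Acube_expo)

end

section \<open>Tangent vectors of a group bundle and their pointwise calculus\<close>

locale sdg_group_bundle = sdg_line S
  for S :: "('o, 'a, 'r, 'k::comm_ring_1) line_data" +
  fixes M :: "('o, 'a, 'm) psh_data" and L :: "('o, 'a, 'm, 'l) groupoid_data"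
  assumes presheaf_M: "presheaf S M" and group_bundle: "group_bundle S M L"
    and microlinear: "microlinear S L"
begin

sublocale L: sdg_groupoid S M L
  using presheaf_M group_bundle by unfold_locales (auto simp: group_bundle_def)

abbreviation "A1 \<equiv> Acube_at S M L (Suc 0)"

lemma src_eq_tgt: "g \<in> el L c \<Longrightarrow> tgt L c g = src L c g"
  using group_bundle by (simp add: group_bundle_def)

lemma A1_val [simp]:
  assumes "t \<in> A1 c x" "Cod S f = c" "d \<in> DD S (Dom S f)"
  shows "t f [d] \<in> el L (Dom S f)" "src L (Dom S f) (t f [d]) = rst M f x"
    "tgt L (Dom S f) (t f [d]) = rst M f x"
  using assms by (auto simp: src_eq_tgt)

lemma A1_nat:
  assumes "t \<in> A1 c x" "Cod S f = c" "Cod S g = Dom S f" "d \<in> DD S (Dom S f)"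
  shows "t (Cmp S f g) [rres S g d] = rst L g (t f [d])"
  using L.Acube_nat[OF assms(1-3), of "[d]"] assms(4) by simp

lemma A1_zero:
  assumes "t \<in> A1 c x" "x \<in> el M c" "Cod S f = c"
  shows "t f [\<zero>\<^bsub>rng S (Dom S f)\<^esub>] = idt L (Dom S f) (rst M f x)"
  using L.Acube_zeros[OF assms] by simp

lemma A1_eqI:
  assumes "s \<in> A1 c x" "t \<in> A1 c y"
    and "\<And>f d. Cod S f = c \<Longrightarrow> d \<in> DD S (Dom S f) \<Longrightarrow> s f [d] = t f [d]"
  shows "s = t"
  using assms by (auto intro!: L.Acube_eqI elim!: cube_1E)

lemma smul_beta:
  assumes "Cod S f = c" "d \<in> DD S (Dom S f)"
  shows "slot_smul S (Suc 0) 0 c a t f [d] = t f [rres S f a \<otimes>\<^bsub>rng S (Dom S f)\<^esub> d]"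
  using assms by (simp add: slot_smul_def)

lemma smul_A1:
  assumes t: "t \<in> A1 c x" and x: "x \<in> el M c" and a: "a \<in> carrier (rng S c)"
  shows "slot_smul S (Suc 0) 0 c a t \<in> A1 c x"
  unfolding slot_smul_def
proof (rule L.Acube_atI)
  fix f g d assume *: "Cod S f = c" "Cod S g = Dom S f" "d \<in> cube S (Suc 0) (Dom S f)"
  then obtain e where "d = [e]" "e \<in> DD S (Dom S f)"
    by (elim cube_1E)
  then show "t (Cmp S f g) ((map (rres S g) d)[0 := rres S (Cmp S f g) a
        \<otimes>\<^bsub>rng S (Dom S (Cmp S f g))\<^esub> map (rres S g) d ! 0]) =
      rst L g (t f (d[0 := rres S f a \<otimes>\<^bsub>rng S (Dom S f)\<^esub> d ! 0]))"
    using A1_nat[OF t *(1,2), of "rres S f a \<otimes>\<^bsub>rng S (Dom S f)\<^esub> e"] * a by simp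
next
  show "t (Idn S c) ((zeros S c (Suc 0))[0 := rres S (Idn S c) a
        \<otimes>\<^bsub>rng S (Dom S (Idn S c))\<^esub> zeros S c (Suc 0) ! 0]) = idt L c x"
    using a x A1_zero[OF t x, of "Idn S c"] by simp
qed (use t a in \<open>auto elim!: cube_1E\<close>)

lemma glue_expo:
  assumes "s \<in> A1 c x" "t \<in> A1 c x"
  shows "lam S (cube_D2 S (Suc 0) 0) c (\<lambda>f v. gcomp L (Dom S f) (s f [v ! 0]) (t f [v ! 1]))
    \<in> expo S (cube_D2 S (Suc 0) 0) L c"
proof (rule lam_expo)
  fix f v assume "v \<in> cube_D2 S (Suc 0) 0 (Cod S f)"
  then obtain d e where "v = [d, e]" "d \<in> DD S (Cod S f)" "e \<in> DD S (Cod S f)"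
    "d \<otimes>\<^bsub>rng S (Cod S f)\<^esub> e = \<zero>\<^bsub>rng S (Cod S f)\<^esub>"
    by (auto simp: cube_D2_iff)
  then show "map (rres S f) v \<in> cube_D2 S (Suc 0) 0 (Dom S f)"
    using rres_mult[of f "Cod S f" d e] by (simp add: cube_D2_iff)
qed (use assms in \<open>auto simp: cube_D2_iff A1_nat L.rst_comp\<close>)

text \<open>On each axis one factor is an identity, so the product satisfies the description;
  \<open>D2_unique\<close> excludes every competitor.\<close>

lemma slot_glue_eq:
  assumes s: "s \<in> A1 c x" and t: "t \<in> A1 c x" and x: "x \<in> el M c"
  shows "slot_glue S M L (Suc 0) 0 c s t =
    lam S (cube_D2 S (Suc 0) 0) c (\<lambda>f v. gcomp L (Dom S f) (s f [v ! 0]) (t f [v ! 1]))"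
    (is "_ = ?l")
  unfolding slot_glue_def
proof (rule the_equality, goal_cases)
  have *: "[d, \<zero>\<^bsub>rng S b\<^esub>] \<in> cube_D2 S (Suc 0) 0 b" "[\<zero>\<^bsub>rng S b\<^esub>, d] \<in> cube_D2 S (Suc 0) 0 b"
    if "d \<in> DD S b" for b d
    using that by (auto simp: cube_D2_iff)
  have l: "?l f [d, \<zero>\<^bsub>rng S (Dom S f)\<^esub>] = s f [d]" "?l f [\<zero>\<^bsub>rng S (Dom S f)\<^esub>, d] = t f [d]"
    if "Cod S f = c" "d \<in> DD S (Dom S f)" for f d
    using that s t x by (auto simp: * A1_zero)
  {
    case 1
    show ?case
      using s t x glue_expo[OF s t] l
      by (auto simp: cube_D2_iff L.base_Acube[OF s] ins_def elim!: cube_1E)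
  next
    case (2 l')
    then have l': "l' \<in> expo S (cube_D2 S (Suc 0) 0) L c"
      and eq: "\<And>f d. Cod S f = c \<Longrightarrow> d \<in> cube S (Suc 0) (Dom S f) \<Longrightarrow>
        l' f (ins (Suc 0) \<zero>\<^bsub>rng S (Dom S f)\<^esub> d) = s f d \<and>
        l' f (ins 0 \<zero>\<^bsub>rng S (Dom S f)\<^esub> d) = t f d"
      by blast+
    show ?case
    proof (rule D2_unique[OF microlinear l' glue_expo[OF s t]])
      fix f d assume f: "Cod S f = c" "d \<in> DD S (Dom S f)"
      show "l' f [d, \<zero>\<^bsub>rng S (Dom S f)\<^esub>] = ?l f [d, \<zero>\<^bsub>rng S (Dom S f)\<^esub>]"
        "l' f [\<zero>\<^bsub>rng S (Dom S f)\<^esub>, d] = ?l f [\<zero>\<^bsub>rng S (Dom S f)\<^esub>, d]"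
        using l[OF f] eq[of f "[d]"] f by (auto simp: ins_def)
    qed
  }
qed

text \<open>The diagonal point with both coordinates d lies in D(2) because d squares to 0, so the
  glueing can be evaluated there.\<close>

lemma add_beta:
  assumes "s \<in> A1 c x" "t \<in> A1 c x" "x \<in> el M c" "Cod S f = c" "d \<in> DD S (Dom S f)"
  shows "slot_add S M L (Suc 0) 0 c s t f [d] = gcomp L (Dom S f) (s f [d]) (t f [d])"
  using assms by (auto simp: slot_add_def slot_glue_eq ins_def cube_D2_iff)

lemma add_A1:
  assumes s: "s \<in> A1 c x" and t: "t \<in> A1 c x" and x: "x \<in> el M c"
  shows "slot_add S M L (Suc 0) 0 c s t \<in> A1 c x"
proof -
  have "slot_add S M L (Suc 0) 0 c s t =
      lam S (cube S (Suc 0)) c (\<lambda>f d. gcomp L (Dom S f) (s f d) (t f d))"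
    unfolding slot_add_def using add_beta[OF assms]
    by (auto simp: lam_def fun_eq_iff slot_add_def elim!: cube_1E)
  also have "\<dots> \<in> A1 c x"
    using assms A1_zero[OF s x, of "Idn S c"] A1_zero[OF t x, of "Idn S c"]
    by (intro L.Acube_atI) (auto elim!: cube_1E simp: A1_nat L.rst_comp)
  finally show ?thesis .
qed

text \<open>On D(2) the families sending (d, e) to the product of the values of \<open>t\<close> at
  d and e, and to the value of \<open>t\<close> at d + e, agree on both axes, hence everywhere;
  evaluation at (d, -d) gives the inverse.\<close>

lemma A1_minus:
  assumes t: "t \<in> A1 c x" and x: "x \<in> el M c" and f: "Cod S f = c" and d: "d \<in> DD S (Dom S f)"
  shows "t f [\<ominus>\<^bsub>rng S (Dom S f)\<^esub> d] = ginv L (Dom S f) (t f [d])"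
proof -
  let ?P = "cube_D2 S (Suc 0) 0"
  define l where "l = lam S ?P c (\<lambda>f v. t f [v ! 0 \<oplus>\<^bsub>rng S (Dom S f)\<^esub> v ! 1])"
  \<comment> \<open>The square of a + e is twice a e, which vanishes on D(2).\<close>
  have add_DD: "a \<oplus>\<^bsub>rng S b\<^esub> e \<in> DD S b"
    if "a \<in> DD S b" "e \<in> DD S b" "a \<otimes>\<^bsub>rng S b\<^esub> e = \<zero>\<^bsub>rng S b\<^esub>" for a b e
    using that R.m_comm[of a b e] by (subst DD_iff) (simp add: R.l_distr R.r_distr)
  have l: "l \<in> expo S ?P L c"
    unfolding l_def
  proof (rule lam_expo)
    fix f v assume "v \<in> ?P (Cod S f)"
    then obtain d e where "v = [d, e]" "d \<in> DD S (Cod S f)" "e \<in> DD S (Cod S f)"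
      "d \<otimes>\<^bsub>rng S (Cod S f)\<^esub> e = \<zero>\<^bsub>rng S (Cod S f)\<^esub>"
      by (auto simp: cube_D2_iff)
    then show "map (rres S f) v \<in> ?P (Dom S f)"
      using rres_mult[of f "Cod S f" d e] by (simp add: cube_D2_iff)
  next
    fix f g v assume *: "Cod S f = c" "Cod S g = Dom S f" "v \<in> ?P (Dom S f)"
    then obtain d e where "v = [d, e]" "d \<in> DD S (Dom S f)" "e \<in> DD S (Dom S f)"
      "d \<otimes>\<^bsub>rng S (Dom S f)\<^esub> e = \<zero>\<^bsub>rng S (Dom S f)\<^esub>"
      by (auto simp: cube_D2_iff)
    then show "t (Cmp S f g) [map (rres S g) v ! 0 \<oplus>\<^bsub>rng S (Dom S (Cmp S f g))\<^esub> map (rres S g) v ! 1] =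
        rst L g (t f [v ! 0 \<oplus>\<^bsub>rng S (Dom S f)\<^esub> v ! 1])"
      using A1_nat[OF t *(1,2) add_DD] * by simp
  qed (use t add_DD in \<open>auto simp: cube_D2_iff\<close>)
  have eq: "lam S ?P c (\<lambda>f v. gcomp L (Dom S f) (t f [v ! 0]) (t f [v ! 1])) = l"
  proof (rule D2_unique[OF microlinear glue_expo[OF t t] l])
    fix f d assume f: "Cod S f = c" "d \<in> DD S (Dom S f)"
    then have "[d, \<zero>\<^bsub>rng S (Dom S f)\<^esub>] \<in> ?P (Dom S f)" "[\<zero>\<^bsub>rng S (Dom S f)\<^esub>, d] \<in> ?P (Dom S f)"
      by (auto simp: cube_D2_iff)
    then show "lam S ?P c (\<lambda>f v. gcomp L (Dom S f) (t f [v ! 0]) (t f [v ! 1])) f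
          [d, \<zero>\<^bsub>rng S (Dom S f)\<^esub>] = l f [d, \<zero>\<^bsub>rng S (Dom S f)\<^esub>]"
      "lam S ?P c (\<lambda>f v. gcomp L (Dom S f) (t f [v ! 0]) (t f [v ! 1])) f
          [\<zero>\<^bsub>rng S (Dom S f)\<^esub>, d] = l f [\<zero>\<^bsub>rng S (Dom S f)\<^esub>, d]"
      using f t x by (simp_all add: l_def A1_zero)
  qed
  \<comment> \<open>The point (d, -d) lies in D(2) since its coordinate product is minus the square
    of d.\<close>
  have "[d, \<ominus>\<^bsub>rng S (Dom S f)\<^esub> d] \<in> ?P (Dom S f)"
    using d by (auto simp: cube_D2_iff R.r_minus)
  then have "gcomp L (Dom S f) (t f [d]) (t f [\<ominus>\<^bsub>rng S (Dom S f)\<^esub> d]) = idt L (Dom S f) (rst M f x)"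
    using fun_cong[OF fun_cong[OF eq], of f "[d, \<ominus>\<^bsub>rng S (Dom S f)\<^esub> d]"] f d A1_zero[OF t x f]
    by (simp add: l_def R.r_neg)
  then show ?thesis
    using t f d by (intro L.inv_unique) auto
qed

lemma zero_A1:
  "x \<in> el M c \<Longrightarrow> lam S (cube S (Suc 0)) c (\<lambda>f d. idt L (Dom S f) (rst M f x)) \<in> A1 c x"
  by (intro L.Acube_atI) (auto simp: L.idt_rst)

lemma sum_A1:
  assumes "set ts \<subseteq> A1 c x" "x \<in> el M c"
  shows "foldr (slot_add S M L (Suc 0) 0 c) ts
    (lam S (cube S (Suc 0)) c (\<lambda>f d. idt L (Dom S f) (rst M f x))) \<in> A1 c x"
  using assms by (induction ts) (auto intro: zero_A1 add_A1)

lemma sum_beta: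
  assumes "set ts \<subseteq> A1 c x" "x \<in> el M c" "Cod S f = c" "d \<in> DD S (Dom S f)"
  shows "foldr (slot_add S M L (Suc 0) 0 c) ts
      (lam S (cube S (Suc 0)) c (\<lambda>f d. idt L (Dom S f) (rst M f x))) f [d] =
    foldr (gcomp L (Dom S f)) (map (\<lambda>t. t f [d]) ts) (idt L (Dom S f) (rst M f x))"
  using assms by (induction ts) (auto simp: add_beta[OF _ sum_A1])

text \<open>Iterated \<open>mult_unique\<close>: multiplication of \<open>Suc m\<close> elements of
  D is epic for tangent vectors of \<open>L\<close>. Agreement is assumed at every later stage,
  which lets the induction restrict to one stage and vary two fresh coordinates there.\<close>

lemma A1_cancel:
  assumes "t \<in> A1 c x" "t' \<in> A1 c x" "x \<in> el M c"
    and "\<And>f d. Cod S f = c \<Longrightarrow> d \<in> cube S (Suc m) (Dom S f) \<Longrightarrow>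
      t f [rprod S (Dom S f) d] = t' f [rprod S (Dom S f) d]"
  shows "t = t'"
  using assms(4)
proof (induction m)
  case 0
  have "t f [d] = t' f [d]" if "Cod S f = c" "d \<in> DD S (Dom S f)" for f d
    using 0[of f "[d]"] that by simp
  then show ?case
    by (rule A1_eqI[OF assms(1,2)])
next
  case (Suc m)
  show ?case
  proof (rule Suc.IH)
    fix f d assume f: "Cod S f = c" and d: "d \<in> cube S (Suc m) (Dom S f)"
    then obtain a d' where ad: "d = a # d'" "a \<in> DD S (Dom S f)" "d' \<in> cube S m (Dom S f)"
      by (cases d) (auto simp: cube_def)
    have carr: "rprod S (Dom S f) d' \<in> carrier (rng S (Dom S f))"
      using cube_carrier[OF ad(3)] by simp
    \<comment> \<open>Scaling by the product of \<open>d'\<close> leaves a tangent vector in the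
      first coordinate alone. The hypothesis gives agreement of both scaled vectors at products u v,
      and \<open>mult_unique\<close> extends it to all of D, in particular to
      \<open>a\<close>.\<close>
    let ?k = "\<lambda>t. slot_smul S (Suc 0) 0 (Dom S f) (rprod S (Dom S f) d') (exp_rst S f t)"
    have k: "?k s \<in> A1 (Dom S f) (rst M f x)" if "s \<in> A1 c x" for s
      using that assms(3) f carr by (intro smul_A1 L.Acube_exp_rst) auto
    have "?k t = ?k t'"
    proof (rule mult_unique[OF microlinear])
      show "?k t \<in> expo S (cube S (Suc 0)) L (Dom S f)" "?k t' \<in> expo S (cube S (Suc 0)) L (Dom S f)"
        using k assms(1,2) L.Acube_expo by blast+
      fix g u v assume g: "Cod S g = Dom S f" "u \<in> DD S (Dom S g)" "v \<in> DD S (Dom S g)"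
      let ?p = "rprod S (Dom S g) (map (rres S g) d')"
      have p: "rres S g (rprod S (Dom S f) d') = ?p"
        using g cube_carrier[OF ad(3)] by simp
      have p': "?p \<in> carrier (rng S (Dom S g))"
        using carr g by (simp flip: p)
      have "?p \<otimes>\<^bsub>rng S (Dom S g)\<^esub> (u \<otimes>\<^bsub>rng S (Dom S g)\<^esub> v) =
          rprod S (Dom S g) (u # v # map (rres S g) d')"
        using p' g by (simp add: R.m_assoc R.m_comm R.m_lcomm)
      moreover have "u # v # map (rres S g) d' \<in> cube S (Suc (Suc m)) (Dom S g)"
        using g ad by simp
      ultimately show "?k t g [u \<otimes>\<^bsub>rng S (Dom S g)\<^esub> v] = ?k t' g [u \<otimes>\<^bsub>rng S (Dom S g)\<^esub> v]"
        using Suc.prems[of "Cmp S f g" "u # v # map (rres S g) d'"] g f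
        by (simp add: smul_beta p)
    qed
    then have "?k t (Idn S (Dom S f)) [a] = ?k t' (Idn S (Dom S f)) [a]"
      by simp
    then show "t f [rprod S (Dom S f) d] = t' f [rprod S (Dom S f) d]"
      using ad f carr R.m_comm[of a "Dom S f" "rprod S (Dom S f) d'"] by (simp add: smul_beta)
  qed
qed

end

subsection \<open>The transported term\<close>

lemma exp_rst_Cmp:
  "category S \<Longrightarrow> Cod S h = Dom S g \<Longrightarrow> exp_rst S (Cmp S g h) \<gamma> = exp_rst S h (exp_rst S g \<gamma>)"
  by (auto simp: exp_rst_def category_def fun_eq_iff)

lemma lin_iso_nat:
  assumes "lin_iso S M E c x y \<phi>" "Cod S f = c" "Cod S g = Dom S f" "e \<in> fib E (Dom S f) (rst M f x)"
  shows "\<phi> (Cmp S f g) (rst E g e) = rst E g (\<phi> f e)"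
  using assms unfolding lin_iso_def by blast

lemma lin_iso_bij:
  assumes "lin_iso S M E c x y \<phi>" "Cod S f = c"
  shows "bij_betw (\<phi> f) (fib E (Dom S f) (rst M f x)) (fib E (Dom S f) (rst M f y))"
  using assms unfolding lin_iso_def by blast

context sdg_line
begin

lemma exp_rst_at_Idn: "exp_rst S g w (Idn S (Dom S g)) = w g"
  by (simp add: exp_rst_def)

lemma map_rres_axis [simp]:
  "Cod S f = c \<Longrightarrow> map (rres S f) (axis S c m i e) = axis S (Dom S f) m i (rres S f e)"
  by (simp add: axis_def map_update)

lemma axis_cube [simp]: "e \<in> DD S c \<Longrightarrow> axis S c m i e \<in> cube S m c"
  using zeros_cube[of c m] by (auto simp: axis_def cube_def dest!: subsetD[OF set_update_subset_insert])

lemma axis_zero [simp]: "axis S c m i \<zero>\<^bsub>rng S c\<^esub> = zeros S c m"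
  unfolding axis_def zeros_def by (induction m arbitrary: i) (auto split: nat.split)

lemma ins_cube [simp]: "e \<in> DD S c \<Longrightarrow> d \<in> cube S n c \<Longrightarrow> i \<le> n \<Longrightarrow> ins i e d \<in> cube S (Suc n) c"
  by (auto simp: cube_def ins_def dest: in_set_takeD in_set_dropD)

lemma map_ins: "map f (ins i e d) = ins i (f e) (map f d)"
  by (simp add: ins_def take_map drop_map)

end

context sdg_groupoid
begin

lemma exp_rst_Idn:
  assumes "\<gamma> \<in> Acube_at S M G n c x"
  shows "exp_rst S (Idn S c) \<gamma> = \<gamma>"
proof (intro ext)
  fix f d
  show "exp_rst S (Idn S c) \<gamma> f d = \<gamma> f d"
    using expo_undefined[OF Acube_expo[OF assms], of f d] by (auto simp: exp_rst_def)
qed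

lemma tgt_nat:
  assumes "\<gamma> \<in> Acube_at S M G n c x" "Cod S f = c" "d \<in> cube S n c"
  shows "tgt G (Dom S f) (\<gamma> f (map (rres S f) d)) = rst M f (tgt G c (\<gamma> (Idn S c) d))"
  using Acube_nat[OF assms(1), of "Idn S c" f d] assms by auto

text \<open>Composing on the right with the inverse of the arrow on the axis moves the source to the
  target of that arrow and makes the value at the origin an identity.\<close>

lemma cube_shift_Acube:
  assumes \<gamma>: "\<gamma> \<in> Acube_at S M G (Suc n) c x" and x: "x \<in> el M c" and i: "i \<le> n" and e: "e \<in> DD S c"
  shows "cube_shift S G n c i e \<gamma> \<in>
    Acube_at S M G n c (tgt G c (\<gamma> (Idn S c) (axis S c (Suc n) i e)))"
  unfolding cube_shift_def
proof (rule Acube_atI)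
  fix f d assume f: "Cod S f = c" "d \<in> cube S n (Dom S f)"
  show "gcomp G (Dom S f) (\<gamma> f (ins i (rres S f e) d))
      (ginv G (Dom S f) (\<gamma> f (axis S (Dom S f) (Suc n) i (rres S f e)))) \<in> el G (Dom S f) \<and>
    src G (Dom S f) (gcomp G (Dom S f) (\<gamma> f (ins i (rres S f e) d))
      (ginv G (Dom S f) (\<gamma> f (axis S (Dom S f) (Suc n) i (rres S f e))))) =
    rst M f (tgt G c (\<gamma> (Idn S c) (axis S c (Suc n) i e)))"
    using f e i x \<gamma> tgt_nat[OF \<gamma>, of f "axis S c (Suc n) i e"] by simp
  fix g assume g: "Cod S g = Dom S f"
  show "gcomp G (Dom S (Cmp S f g)) (\<gamma> (Cmp S f g) (ins i (rres S (Cmp S f g) e) (map (rres S g) d)))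
      (ginv G (Dom S (Cmp S f g))
        (\<gamma> (Cmp S f g) (axis S (Dom S (Cmp S f g)) (Suc n) i (rres S (Cmp S f g) e)))) =
    rst G g (gcomp G (Dom S f) (\<gamma> f (ins i (rres S f e) d))
      (ginv G (Dom S f) (\<gamma> f (axis S (Dom S f) (Suc n) i (rres S f e)))))"
    using f g e i x \<gamma> Acube_nat[OF \<gamma>, of f g "ins i (rres S f e) d"]
      Acube_nat[OF \<gamma>, of f g "axis S (Dom S f) (Suc n) i (rres S f e)"]
    by (simp add: rst_comp rst_inv map_ins)
next
  show "gcomp G (Dom S (Idn S c)) (\<gamma> (Idn S c) (ins i (rres S (Idn S c) e) (zeros S c n)))
      (ginv G (Dom S (Idn S c))
        (\<gamma> (Idn S c) (axis S (Dom S (Idn S c)) (Suc n) i (rres S (Idn S c) e)))) =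
    idt G c (tgt G c (\<gamma> (Idn S c) (axis S c (Suc n) i e)))"
    using e i x \<gamma> by (simp add: ins_zeros)
qed

lemma cube_shift_rst:
  assumes "Cod S g = c" "e \<in> DD S c"
  shows "exp_rst S g (cube_shift S G n c i e \<gamma>) =
    cube_shift S G n (Dom S g) i (rres S g e) (exp_rst S g \<gamma>)"
  using assms by (auto simp: fun_eq_iff cube_shift_def lam_def exp_rst_def)

lemma cube_axis_Acube:
  assumes \<gamma>: "\<gamma> \<in> Acube_at S M G (Suc n) c x" and x: "x \<in> el M c"
  shows "cube_axis S n c i \<gamma> \<in> Acube_at S M G (Suc 0) c x"
  unfolding cube_axis_def One_nat_def
proof (rule Acube_atI)
  fix f g d assume *: "Cod S f = c" "Cod S g = Dom S f" "d \<in> cube S (Suc 0) (Dom S f)"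
  then show "\<gamma> (Cmp S f g) (axis S (Dom S (Cmp S f g)) (Suc n) i (map (rres S g) d ! 0)) =
      rst G g (\<gamma> f (axis S (Dom S f) (Suc n) i (d ! 0)))"
    using Acube_nat[OF \<gamma> *(1,2), of "axis S (Dom S f) (Suc n) i (d ! 0)"]
    by (auto elim!: cube_1E)
qed (use \<gamma> x in \<open>auto simp: Acube_Idn[OF \<gamma>] elim!: cube_1E\<close>)

lemma cube_axis_beta:
  "e \<in> DD S c \<Longrightarrow> cube_axis S n c i \<gamma> (Idn S c) [e] = \<gamma> (Idn S c) (axis S c (Suc n) i e)"
  by (simp add: cube_axis_def)

lemma cube_axis_rst:
  assumes "Cod S g = c"
  shows "exp_rst S g (cube_axis S n c i \<gamma>) = cube_axis S n (Dom S g) i (exp_rst S g \<gamma>)"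
  using assms by (auto simp: fun_eq_iff cube_axis_def lam_def exp_rst_def)

end

context sdg_group_bundle
begin

lemma exp_rst_Idn_beta:
  assumes "s \<in> A1 c x" "Cod S h = c" "e \<in> DD S c"
  shows "s h [rres S h e] = rst L h (s (Idn S c) [e])"
  using A1_nat[OF assms(1), of "Idn S c" h e] assms by auto

lemma rst_A1_bundle: "rst (A1_bundle S M L) = exp_rst S"
  by (simp add: A1_bundle_def Acube_def)

lemma fib_A1: "x \<in> el M c \<Longrightarrow> fib (A1_bundle S M L) c x = A1 c x"
  by (auto simp: fib_def A1_bundle_def L.Acube_iff L.base_Acube)

end

section \<open>Transport along the representation and its compatibility with restriction\<close>

locale sdg_representation = sdg_group_bundle S M L + G: sdg_groupoid S M G
  for S :: "('o, 'a, 'r, 'k::comm_ring_1) line_data"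
    and M :: "('o, 'a, 'm) psh_data" and L :: "('o, 'a, 'm, 'l) groupoid_data"
    and G :: "('o, 'a, 'm, 'g) groupoid_data" +
  fixes \<rho> :: "('o, 'a, 'r, 'm, 'g, 'a \<Rightarrow> 'r list \<Rightarrow> 'l) rep_data"
  assumes representation: "representation S M G (A1_bundle S M L) \<rho>"
    and microlinear_M: "microlinear S M"
begin

abbreviation "E \<equiv> A1_bundle S M L"
abbreviation "\<Phi> \<equiv> Phi_Lin S M E"

lemma rep_hom: "Acube_hom S M G \<Phi> (Suc 0) (fst \<rho>)"
  using representation by (auto simp: representation_def algebroid_hom_def)

lemma rep_nat:
  assumes "t \<in> Acube_at S M G (Suc 0) c x" "x \<in> el M c" "Cod S f = c"
  shows "fst \<rho> (Dom S f) (exp_rst S f t) = exp_rst S f (fst \<rho> c t)"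
  using rep_hom assms by (auto simp: Acube_hom_def Acube_def)

lemma rep_Acube:
  assumes t: "t \<in> Acube_at S M G (Suc 0) c x" and x: "x \<in> el M c"
  shows "fst \<rho> c t \<in> Acube_at S M \<Phi> (Suc 0) c x"
    and "\<And>f d. Cod S f = c \<Longrightarrow> d \<in> cube S (Suc 0) (Dom S f) \<Longrightarrow>
      tgt \<Phi> (Dom S f) (fst \<rho> c t f d) = tgt G (Dom S f) (t f d)"
proof -
  have el: "t \<in> el (Acube S M G (Suc 0)) c"
    using t x by (auto simp: Acube_def)
  then have *: "fst \<rho> c t \<in> el (Acube S M \<Phi> (Suc 0)) c" "base S \<Phi> (Suc 0) c (fst \<rho> c t) = x"
    using rep_hom G.base_Acube[OF t x] unfolding Acube_hom_def by auto
  then obtain y where y: "fst \<rho> c t \<in> Acube_at S M \<Phi> (Suc 0) c y"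
    by (auto simp: Acube_def)
  then have "fst \<rho> c t (Idn S c) (zeros S c (Suc 0)) = idt \<Phi> c y"
    unfolding Acube_at_def by blast
  \<comment> \<open>\<open>Acube_hom\<close> preserves \<open>base\<close>, and the source component
    of the identity arrow of \<open>\<Phi>\<close> at y is y by definition.\<close>
  then have "y = x"
    using *(2) by (simp add: base_def Phi_Lin_def)
  then show "fst \<rho> c t \<in> Acube_at S M \<Phi> (Suc 0) c x"
    using y by simp
  show "\<And>f d. Cod S f = c \<Longrightarrow> d \<in> cube S (Suc 0) (Dom S f) \<Longrightarrow>
      tgt \<Phi> (Dom S f) (fst \<rho> c t f d) = tgt G (Dom S f) (t f d)"
    using rep_hom el unfolding Acube_hom_def by blast
qed

text \<open>The source comes from membership in the tangent bundle of \<open>\<Phi>\<close>, the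
  target from compatibility of the representation with the anchor.\<close>

lemma rep_arrow:
  assumes t: "t \<in> Acube_at S M G (Suc 0) c x" and x: "x \<in> el M c" and e: "e \<in> DD S c"
  obtains \<phi> where "fst \<rho> c t (Idn S c) [e] = (x, tgt G c (t (Idn S c) [e]), \<phi>)"
    "lin_iso S M E c x (tgt G c (t (Idn S c) [e])) \<phi>"
proof -
  obtain x' y \<phi> where eq: "fst \<rho> c t (Idn S c) [e] = (x', y, \<phi>)"
    using prod_cases3 by blast
  have P: "fst \<rho> c t \<in> Acube_at S M \<Phi> (Suc 0) c x"
    by (rule rep_Acube(1)[OF t x])
  have src: "src \<Phi> (Dom S f) (fst \<rho> c t f d) = rst M f x"
    if "Cod S f = c" "d \<in> cube S (Suc 0) (Dom S f)" for f d
    using P that unfolding Acube_at_def by blast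
  have "src \<Phi> c (fst \<rho> c t (Idn S c) [e]) = rst M (Idn S c) x"
    using src[of "Idn S c" "[e]"] e by simp
  moreover have "tgt \<Phi> c (fst \<rho> c t (Idn S c) [e]) = tgt G c (t (Idn S c) [e])"
    using rep_Acube(2)[OF t x, of "Idn S c" "[e]"] e by simp
  moreover have "fst \<rho> c t (Idn S c) [e] \<in> el \<Phi> c"
    using P e expo_el[of "fst \<rho> c t" S "cube S (Suc 0)" \<Phi> c "Idn S c" "[e]"]
    unfolding Acube_at_def by simp
  ultimately have "x' = x" "y = tgt G c (t (Idn S c) [e])" "lin_iso S M E c x' y \<phi>"
    using x by (simp_all add: eq Phi_Lin_def)
  with eq that show thesis
    by blast
qed

lemma rep_zero:
  assumes t: "t \<in> Acube_at S M G (Suc 0) c x" and x: "x \<in> el M c"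
  shows "fst \<rho> c t (Idn S c) [\<zero>\<^bsub>rng S c\<^esub>] = (x, x, fib_lam S M E c x (\<lambda>f e. e))"
  using rep_Acube(1)[OF t x] by (simp add: Acube_at_def Phi_Lin_def)

text \<open>Two naturalities combine: that of the family \<open>fst \<rho> c t\<close> along
  \<open>g\<close>, and that of \<open>fst \<rho>\<close> in its stage.\<close>

lemma rep_arrow_rst:
  assumes t: "t \<in> Acube_at S M G (Suc 0) c x" and x: "x \<in> el M c" and e: "e \<in> DD S c"
    and g: "Cod S g = c" and eq: "fst \<rho> c t (Idn S c) [e] = (x, y, \<phi>)"
  shows "fst \<rho> (Dom S g) (exp_rst S g t) (Idn S (Dom S g)) [rres S g e] =
    (rst M g x, rst M g y, exp_rst S g \<phi>)"
proof -
  have "fst \<rho> c t \<in> expo S (cube S (Suc 0)) \<Phi> c"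
    using rep_Acube(1)[OF t x] by (simp add: Acube_at_def)
  then have "fst \<rho> c t (Cmp S (Idn S c) g) (map (rres S g) [e]) = rst \<Phi> g (fst \<rho> c t (Idn S c) [e])"
    using e g by (intro expo_nat) auto
  then show ?thesis
    using g rep_nat[OF t x g] eq by (auto simp: Phi_Lin_def)
qed

lemma form_A1:
  assumes "\<omega> \<in> forms S M G E n c" "Cod S f = c" "\<gamma> \<in> Acube_at S M G n (Dom S f) x" "x \<in> el M (Dom S f)"
  shows "\<omega> f \<gamma> \<in> A1 (Dom S f) x"
proof -
  have "\<gamma> \<in> el (Acube S M G n) (Dom S f)"
    using assms by (auto simp: Acube_def)
  then have "\<omega> f \<gamma> \<in> fib E (Dom S f) (base S G n (Dom S f) \<gamma>)"
    using assms(1,2) unfolding forms_def by blast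
  then show ?thesis
    using assms by (simp add: G.base_Acube fib_A1)
qed

lemma form_nat:
  assumes "\<omega> \<in> forms S M G E n c" "Cod S f = c" "\<gamma> \<in> Acube_at S M G n (Dom S f) x" "x \<in> el M (Dom S f)"
    "Cod S g = Dom S f"
  shows "\<omega> (Cmp S f g) (exp_rst S g \<gamma>) = exp_rst S g (\<omega> f \<gamma>)"
proof -
  have "\<gamma> \<in> el (Acube S M G n) (Dom S f)"
    using assms by (auto simp: Acube_def)
  then have "\<omega> (Cmp S f g) (exp_rst S g \<gamma>) = rst E g (\<omega> f \<gamma>)"
    using assms(1,2,5) unfolding forms_def by blast
  then show ?thesis
    by (simp add: rst_A1_bundle)
qed

context
  fixes \<omega> n c f \<gamma> x i
  assumes \<omega>: "\<omega> \<in> forms S M G E n c" and f: "Cod S f = c"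
    and \<gamma>: "\<gamma> \<in> Acube_at S M G (Suc n) (Dom S f) x" and x: "x \<in> el M (Dom S f)" and i: "i \<le> n"
begin

lemma form_shift_A1:
  assumes "e \<in> DD S (Dom S f)"
  shows "\<omega> f (cube_shift S G n (Dom S f) i e \<gamma>) \<in>
    A1 (Dom S f) (tgt G (Dom S f) (\<gamma> (Idn S (Dom S f)) (axis S (Dom S f) (Suc n) i e)))"
  using assms by (intro form_A1[OF \<omega> f] G.cube_shift_Acube[OF \<gamma> x i] G.tgt_el G.Acube_val(1)[OF \<gamma>, of "Idn S (Dom S f)", simplified]) auto

lemma form_shift_zero_A1:
  "\<omega> f (cube_shift S G n (Dom S f) i \<zero>\<^bsub>rng S (Dom S f)\<^esub> \<gamma>) \<in> A1 (Dom S f) x"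
  using form_shift_A1[OF DD_zero] x by (simp add: G.Acube_Idn[OF \<gamma>])

text \<open>Bijectivity of the isomorphism on fibres makes the transported vector a genuine preimage
  of the form value. Later arguments use this equation and injectivity in place of
  \<open>inv_into\<close>.\<close>

lemma transported_char:
  assumes e: "e \<in> DD S (Dom S f)"
  obtains \<phi> where
    "fst \<rho> (Dom S f) (cube_axis S n (Dom S f) i \<gamma>) (Idn S (Dom S f)) [e] =
      (x, tgt G (Dom S f) (\<gamma> (Idn S (Dom S f)) (axis S (Dom S f) (Suc n) i e)), \<phi>)"
    "lin_iso S M E (Dom S f) x
      (tgt G (Dom S f) (\<gamma> (Idn S (Dom S f)) (axis S (Dom S f) (Suc n) i e))) \<phi>"
    "transported S M G E \<rho> n \<omega> f \<gamma> i e \<in> A1 (Dom S f) x"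
    "\<phi> (Idn S (Dom S f)) (transported S M G E \<rho> n \<omega> f \<gamma> i e) =
      \<omega> f (cube_shift S G n (Dom S f) i e \<gamma>)"
proof -
  let ?b = "Dom S f" and ?t = "cube_axis S n (Dom S f) i \<gamma>"
  let ?y = "tgt G ?b (\<gamma> (Idn S ?b) (axis S ?b (Suc n) i e))"
  let ?w = "\<omega> f (cube_shift S G n ?b i e \<gamma>)" and ?tr = "transported S M G E \<rho> n \<omega> f \<gamma> i e"
  have y: "?y \<in> el M ?b"
    using \<gamma> e by (intro G.tgt_el) simp
  obtain \<phi> where eq: "fst \<rho> ?b ?t (Idn S ?b) [e] = (x, ?y, \<phi>)" and iso: "lin_iso S M E ?b x ?y \<phi>"
    using rep_arrow[OF G.cube_axis_Acube[OF \<gamma> x] x e] G.cube_axis_beta[OF e] by metis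
  have bij: "bij_betw (\<phi> (Idn S ?b)) (A1 ?b x) (A1 ?b ?y)"
    using lin_iso_bij[OF iso, of "Idn S ?b"] x y by (simp add: fib_A1)
  have w: "?w \<in> A1 ?b ?y"
    by (rule form_shift_A1[OF e])
  have "?tr = inv_into (A1 ?b x) (\<phi> (Idn S ?b)) ?w"
    using w x y by (simp add: transported_def Let_def eq Phi_Lin_def app_def fib_lam_def fib_A1)
  then have "?tr \<in> A1 ?b x" "\<phi> (Idn S ?b) ?tr = ?w"
    using w bij by (auto simp: bij_betw_def inv_into_into f_inv_into_f)
  with eq iso that show thesis
    by blast
qed

lemma transported_A1: "e \<in> DD S (Dom S f) \<Longrightarrow> transported S M G E \<rho> n \<omega> f \<gamma> i e \<in> A1 (Dom S f) x"
  by (rule transported_char)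

text \<open>The isomorphism assigned to parameter 0 is the identity. This is the vanishing at d = 0
  of the difference that is to be factored.\<close>

lemma transported_zero:
  "transported S M G E \<rho> n \<omega> f \<gamma> i \<zero>\<^bsub>rng S (Dom S f)\<^esub> =
    \<omega> f (cube_shift S G n (Dom S f) i \<zero>\<^bsub>rng S (Dom S f)\<^esub> \<gamma>)"
proof -
  let ?b = "Dom S f"
  obtain \<phi> where \<phi>: "fst \<rho> ?b (cube_axis S n ?b i \<gamma>) (Idn S ?b) [\<zero>\<^bsub>rng S ?b\<^esub>] =
      (x, tgt G ?b (\<gamma> (Idn S ?b) (axis S ?b (Suc n) i \<zero>\<^bsub>rng S ?b\<^esub>)), \<phi>)"
    and tr: "transported S M G E \<rho> n \<omega> f \<gamma> i \<zero>\<^bsub>rng S ?b\<^esub> \<in> A1 ?b x"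
    and eq: "\<phi> (Idn S ?b) (transported S M G E \<rho> n \<omega> f \<gamma> i \<zero>\<^bsub>rng S ?b\<^esub>) =
      \<omega> f (cube_shift S G n ?b i \<zero>\<^bsub>rng S ?b\<^esub> \<gamma>)"
    using transported_char[OF DD_zero] by blast
  have "\<phi> = fib_lam S M E ?b x (\<lambda>f e. e)"
    using \<phi>[unfolded rep_zero[OF G.cube_axis_Acube[OF \<gamma> x] x]] by (metis prod.inject)
  then show ?thesis
    using eq tr x by (simp add: fib_lam_def fib_A1)
qed

lemma form_shift_rst:
  assumes g: "Cod S g = Dom S f" and e: "e \<in> DD S (Dom S f)"
  shows "\<omega> (Cmp S f g) (cube_shift S G n (Dom S g) i (rres S g e) (exp_rst S g \<gamma>)) =
    exp_rst S g (\<omega> f (cube_shift S G n (Dom S f) i e \<gamma>))"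
proof -
  have "tgt G (Dom S f) (\<gamma> (Idn S (Dom S f)) (axis S (Dom S f) (Suc n) i e)) \<in> el M (Dom S f)"
    using \<gamma> e by (intro G.tgt_el) simp
  then show ?thesis
    using form_nat[OF \<omega> f G.cube_shift_Acube[OF \<gamma> x i e] _ g] G.cube_shift_rst[OF g e] by simp
qed

end

text \<open>The isomorphism at the later stage, \<open>\<phi> g\<close>, sends both sides to the
  same value of the form, and it is injective on the fibre.\<close>

lemma transported_rst:
  assumes \<omega>: "\<omega> \<in> forms S M G E n c" and f: "Cod S f = c"
    and \<gamma>: "\<gamma> \<in> Acube_at S M G (Suc n) (Dom S f) x" and x: "x \<in> el M (Dom S f)" and i: "i \<le> n"
    and g: "Cod S g = Dom S f" and e: "e \<in> DD S (Dom S f)"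
  shows "transported S M G E \<rho> n \<omega> (Cmp S f g) (exp_rst S g \<gamma>) i (rres S g e) =
    exp_rst S g (transported S M G E \<rho> n \<omega> f \<gamma> i e)" (is "?tr' = exp_rst S g ?tr")
proof -
  let ?b = "Dom S f" and ?b' = "Dom S g"
  let ?y = "tgt G ?b (\<gamma> (Idn S ?b) (axis S ?b (Suc n) i e))"
  have y: "?y \<in> el M ?b"
    using \<gamma> e by (intro G.tgt_el) simp
  obtain \<phi> where \<phi>: "fst \<rho> ?b (cube_axis S n ?b i \<gamma>) (Idn S ?b) [e] = (x, ?y, \<phi>)"
    and iso: "lin_iso S M E ?b x ?y \<phi>" and tr: "?tr \<in> A1 ?b x"
    and eq: "\<phi> (Idn S ?b) ?tr = \<omega> f (cube_shift S G n ?b i e \<gamma>)"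
    using transported_char[OF \<omega> f \<gamma> x i e] by blast
  have Cmp: "Cod S (Cmp S f g) = c" "Dom S (Cmp S f g) = ?b'"
    using f g by auto
  have x': "rst M g x \<in> el M ?b'"
    using x g by simp
  have \<gamma>': "exp_rst S g \<gamma> \<in> Acube_at S M G (Suc n) ?b' (rst M g x)"
    by (rule G.Acube_exp_rst[OF \<gamma> x g])
  have e': "rres S g e \<in> DD S ?b'"
    using e g by simp
  obtain \<phi>' y' where \<phi>': "fst \<rho> ?b' (cube_axis S n ?b' i (exp_rst S g \<gamma>)) (Idn S ?b') [rres S g e] =
      (rst M g x, y', \<phi>')"
    and tr': "?tr' \<in> A1 ?b' (rst M g x)"
    and eq': "\<phi>' (Idn S ?b') ?tr' = \<omega> (Cmp S f g) (cube_shift S G n ?b' i (rres S g e) (exp_rst S g \<gamma>))"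
    using transported_char[OF \<omega> Cmp(1), unfolded Cmp(2), OF \<gamma>' x' i e'] by metis
  \<comment> \<open>The isomorphism belonging to the restricted axis is the restriction of the
    original one, so its component at the identity is the component of \<open>\<phi>\<close> at
    \<open>g\<close>.\<close>
  have "\<phi>' = exp_rst S g \<phi>"
    using \<phi>' rep_arrow_rst[OF G.cube_axis_Acube[OF \<gamma> x] x e g \<phi>]
    unfolding G.cube_axis_rst[OF g] by (metis prod.inject)
  then have "\<phi> g ?tr' = exp_rst S g (\<phi> (Idn S ?b) ?tr)"
    using eq eq' form_shift_rst[OF \<omega> f \<gamma> x i g e] g by simp
  also have "\<dots> = \<phi> (Cmp S (Idn S ?b) g) (rst E g ?tr)"
    using tr g x by (subst lin_iso_nat[OF iso]) (simp_all add: fib_A1 rst_A1_bundle)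
  also have "\<dots> = \<phi> g (exp_rst S g ?tr)"
    using Idn_Cmp[of g] g by (simp add: rst_A1_bundle)
  finally have "\<phi> g ?tr' = \<phi> g (exp_rst S g ?tr)" .
  moreover have "inj_on (\<phi> g) (A1 ?b' (rst M g x))"
    using bij_betw_imp_inj_on[OF lin_iso_bij[OF iso g]] fib_A1[OF x'] by simp
  moreover have "exp_rst S g ?tr \<in> A1 ?b' (rst M g x)"
    by (rule L.Acube_exp_rst[OF tr x g])
  ultimately show ?thesis
    using tr' by (auto dest: inj_onD)
qed

end

subsection \<open>Comparison of the two coboundaries\<close>

lemma (in sdg_group_bundle) A1_bundle_simps:
  "vadd (A1_bundle S M L) = slot_add S M L (Suc 0) 0"
  "vsmul (A1_bundle S M L) = slot_smul S (Suc 0) 0"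
  "vzero (A1_bundle S M L) = (\<lambda>c x. lam S (cube S (Suc 0)) c (\<lambda>f d. idt L (Dom S f) (rst M f x)))"
  by (simp_all add: A1_bundle_def)

lemma (in sdg_line) sign_eq: "(\<ominus>\<^bsub>rng S c\<^esub> \<one>\<^bsub>rng S c\<^esub>) [^]\<^bsub>rng S c\<^esub> k =
    (if odd k then \<ominus>\<^bsub>rng S c\<^esub> \<one>\<^bsub>rng S c\<^esub> else \<one>\<^bsub>rng S c\<^esub>)" for k :: nat
  by (induction k) (auto simp: R.l_minus)

context sdg_representation
begin

section \<open>The common value of the two coboundaries\<close>

context
  fixes \<omega> n c
  assumes \<omega>: "\<omega> \<in> forms S M G E n c" and n: "n \<ge> 1"
begin

abbreviation "back \<equiv> transported S M G E \<rho> n \<omega>"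

text \<open>The right-hand side is \<open>(\<omega>(\<gamma>\<^sup>i\<^sub>0) - (\<rho>(\<gamma>\<^sub>i)\<^sub>d)\<^sup>-\<^sup>1(\<omega>(\<gamma>\<^sup>i\<^sub>d)))\<^sub>e\<close>.\<close>

definition factor where
  "factor f \<gamma> i w \<longleftrightarrow> (\<forall>g d e. Cod S g = Dom S f \<longrightarrow> d \<in> DD S (Dom S g) \<longrightarrow> e \<in> DD S (Dom S g) \<longrightarrow>
    w g [d \<otimes>\<^bsub>rng S (Dom S g)\<^esub> e] = gcomp L (Dom S g)
      (\<omega> (Cmp S f g) (cube_shift S G n (Dom S g) i \<zero>\<^bsub>rng S (Dom S g)\<^esub> (exp_rst S g \<gamma>))
        (Idn S (Dom S g)) [e])
      (back (Cmp S f g) (exp_rst S g \<gamma>) i d (Idn S (Dom S g)) [\<ominus>\<^bsub>rng S (Dom S g)\<^esub> e]))"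

text \<open>\<open>mult_factor\<close> supplies \<open>w\<close> as a family in \<open>L\<close>,
  given naturality of forms and of transport; that its values lie over x is then recovered from
  microlinearity of \<open>M\<close>.\<close>

lemma factor_exists:
  assumes f: "Cod S f = c" and \<gamma>: "\<gamma> \<in> Acube_at S M G (Suc n) (Dom S f) x"
    and x: "x \<in> el M (Dom S f)" and i: "i \<le> n"
  shows "\<exists>w\<in>A1 (Dom S f) x. factor f \<gamma> i w"
proof -
  let ?b = "Dom S f"
  let ?a = "\<lambda>g. \<omega> (Cmp S f g) (cube_shift S G n (Dom S g) i \<zero>\<^bsub>rng S (Dom S g)\<^esub> (exp_rst S g \<gamma>))"
  let ?t = "\<lambda>g d. back (Cmp S f g) (exp_rst S g \<gamma>) i d"
  let ?u = "\<lambda>g d e. gcomp L (Dom S g) (?a g (Idn S (Dom S g)) [e])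
    (?t g d (Idn S (Dom S g)) [\<ominus>\<^bsub>rng S (Dom S g)\<^esub> e])"
  have a_A1: "?a g \<in> A1 (Dom S g) (rst M g x)"
    and t_A1: "d \<in> DD S (Dom S g) \<Longrightarrow> ?t g d \<in> A1 (Dom S g) (rst M g x)"
    and t_0: "?t g \<zero>\<^bsub>rng S (Dom S g)\<^esub> = ?a g"
    if g: "Cod S g = ?b" for g d
  proof -
    have Cmp: "Cod S (Cmp S f g) = c" "Dom S (Cmp S f g) = Dom S g"
      using f g by auto
    note * = \<omega> Cmp(1) G.Acube_exp_rst[OF \<gamma> x g, folded Cmp(2)] G.rst_M[OF g x, folded Cmp(2)] i
    show "?a g \<in> A1 (Dom S g) (rst M g x)"
      "d \<in> DD S (Dom S g) \<Longrightarrow> ?t g d \<in> A1 (Dom S g) (rst M g x)"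
      "?t g \<zero>\<^bsub>rng S (Dom S g)\<^esub> = ?a g"
      using form_shift_zero_A1[OF *] transported_A1[OF *] transported_zero[OF *] by (simp_all add: Cmp)
  qed
  have a_rst: "?a (Cmp S g h) = exp_rst S h (?a g)"
    and t_rst: "d \<in> DD S (Dom S g) \<Longrightarrow> ?t (Cmp S g h) (rres S h d) = exp_rst S h (?t g d)"
    if g: "Cod S g = ?b" and h: "Cod S h = Dom S g" for g h d
  proof -
    have Cmp: "Cod S (Cmp S f g) = c" "Dom S (Cmp S f g) = Dom S g"
      "Cmp S f (Cmp S g h) = Cmp S (Cmp S f g) h"
      "exp_rst S (Cmp S g h) \<gamma> = exp_rst S h (exp_rst S g \<gamma>)"
      using f g h Cmp_assoc[of g f h] by (auto simp: exp_rst_Cmp[OF category])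
    note * = \<omega> Cmp(1) G.Acube_exp_rst[OF \<gamma> x g, folded Cmp(2)] G.rst_M[OF g x, folded Cmp(2)] i
    show "?a (Cmp S g h) = exp_rst S h (?a g)"
      "d \<in> DD S (Dom S g) \<Longrightarrow> ?t (Cmp S g h) (rres S h d) = exp_rst S h (?t g d)"
      using form_shift_rst[OF *, of h "\<zero>\<^bsub>rng S (Dom S g)\<^esub>"] transported_rst[OF *, of h d] h g
      by (simp_all add: Cmp)
  qed
  obtain w where w: "w \<in> expo S (cube S (Suc 0)) L ?b"
    and eq: "\<And>g d e. Cod S g = ?b \<Longrightarrow> d \<in> DD S (Dom S g) \<Longrightarrow> e \<in> DD S (Dom S g) \<Longrightarrow>
      ?u g d e = w g [d \<otimes>\<^bsub>rng S (Dom S g)\<^esub> e]"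
  proof (rule mult_factor[OF microlinear, of ?b ?u])
    fix g d e assume g: "Cod S g = ?b" and d: "d \<in> DD S (Dom S g)" and e: "e \<in> DD S (Dom S g)"
    have in_A1: "?a g \<in> A1 (Dom S g) (rst M g x)" "?t g d \<in> A1 (Dom S g) (rst M g x)"
      using a_A1 t_A1 g d by auto
    then show "?u g d e \<in> el L (Dom S g)"
      using A1_val[OF in_A1(1), of "Idn S (Dom S g)" e] A1_val[OF in_A1(2), of "Idn S (Dom S g)"] e
      by simp
    fix h assume h: "Cod S h = Dom S g"
    show "?u (Cmp S g h) (rres S h d) (rres S h e) = rst L h (?u g d e)"
      using A1_val[OF in_A1(1), of "Idn S (Dom S g)" e] A1_val[OF in_A1(2), of "Idn S (Dom S g)"] e
        exp_rst_Idn_beta[OF in_A1(1) h e] exp_rst_Idn_beta[OF in_A1(2) h DD_minus[OF e]]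
        a_rst[OF g h] t_rst[OF g h d] h
      by (simp add: L.rst_comp)
  next
    fix g d assume g: "Cod S g = ?b" and d: "d \<in> DD S (Dom S g)"
    have x': "rst M g x \<in> el M (Dom S g)"
      using x g by simp
    have "?u g d \<zero>\<^bsub>rng S (Dom S g)\<^esub> = idt L (Dom S g) (rst M g x)" if "d \<in> DD S (Dom S g)" for d
      using A1_zero[OF a_A1[OF g] x', of "Idn S (Dom S g)"]
        A1_zero[OF t_A1[OF g that] x', of "Idn S (Dom S g)"] x' by simp
    \<comment> \<open>For parameter 0 the transported vector is the form value itself, so the
      product is that of a tangent vector at d and at -d.\<close>
    moreover have "?u g \<zero>\<^bsub>rng S (Dom S g)\<^esub> d = idt L (Dom S g) (rst M g x)"
      using A1_minus[OF a_A1[OF g] x', of "Idn S (Dom S g)" d] d t_0[OF g]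
        A1_val[OF a_A1[OF g], of "Idn S (Dom S g)" d] x' by simp
    ultimately show "?u g d \<zero>\<^bsub>rng S (Dom S g)\<^esub> = ?u g \<zero>\<^bsub>rng S (Dom S g)\<^esub> \<zero>\<^bsub>rng S (Dom S g)\<^esub> \<and>
        ?u g \<zero>\<^bsub>rng S (Dom S g)\<^esub> d = ?u g \<zero>\<^bsub>rng S (Dom S g)\<^esub> \<zero>\<^bsub>rng S (Dom S g)\<^esub>"
      using d by simp
  qed blast
  have u_src: "src L (Dom S g) (?u g d e) = rst M g x"
    if "Cod S g = ?b" "d \<in> DD S (Dom S g)" "e \<in> DD S (Dom S g)" for g d e
    using that A1_val[OF a_A1, of g "Idn S (Dom S g)" e] A1_val[OF t_A1, of g d "Idn S (Dom S g)"] x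
    by simp
  \<comment> \<open>Every product of two elements of D is sent by \<open>w\<close> to an element
    over x. The source of \<open>w\<close> and the constant family at x therefore agree on products,
    hence on D.\<close>
  have "lam S (cube S (Suc 0)) ?b (\<lambda>g v. src L (Dom S g) (w g v)) =
      lam S (cube S (Suc 0)) ?b (\<lambda>g v. rst M g x)"
  proof (rule mult_unique[OF microlinear_M])
    show "lam S (cube S (Suc 0)) ?b (\<lambda>g v. rst M g x) \<in> expo S (cube S (Suc 0)) M ?b"
      by (rule lam_expo) (use x in auto)
    show "lam S (cube S (Suc 0)) ?b (\<lambda>g v. src L (Dom S g) (w g v)) \<in> expo S (cube S (Suc 0)) M ?b"
    proof (rule lam_expo)
      fix g h v assume *: "Cod S g = ?b" "Cod S h = Dom S g" "v \<in> cube S (Suc 0) (Dom S g)"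
      then show "src L (Dom S (Cmp S g h)) (w (Cmp S g h) (map (rres S h) v)) =
          rst M h (src L (Dom S g) (w g v))"
        using expo_nat[OF w *] expo_el[OF w *(1,3)] by simp
    qed (use expo_el[OF w] in auto)
  qed (use eq u_src in \<open>auto simp flip: eq\<close>)
  note src = fun_cong[OF fun_cong[OF this]]
  have "w \<in> A1 ?b x"
    unfolding Acube_at_def
  proof (intro CollectI conjI allI impI w)
    fix g v assume "Cod S g = ?b" "v \<in> cube S (Suc 0) (Dom S g)"
    then show "src L (Dom S g) (w g v) = rst M g x"
      using src[of g v] by simp
  next
    show "w (Idn S ?b) (zeros S ?b (Suc 0)) = idt L ?b x"
      using eq[of "Idn S ?b" "\<zero>\<^bsub>rng S ?b\<^esub>" "\<zero>\<^bsub>rng S ?b\<^esub>"] x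
        A1_zero[OF a_A1, of "Idn S ?b" "Idn S ?b"] A1_zero[OF t_A1, of "Idn S ?b" "\<zero>\<^bsub>rng S ?b\<^esub>" "Idn S ?b"]
      by simp
  qed
  moreover have "factor f \<gamma> i w"
    using eq by (simp add: factor_def)
  ultimately show ?thesis
    by blast
qed

text \<open>Written exactly as the summand in \<open>is_d_plus\<close> for the bundle
  \<open>E\<close>, so that folding this definition rewrites the formula.\<close>

definition plus_term where
  "plus_term f \<gamma> d i = slot_smul S (Suc 0) 0 (Dom S f)
    ((\<ominus>\<^bsub>rng S (Dom S f)\<^esub> \<one>\<^bsub>rng S (Dom S f)\<^esub>) [^]\<^bsub>rng S (Dom S f)\<^esub> Suc i)
    (slot_smul S (Suc 0) 0 (Dom S f) (rprod S (Dom S f) (del i d))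
      (slot_add S M L (Suc 0) 0 (Dom S f)
        (\<omega> f (cube_shift S G n (Dom S f) i \<zero>\<^bsub>rng S (Dom S f)\<^esub> \<gamma>))
        (slot_smul S (Suc 0) 0 (Dom S f) (\<ominus>\<^bsub>rng S (Dom S f)\<^esub> \<one>\<^bsub>rng S (Dom S f)\<^esub>)
          (back f \<gamma> i (d ! i)))))"

text \<open>Chosen independently at each stage, so compatibility with restriction is not visible
  from the definition; \<open>cobd_rst\<close> recovers it for the sum.\<close>

definition part where "part f \<gamma> i = (SOME w. w \<in> A1 (Dom S f) (base S G (Suc n) (Dom S f) \<gamma>) \<and> factor f \<gamma> i w)"

text \<open>The common value of both coboundaries of \<open>\<omega>\<close> at \<open>\<gamma>\<close>.\<close>

definition cobd where
  "cobd f \<gamma> = foldr (slot_add S M L (Suc 0) 0 (Dom S f))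
    (map (\<lambda>i. slot_smul S (Suc 0) 0 (Dom S f)
      ((\<ominus>\<^bsub>rng S (Dom S f)\<^esub> \<one>\<^bsub>rng S (Dom S f)\<^esub>) [^]\<^bsub>rng S (Dom S f)\<^esub> Suc i) (part f \<gamma> i)) [0..<Suc n])
    (lam S (cube S (Suc 0)) (Dom S f) (\<lambda>g d. idt L (Dom S g) (rst M g (base S G (Suc n) (Dom S f) \<gamma>))))"

text \<open>By \<open>A1_minus\<close>, scaling by -1 is pointwise inversion in \<open>L\<close>;
  this matches the additive signs with the exponents of the multiplicative formula.\<close>

lemma smul_sign_beta:
  fixes k :: nat
  assumes "t \<in> A1 b x" "x \<in> el M b" "Cod S g = b" "e \<in> DD S (Dom S g)"
  shows "slot_smul S (Suc 0) 0 b ((\<ominus>\<^bsub>rng S b\<^esub> \<one>\<^bsub>rng S b\<^esub>) [^]\<^bsub>rng S b\<^esub> k) t g [e] =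
    (if odd k then ginv L (Dom S g) else id) (t g [e])"
  using assms by (simp add: smul_beta sign_eq R.l_minus A1_minus[OF assms(1-3)])

context
  fixes f \<gamma> x
  assumes f: "Cod S f = c" and \<gamma>: "\<gamma> \<in> Acube_at S M G (Suc n) (Dom S f) x"
    and x: "x \<in> el M (Dom S f)"
begin

lemma part: "i \<le> n \<Longrightarrow> part f \<gamma> i \<in> A1 (Dom S f) x" "i \<le> n \<Longrightarrow> factor f \<gamma> i (part f \<gamma> i)"
proof -
  assume "i \<le> n"
  then have "\<exists>w. w \<in> A1 (Dom S f) (base S G (Suc n) (Dom S f) \<gamma>) \<and> factor f \<gamma> i w"
    using factor_exists[OF f \<gamma> x] G.base_Acube[OF \<gamma> x] by auto
  from someI_ex[OF this] show "part f \<gamma> i \<in> A1 (Dom S f) x" "factor f \<gamma> i (part f \<gamma> i)"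
    using G.base_Acube[OF \<gamma> x] by (auto simp: part_def)
qed

lemma cobd_terms: "set (map (\<lambda>i. slot_smul S (Suc 0) 0 (Dom S f)
      ((\<ominus>\<^bsub>rng S (Dom S f)\<^esub> \<one>\<^bsub>rng S (Dom S f)\<^esub>) [^]\<^bsub>rng S (Dom S f)\<^esub> Suc i) (part f \<gamma> i)) [0..<Suc n])
    \<subseteq> A1 (Dom S f) x"
  using part x by (auto intro!: smul_A1)

lemma cobd_A1: "cobd f \<gamma> \<in> A1 (Dom S f) x"
  unfolding cobd_def G.base_Acube[OF \<gamma> x] by (rule sum_A1[OF cobd_terms x])

lemma cobd_beta:
  assumes g: "Cod S g = Dom S f" and e: "e \<in> DD S (Dom S g)"
  shows "cobd f \<gamma> g [e] = foldr (gcomp L (Dom S g))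
    (map (\<lambda>i. (if odd (Suc i) then ginv L (Dom S g) else id) (part f \<gamma> i g [e])) [0..<Suc n])
    (idt L (Dom S g) (rst M g x))"
  unfolding cobd_def G.base_Acube[OF \<gamma> x] sum_beta[OF cobd_terms x g e] map_map o_def
  by (intro arg_cong2[where f = "\<lambda>ts. foldr _ ts"] map_cong refl
      smul_sign_beta[OF part(1) x g e]) (simp add: less_Suc_eq_le del: upt_Suc)

text \<open>In the i-th factor take \<open>d ! i\<close> as d and the product of the other
  coordinates as e; then d e is the full product for every i. The left-hand side involves no choice
  of parts.\<close>

lemma times_eq_cobd:
  assumes g: "Cod S g = Dom S f" and d: "d \<in> cube S (Suc n) (Dom S g)"
  shows "foldr (gcomp L (Dom S g))
      (map (\<lambda>i. (if odd (Suc i) then ginv L (Dom S g) else id)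
        (gcomp L (Dom S g)
          (\<omega> (Cmp S f g) (cube_shift S G n (Dom S g) i \<zero>\<^bsub>rng S (Dom S g)\<^esub> (exp_rst S g \<gamma>))
            (Idn S (Dom S g)) [rprod S (Dom S g) (del i d)])
          (back (Cmp S f g) (exp_rst S g \<gamma>) i (d ! i)
            (Idn S (Dom S g)) [\<ominus>\<^bsub>rng S (Dom S g)\<^esub> rprod S (Dom S g) (del i d)])))
        [0..<Suc n])
      (idt L (Dom S g) (base S G (Suc n) (Dom S g) (exp_rst S g \<gamma>))) =
    cobd f \<gamma> g [rprod S (Dom S g) d]"
proof -
  have eq: "part f \<gamma> i g [rprod S (Dom S g) d] = gcomp L (Dom S g)
      (\<omega> (Cmp S f g) (cube_shift S G n (Dom S g) i \<zero>\<^bsub>rng S (Dom S g)\<^esub> (exp_rst S g \<gamma>))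
        (Idn S (Dom S g)) [rprod S (Dom S g) (del i d)])
      (back (Cmp S f g) (exp_rst S g \<gamma>) i (d ! i)
        (Idn S (Dom S g)) [\<ominus>\<^bsub>rng S (Dom S g)\<^esub> rprod S (Dom S g) (del i d)])"
    if i: "i \<le> n" for i
  proof -
    have "del i d \<in> cube S n (Dom S g)"
      using d i by simp
    \<comment> \<open>As n \<ge> 1, a coordinate remains after the deletion, so the product lies in
      D and may serve as e in \<open>factor\<close>.\<close>
    then have "rprod S (Dom S g) (del i d) \<in> DD S (Dom S g)"
      using n by (cases n) auto
    moreover have "d ! i \<otimes>\<^bsub>rng S (Dom S g)\<^esub> rprod S (Dom S g) (del i d) = rprod S (Dom S g) d"
      using d i cube_carrier[OF d] by (intro rprod_del) (auto simp: cube_def)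
    ultimately show ?thesis
      using part(2)[OF i] g d i unfolding factor_def by (metis cube_nth less_Suc_eq_le)
  qed
  show ?thesis
    unfolding cobd_beta[OF g rprod_DD[OF d]] G.base_Acube[OF G.Acube_exp_rst[OF \<gamma> x g] G.rst_M[OF g x]]
    by (intro arg_cong2[where f = "\<lambda>ts. foldr _ ts"] map_cong refl)
       (auto simp: less_Suc_eq_le eq simp del: upt_Suc)
qed

text \<open>Scaling by the product of the other coordinates replaces the argument e by that product
  times e; the factorization then contributes the missing coordinate \<open>d ! i\<close>.\<close>

lemma plus_term_beta:
  assumes d: "d \<in> cube S (Suc n) (Dom S f)" and g: "Cod S g = Dom S f" and e: "e \<in> DD S (Dom S g)"
    and i: "i \<le> n"
  shows "plus_term f \<gamma> d i \<in> A1 (Dom S f) x"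
    and "plus_term f \<gamma> d i g [e] = (if odd (Suc i) then ginv L (Dom S g) else id)
      (part f \<gamma> i g [rres S g (rprod S (Dom S f) d) \<otimes>\<^bsub>rng S (Dom S g)\<^esub> e])"
proof -
  let ?b = "Dom S f" and ?b' = "Dom S g"
  let ?D = "\<lambda>i. slot_add S M L (Suc 0) 0 ?b
    (\<omega> f (cube_shift S G n ?b i \<zero>\<^bsub>rng S ?b\<^esub> \<gamma>))
    (slot_smul S (Suc 0) 0 ?b (\<ominus>\<^bsub>rng S ?b\<^esub> \<one>\<^bsub>rng S ?b\<^esub>) (back f \<gamma> i (d ! i)))"
  let ?T = "\<lambda>i. slot_smul S (Suc 0) 0 ?b (rprod S ?b (del i d)) (?D i)"
  note * = \<omega> f \<gamma> x
  have di: "d ! i \<in> DD S ?b" if "i \<le> n" for i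
    using d that by simp
  have a: "\<omega> f (cube_shift S G n ?b i \<zero>\<^bsub>rng S ?b\<^esub> \<gamma>) \<in> A1 ?b x"
    and t: "back f \<gamma> i (d ! i) \<in> A1 ?b x" if "i \<le> n" for i
    using form_shift_zero_A1[OF * that] transported_A1[OF * that di[OF that]] .
  have del: "rprod S ?b (del i d) \<in> carrier (rng S ?b)" if "i \<le> n" for i
    using that cube_carrier[OF cube_del[OF d, of i]] by simp
  have s: "slot_smul S (Suc 0) 0 ?b (\<ominus>\<^bsub>rng S ?b\<^esub> \<one>\<^bsub>rng S ?b\<^esub>) (back f \<gamma> i (d ! i)) \<in> A1 ?b x"
    if "i \<le> n" for i
    using t[OF that] x by (intro smul_A1) auto
  have D: "?D i \<in> A1 ?b x" if "i \<le> n" for i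
    using a s that x by (intro add_A1) auto
  have T: "?T i \<in> A1 ?b x" if "i \<le> n" for i
    using D del that x by (intro smul_A1) auto
  show "plus_term f \<gamma> d i \<in> A1 ?b x"
    unfolding plus_term_def by (rule smul_A1[OF T[OF i] x]) simp
  let ?p = "rres S g (rprod S ?b d) \<otimes>\<^bsub>rng S ?b'\<^esub> e"
  have "plus_term f \<gamma> d i g [e] = (if odd (Suc i) then ginv L ?b' else id) (part f \<gamma> i g [?p])"
  proof -
    let ?q = "rres S g (rprod S ?b (del i d)) \<otimes>\<^bsub>rng S ?b'\<^esub> e"
    have q: "?q \<in> DD S ?b'"
      using g e del[OF i] by simp
    have "?T i g [e] = ?D i g [?q]"
      using g e by (simp add: smul_beta)
    also have "\<dots> = gcomp L ?b' (\<omega> f (cube_shift S G n ?b i \<zero>\<^bsub>rng S ?b\<^esub> \<gamma>) g [?q])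
        (back f \<gamma> i (d ! i) g [\<ominus>\<^bsub>rng S ?b'\<^esub> ?q])"
      using add_beta[OF a[OF i] s[OF i] x g q] g q by (simp add: smul_beta R.l_minus)
    \<comment> \<open>\<open>factor\<close> is phrased at identity arrows of later stages, so
      evaluation at \<open>g\<close> is traded for restriction along \<open>g\<close>.\<close>
    also have "\<dots> = gcomp L ?b'
      (\<omega> (Cmp S f g) (cube_shift S G n ?b' i \<zero>\<^bsub>rng S ?b'\<^esub> (exp_rst S g \<gamma>)) (Idn S ?b') [?q])
      (back (Cmp S f g) (exp_rst S g \<gamma>) i (rres S g (d ! i)) (Idn S ?b') [\<ominus>\<^bsub>rng S ?b'\<^esub> ?q])"
      using form_shift_rst[OF * i g DD_zero] transported_rst[OF * i g di[OF i]] g by (simp add: exp_rst_at_Idn)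
    also have "\<dots> = part f \<gamma> i g [rres S g (d ! i) \<otimes>\<^bsub>rng S ?b'\<^esub> ?q]"
      using part(2)[OF i] g q di[OF i] unfolding factor_def by simp
    also have "rres S g (d ! i) \<otimes>\<^bsub>rng S ?b'\<^esub> ?q =
        rres S g (d ! i \<otimes>\<^bsub>rng S ?b\<^esub> rprod S ?b (del i d)) \<otimes>\<^bsub>rng S ?b'\<^esub> e"
      using g e del[OF i] di[OF i] by (simp add: R.m_assoc)
    also have "d ! i \<otimes>\<^bsub>rng S ?b\<^esub> rprod S ?b (del i d) = rprod S ?b d"
      using d i cube_carrier[OF d] by (intro rprod_del) (auto simp: cube_def)
    finally show ?thesis
      using smul_sign_beta[OF T[OF i] x g e, of "Suc i"] unfolding plus_term_def by simp
  qed
  then show "plus_term f \<gamma> d i g [e] = (if odd (Suc i) then ginv L ?b' else id) (part f \<gamma> i g [?p])" .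
qed

text \<open>At each e both sides are the ordered product of the signed parts, taken at the full
  coordinate product times e.\<close>

lemma plus_eq_cobd:
  assumes d: "d \<in> cube S (Suc n) (Dom S f)"
  shows "foldr (slot_add S M L (Suc 0) 0 (Dom S f)) (map (plus_term f \<gamma> d) [0..<Suc n])
      (lam S (cube S (Suc 0)) (Dom S f)
        (\<lambda>g d. idt L (Dom S g) (rst M g (base S G (Suc n) (Dom S f) \<gamma>)))) =
    slot_smul S (Suc 0) 0 (Dom S f) (rprod S (Dom S f) d) (cobd f \<gamma>)"
proof -
  have "set (map (plus_term f \<gamma> d) [0..<Suc n]) \<subseteq> A1 (Dom S f) x"
    using plus_term_beta(1)[OF d Cod_Idn, of "\<zero>\<^bsub>rng S (Dom S f)\<^esub>"]
    by (auto simp: less_Suc_eq_le simp del: upt_Suc)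
  note sub = this
  show ?thesis
    unfolding G.base_Acube[OF \<gamma> x]
  proof (rule A1_eqI)
    show "slot_smul S (Suc 0) 0 (Dom S f) (rprod S (Dom S f) d) (cobd f \<gamma>) \<in> A1 (Dom S f) x"
      by (intro smul_A1 cobd_A1 x rprod_closed cube_carrier[OF d])
    fix g e assume g: "Cod S g = Dom S f" and e: "e \<in> DD S (Dom S g)"
    have p: "rres S g (rprod S (Dom S f) d) \<otimes>\<^bsub>rng S (Dom S g)\<^esub> e \<in> DD S (Dom S g)"
      using g e rprod_closed[OF cube_carrier[OF d]] by simp
    show "foldr (slot_add S M L (Suc 0) 0 (Dom S f)) (map (plus_term f \<gamma> d) [0..<Suc n])
        (lam S (cube S (Suc 0)) (Dom S f) (\<lambda>g d. idt L (Dom S g) (rst M g x))) g [e] =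
      slot_smul S (Suc 0) 0 (Dom S f) (rprod S (Dom S f) d) (cobd f \<gamma>) g [e]"
      unfolding sum_beta[OF sub x g e] smul_beta[OF g e] cobd_beta[OF g p] map_map o_def
      by (intro arg_cong2[where f = "\<lambda>ts. foldr _ ts"] map_cong refl plus_term_beta(2)[OF d g e])
         (simp add: less_Suc_eq_le del: upt_Suc)
  qed (rule sum_A1[OF sub x])
qed

end

text \<open>By \<open>times_eq_cobd\<close>, the values of both sides at products of coordinates are
  given by one and the same formula free of choices; \<open>A1_cancel\<close> turns this into
  equality.\<close>

lemma cobd_rst:
  assumes f: "Cod S f = c" and \<gamma>: "\<gamma> \<in> Acube_at S M G (Suc n) (Dom S f) x"
    and x: "x \<in> el M (Dom S f)" and g: "Cod S g = Dom S f"
  shows "cobd (Cmp S f g) (exp_rst S g \<gamma>) = exp_rst S g (cobd f \<gamma>)"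
proof -
  have Cmp: "Cod S (Cmp S f g) = c" "Dom S (Cmp S f g) = Dom S g"
    using f g by auto
  note * = Cmp(1) G.Acube_exp_rst[OF \<gamma> x g, folded Cmp(2)] G.rst_M[OF g x, folded Cmp(2)]
  show ?thesis
  proof (rule A1_cancel)
    show "cobd (Cmp S f g) (exp_rst S g \<gamma>) \<in> A1 (Dom S g) (rst M g x)"
      using cobd_A1[OF *] by (simp add: Cmp)
    show "exp_rst S g (cobd f \<gamma>) \<in> A1 (Dom S g) (rst M g x)"
      by (rule L.Acube_exp_rst[OF cobd_A1[OF f \<gamma> x] x g])
    show "rst M g x \<in> el M (Dom S g)"
      using x g by simp
    fix h d assume h: "Cod S h = Dom S g" and d: "d \<in> cube S (Suc n) (Dom S h)"
    have Cmp2: "Cod S (Cmp S g h) = Dom S f" "Dom S (Cmp S g h) = Dom S h"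
      "Cmp S f (Cmp S g h) = Cmp S (Cmp S f g) h"
      "exp_rst S (Cmp S g h) \<gamma> = exp_rst S h (exp_rst S g \<gamma>)"
      using f g h Cmp_assoc[of g f h] by (auto simp: exp_rst_Cmp[OF category])
    show "cobd (Cmp S f g) (exp_rst S g \<gamma>) h [rprod S (Dom S h) d] =
        exp_rst S g (cobd f \<gamma>) h [rprod S (Dom S h) d]"
      using times_eq_cobd[OF *, of h d] times_eq_cobd[OF f \<gamma> x Cmp2(1), of d] h d
      by (simp only: Cmp Cmp2 exp_rst_beta)
  qed
qed

lemma is_d_plus_iff:
  "is_d_plus S M G E \<rho> n c \<omega> \<eta> \<longleftrightarrow> \<eta> \<in> forms S M G E (Suc n) c \<and>
    (\<forall>f. Cod S f = c \<longrightarrow> (\<forall>\<gamma>\<in>el (Acube S M G (Suc n)) (Dom S f). \<eta> f \<gamma> = cobd f \<gamma>))"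
  (is "?P \<longleftrightarrow> ?\<eta> \<and> ?Q")
proof -
  have "?P \<longleftrightarrow> ?\<eta> \<and> (\<forall>f. Cod S f = c \<longrightarrow> (\<forall>\<gamma>\<in>el (Acube S M G (Suc n)) (Dom S f).
    \<forall>d\<in>cube S (Suc n) (Dom S f). slot_smul S (Suc 0) 0 (Dom S f) (rprod S (Dom S f) d) (\<eta> f \<gamma>) =
      slot_smul S (Suc 0) 0 (Dom S f) (rprod S (Dom S f) d) (cobd f \<gamma>)))" (is "_ \<longleftrightarrow> _ \<and> ?R")
    unfolding is_d_plus_def Let_def A1_bundle_simps plus_term_def[symmetric]
  proof (intro conj_cong refl all_cong ball_cong, goal_cases)
    case (1 f \<gamma> d)
    then obtain x where "\<gamma> \<in> Acube_at S M G (Suc n) (Dom S f) x" "x \<in> el M (Dom S f)"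
      by (auto simp: Acube_def)
    with 1 show ?case
      by (simp only: plus_eq_cobd)
  qed
  moreover have ?Q if \<eta>: ?\<eta> and R: ?R
  proof (intro allI impI ballI)
    fix f \<gamma> assume f: "Cod S f = c" and "\<gamma> \<in> el (Acube S M G (Suc n)) (Dom S f)"
    then obtain x where \<gamma>: "\<gamma> \<in> Acube_at S M G (Suc n) (Dom S f) x" and x: "x \<in> el M (Dom S f)"
      by (auto simp: Acube_def)
    show "\<eta> f \<gamma> = cobd f \<gamma>"
    proof (rule A1_cancel[OF form_A1[OF \<eta> f \<gamma> x] cobd_A1[OF f \<gamma> x] x])
      \<comment> \<open>The additive formula equates tangent vectors already scaled by a product of
        n + 1 coordinates. Evaluating them at one more element of D is what raises the number of
        cancelled factors to n + 2.\<close>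
      fix g d assume g: "Cod S g = Dom S f" and "d \<in> cube S (Suc (Suc n)) (Dom S g)"
      then obtain e d' where d: "d = e # d'" "e \<in> DD S (Dom S g)" "d' \<in> cube S (Suc n) (Dom S g)"
        by (cases d) (auto simp: cube_def)
      have "exp_rst S g \<gamma> \<in> el (Acube S M G (Suc n)) (Dom S g)"
        using G.Acube_exp_rst[OF \<gamma> x g] G.rst_M[OF g x] by (auto simp: Acube_def)
      \<comment> \<open>The formula is applied at the later stage to the restricted cube; naturality
        of \<open>\<eta>\<close> and of \<open>cobd\<close> brings it back to
        \<open>\<gamma>\<close>.\<close>
      then have "slot_smul S (Suc 0) 0 (Dom S g) (rprod S (Dom S g) d') (exp_rst S g (\<eta> f \<gamma>)) =
          slot_smul S (Suc 0) 0 (Dom S g) (rprod S (Dom S g) d') (exp_rst S g (cobd f \<gamma>))"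
        using R[rule_format, of "Cmp S f g" "exp_rst S g \<gamma>" d'] f g d(3)
        by (simp add: form_nat[OF \<eta> f \<gamma> x g] cobd_rst[OF f \<gamma> x g])
      from fun_cong[OF fun_cong[OF this], of "Idn S (Dom S g)" "[e]"]
      show "\<eta> f \<gamma> g [rprod S (Dom S g) d] = cobd f \<gamma> g [rprod S (Dom S g) d]"
        using d g rprod_closed[OF cube_carrier[OF d(3)]] R.m_comm[of e "Dom S g" "rprod S (Dom S g) d'"]
        by (simp add: smul_beta exp_rst_at_Idn)
    qed
  qed
  ultimately show ?thesis
    by auto
qed

lemma is_d_times_iff:
  "is_d_times S M G L \<rho> n c \<omega> \<eta> \<longleftrightarrow> \<eta> \<in> forms S M G E (Suc n) c \<and>
    (\<forall>f. Cod S f = c \<longrightarrow> (\<forall>\<gamma>\<in>el (Acube S M G (Suc n)) (Dom S f). \<eta> f \<gamma> = cobd f \<gamma>))"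
  (is "?P \<longleftrightarrow> ?\<eta> \<and> ?Q")
proof -
  have "?P \<longleftrightarrow> ?\<eta> \<and> (\<forall>f. Cod S f = c \<longrightarrow> (\<forall>\<gamma>\<in>el (Acube S M G (Suc n)) (Dom S f).
    \<forall>d\<in>cube S (Suc n) (Dom S f). \<eta> f \<gamma> (Idn S (Dom S f)) [rprod S (Dom S f) d] =
      cobd f \<gamma> (Idn S (Dom S f)) [rprod S (Dom S f) d]))" (is "_ \<longleftrightarrow> _ \<and> ?R")
    unfolding is_d_times_def Let_def
  proof (intro conj_cong refl all_cong ball_cong)
    fix f \<gamma> d assume f: "Cod S f = c" and "\<gamma> \<in> el (Acube S M G (Suc n)) (Dom S f)"
      and d: "d \<in> cube S (Suc n) (Dom S f)"
    then obtain x where \<gamma>: "\<gamma> \<in> Acube_at S M G (Suc n) (Dom S f) x" and x: "x \<in> el M (Dom S f)"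
      by (auto simp: Acube_def)
    note times_eq_cobd[OF f \<gamma> x, of "Idn S (Dom S f)" d, unfolded Dom_Idn Cod_Idn Cmp_Idn
      G.exp_rst_Idn[OF \<gamma>], OF refl d]
    then show "(\<eta> f \<gamma> (Idn S (Dom S f)) [rprod S (Dom S f) d] = foldr (gcomp L (Dom S f))
          (map (\<lambda>i. (if odd (Suc i) then ginv L (Dom S f) else id)
            (gcomp L (Dom S f)
              (\<omega> f (cube_shift S G n (Dom S f) i \<zero>\<^bsub>rng S (Dom S f)\<^esub> \<gamma>) (Idn S (Dom S f))
                [rprod S (Dom S f) (del i d)])
              (back f \<gamma> i (d ! i) (Idn S (Dom S f)) [\<ominus>\<^bsub>rng S (Dom S f)\<^esub> rprod S (Dom S f) (del i d)])))
            [0..<Suc n])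
          (idt L (Dom S f) (base S G (Suc n) (Dom S f) \<gamma>))) =
        (\<eta> f \<gamma> (Idn S (Dom S f)) [rprod S (Dom S f) d] =
          cobd f \<gamma> (Idn S (Dom S f)) [rprod S (Dom S f) d])"
      by (rule arg_cong)
  qed
  moreover have ?Q if \<eta>: ?\<eta> and R: ?R
  proof (intro allI impI ballI)
    fix f \<gamma> assume f: "Cod S f = c" and "\<gamma> \<in> el (Acube S M G (Suc n)) (Dom S f)"
    then obtain x where \<gamma>: "\<gamma> \<in> Acube_at S M G (Suc n) (Dom S f) x" and x: "x \<in> el M (Dom S f)"
      by (auto simp: Acube_def)
    show "\<eta> f \<gamma> = cobd f \<gamma>"
    proof (rule A1_cancel[OF form_A1[OF \<eta> f \<gamma> x] cobd_A1[OF f \<gamma> x] x])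
      fix g d assume g: "Cod S g = Dom S f" and d: "d \<in> cube S (Suc n) (Dom S g)"
      \<comment> \<open>At its own stage the formula only gives values at the identity arrow; the
        value at \<open>g\<close> is obtained from the restricted cube.\<close>
      have "exp_rst S g \<gamma> \<in> el (Acube S M G (Suc n)) (Dom S g)"
        using G.Acube_exp_rst[OF \<gamma> x g] G.rst_M[OF g x] by (auto simp: Acube_def)
      then show "\<eta> f \<gamma> g [rprod S (Dom S g) d] = cobd f \<gamma> g [rprod S (Dom S g) d]"
        using R[rule_format, of "Cmp S f g" "exp_rst S g \<gamma>" d] f g d
        by (simp add: form_nat[OF \<eta> f \<gamma> x g] cobd_rst[OF f \<gamma> x g] exp_rst_at_Idn)
    qed
  qed
  ultimately show ?thesis
    by auto
qed

text \<open>After rewriting, both definite descriptions range over literally the same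
  predicate.\<close>

lemma d_plus_eq_d_times: "d_plus S M G E \<rho> n c \<omega> = d_times S M G L \<rho> n c \<omega>"
  unfolding d_plus_def d_times_def is_d_plus_iff is_d_times_iff ..

end

end

theorem theorem15:
  fixes S :: "('o, 'a, 'r, 'k::comm_ring_1) line_data"
    and M :: "('o, 'a, 'm) psh_data"
    and G :: "('o, 'a, 'm, 'g) groupoid_data"
    and L :: "('o, 'a, 'm, 'l) groupoid_data"
    and \<rho> :: "('o, 'a, 'r, 'm, 'g, 'a \<Rightarrow> 'r list \<Rightarrow> 'l) rep_data"
    and n :: nat
  assumes "line_object S"
    and "presheaf S M" and "microlinear S M"
    and "groupoid S M G" and "microlinear S G"
    and "group_bundle S M L" and "microlinear S L"
    and "microlinear S (Phi_Lin S M (A1_bundle S M L))"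
    and "representation S M G (A1_bundle S M L) \<rho>"
    and "n \<ge> 1"
  shows "\<forall>c. \<forall>\<omega>\<in>forms S M G (A1_bundle S M L) n c.
    d_plus S M G (A1_bundle S M L) \<rho> n c \<omega> = d_times S M G L \<rho> n c \<omega>"
proof -
  interpret sdg_representation S M L G \<rho>
    using assms by unfold_locales
  show ?thesis
    using d_plus_eq_d_times assms by blast
qed

end
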